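(* Let $n\ge 2$ and $r\ge 1$. If $\mathrm{Z}:\mathcal{P}(\mathbb{Z}^n)\to\mathbb{T}^r$ is a translation covariant, $(n+r)$-homogeneous valuation, then there is $c\in\mathbb{R}$ such that $$\mathrm{Z}(P)=c\,\mathrm{L}^r_{n+r}(P)$$ for every $P\in\mathcal{P}(\mathbb{Z}^n)$.
   Context: $\mathbb{N}$ is the set of non-negative integers. $\mathcal{P}(\mathbb{Z}^n)$ is the set of lattice polytopes in $\mathbb{R}^n$, i.e. convex polytopes with vertices in $\mathbb{Z}^n$ (the empty set is included). $\mathbb{T}^r$ is the vector space of symmetric tensors of rank $r$ on $\mathbb{R}^n$, identified via the scalar product with symmetric $r$-linear functionals on $(\mathbb{R}^n)^r$; $\mathbb{T}^0=\mathbb{R}$. For $x\in\mathbb{R}^n$, $x^r\in\mathbb{T}^r$ is the $r$-fold symmetric tensor product, $x^r(v_1,\dots,v_r)=(x\cdot v_1)\cdots(x\cdot v_r)$, and $x^0=1$. Products of symmetric tensors are symmetric tensor products: for $A\in\mathbb{T}^{p}$, $B\in\mathbb{T}^{q}$, $(AB)(v_1,\dots,v_{p+q})=\frac{1}{(p+q)!}\sum_\sigma A(v_{\sigma(1)},\dots,v_{\sigma(p)})B(v_{\sigma(p+1)},\dots,v_{\sigma(p+q)})$, summing over all permutations $\sigma$ of $1,\dots,p+q$. A function $\mathrm{Z}:\mathcal{P}(\mathbb{Z}^n)\to\mathbb{T}^r$ is: a valuation if $\mathrm{Z}(\emptyset)=0$ and $\mathrm{Z}(P)+\mathrm{Z}(Q)=\mathrm{Z}(P\cup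 Q)+\mathrm{Z}(P\cap Q)$ whenever $P,Q,P\cup Q,P\cap Q\in\mathcal{P}(\mathbb{Z}^n)$; $i$-homogeneous if $\mathrm{Z}(kP)=k^i\mathrm{Z}(P)$ for all $k\in\mathbb{N}$ and $P\in\mathcal{P}(\mathbb{Z}^n)$. A valuation $\mathrm{Z}$ is translation covariant if there are functions $\mathrm{Z}^j:\mathcal{P}(\mathbb{Z}^n)\to\mathbb{T}^j$, $j=0,\dots,r$, such that $\mathrm{Z}(P+y)=\sum_{j=0}^r\mathrm{Z}^{r-j}(P)\frac{y^j}{j!}$ for all $y\in\mathbb{Z}^n$ and $P\in\mathcal{P}(\mathbb{Z}^n)$. The discrete moment tensor is $\mathrm{L}^r(P)=\frac1{r!}\sum_{x\in P\cap\mathbb{Z}^n}x^r$. The Ehrhart tensors $\mathrm{L}^r_i:\mathcal{P}(\mathbb{Z}^n)\to\mathbb{T}^r$, $i=1,\dots,n+r$, are the coefficients (which exist and are unique) in $\mathrm{L}^r(kP)=\sum_{i=1}^{n+r}\mathrm{L}^r_i(P)k^i$ for all $k\in\mathbb{N}$ and $P\in\mathcal{P}(\mathbb{Z}^n)$. *)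

theory Defs
  imports "HOL-Analysis.Analysis" "HOL-Combinatorics.Permutations"
begin

definition int_lattice :: "(real ^ 'n) set" where
  "int_lattice = {x. \<forall>i. x $ i \<in> \<int>}"

definition lattice_polytopes :: "(real ^ 'n) set set" where
  "lattice_polytopes =
     {P. polytope P \<and> (\<forall>x. x extreme_point_of P \<longrightarrow> x \<in> int_lattice)}"

text \<open>
  A tensor of rank \<open>r\<close> is a function of a sequence \<open>v\<close> of vectors that depends only on
  \<open>v 0, \<dots>, v (r - 1)\<close>. So tensors of all ranks share one type, the rank being a parameter
  of the carrier set, and equality of tensors of the same rank is equality of functions.
  Rank 0 tensors are the constant functions, i.e. the real numbers.
\<close>

type_synonym 'n tensor = "(nat \<Rightarrow> real ^ 'n) \<Rightarrow> real"

definition sym_tensors :: "nat \<Rightarrow> ('n::finite) tensor set" where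
  "sym_tensors r = {A.
     (\<forall>v w. (\<forall>i<r. v i = w i) \<longrightarrow> A v = A w) \<and>
     (\<forall>v. \<forall>i<r. linear (\<lambda>x. A (v(i := x)))) \<and>
     (\<forall>v \<sigma>. \<sigma> permutes {..<r} \<longrightarrow> A (v \<circ> \<sigma>) = A v)}"

definition sym_prod :: "nat \<Rightarrow> nat \<Rightarrow> ('n::finite) tensor \<Rightarrow> 'n tensor \<Rightarrow> 'n tensor" where
  "sym_prod p q A B = (\<lambda>v.
     (\<Sum>\<sigma> | \<sigma> permutes {..<p + q}. A (\<lambda>i. v (\<sigma> i)) * B (\<lambda>i. v (\<sigma> (p + i)))) / fact (p + q))"

definition tensor_power :: "real ^ 'n \<Rightarrow> nat \<Rightarrow> 'n tensor" where
  "tensor_power x r = (\<lambda>v. \<Prod>i<r. x \<bullet> v i)"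

definition tensor_valuation :: "nat \<Rightarrow> ((real ^ 'n) set \<Rightarrow> 'n tensor) \<Rightarrow> bool" where
  "tensor_valuation r Z \<longleftrightarrow>
     Z \<in> lattice_polytopes \<rightarrow> sym_tensors r \<and>
     (\<forall>v. Z {} v = 0) \<and>
     (\<forall>P Q. P \<in> lattice_polytopes \<and> Q \<in> lattice_polytopes \<and>
            P \<union> Q \<in> lattice_polytopes \<and> P \<inter> Q \<in> lattice_polytopes \<longrightarrow>
            (\<forall>v. Z P v + Z Q v = Z (P \<union> Q) v + Z (P \<inter> Q) v))"

definition homogeneous :: "nat \<Rightarrow> ((real ^ 'n) set \<Rightarrow> 'n tensor) \<Rightarrow> bool" where
  "homogeneous i Z \<longleftrightarrow>
     (\<forall>P\<in>lattice_polytopes. \<forall>k::nat. \<forall>v. Z ((\<lambda>x. real k *\<^sub>R x) ` P) v = real k ^ i * Z P v)"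

definition translation_covariant :: "nat \<Rightarrow> ((real ^ 'n) set \<Rightarrow> 'n tensor) \<Rightarrow> bool" where
  "translation_covariant r Z \<longleftrightarrow>
     (\<exists>Zs :: nat \<Rightarrow> (real ^ 'n) set \<Rightarrow> 'n tensor.
        (\<forall>j\<le>r. Zs j \<in> lattice_polytopes \<rightarrow> sym_tensors j) \<and>
        (\<forall>P\<in>lattice_polytopes. \<forall>y\<in>int_lattice. \<forall>v.
           Z ((\<lambda>x. x + y) ` P) v =
             (\<Sum>j\<le>r. sym_prod (r - j) j (Zs (r - j) P) (tensor_power y j) v / fact j)))"

definition discrete_moment :: "nat \<Rightarrow> (real ^ 'n) set \<Rightarrow> 'n tensor" where
  "discrete_moment r P = (\<lambda>v. (\<Sum>x\<in>P \<inter> int_lattice. tensor_power x r v) / fact r)"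

text \<open>
  The coefficient sequence \<open>c\<close> is constrained only at indices \<open>1, \<dots>, n + r\<close>, so the
  definite description below ranges over the single coefficient rather than over \<open>c\<close>; it is
  meaningful for \<open>r \<ge> 1\<close> and \<open>1 \<le> i \<le> n + r\<close>. (For \<open>r = 0\<close> there is in general also a constant
  term.)
\<close>

definition ehrhart_coeffs :: "nat \<Rightarrow> (real ^ 'n) set \<Rightarrow> (nat \<Rightarrow> 'n tensor) \<Rightarrow> bool" where
  "ehrhart_coeffs r P c \<longleftrightarrow>
     (\<forall>i\<in>{1..CARD('n) + r}. c i \<in> sym_tensors r) \<and>
     (\<forall>k::nat. \<forall>v. discrete_moment r ((\<lambda>x. real k *\<^sub>R x) ` P) v =
                    (\<Sum>i = 1..CARD('n) + r. c i v * real k ^ i))"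

definition ehrhart_tensor :: "nat \<Rightarrow> nat \<Rightarrow> (real ^ 'n) set \<Rightarrow> 'n tensor" where
  "ehrhart_tensor r i P = (THE A. \<exists>c. ehrhart_coeffs r P c \<and> A = c i)"

end

(*
  The leading Ehrhart tensor is, up to the factor k^(n+r), the limit of the discrete moment tensors
  of kP; so it is itself a translation covariant, (n+r)-homogeneous valuation.  Subtract a multiple
  of it from Z so that the translation invariant associated function of rank 0 vanishes on the unit
  cube.  The associated functions of the difference then vanish one rank after the other: when
  those of rank less than j are zero, the one of rank j is translation invariant and
  (n+j)-homogeneous.

  What remains is that a translation invariant valuation, homogeneous of degree d, is zero if
  d > n, or if d = n and it vanishes on the unit cube.  By homogeneity it extends to rational
  polytopes, which may be cut by rational hyperplanes; bisecting simplices reduces the claim to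
  simplices.  A dilated simplex kT is sliced into products of smaller simplices, which makes the
  value at kT a polynomial in k of degree dim T with top coefficient given by the parallelepiped
  spanned by the edges of T.  For d > dim T this forces the value to be zero, and for d = n a Steinitz
  exchange transforms the parallelepiped into the unit cube.

  That the discrete moment tensor of kP is polynomial in k follows from a triangulation of P into
  relatively open lattice simplices.
*)

theory Submission
  imports Defs "HOL-Computational_Algebra.Polynomial"
begin

section \<open>Lattice points of dilated polytopes\<close>

text \<open>Everything is tested on diagonal arguments: for a fixed vector u, tensors become real
  numbers, symmetric products become products, and covariance says that Z(P + y) is a polynomial in
  the number y . u; polarization recovers the tensors at the end. The constant is forced by rank 0:
  the associated function of rank 0 of the leading Ehrhart tensor is the volume, which is 1 on the
  unit cube, so c has to be the value of the rank 0 function of Z there.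

  Lattice polytopes are not closed under intersection or cutting, which is why homogeneity is first
  used to pass to rational ones. The valuation identity concerns two polytopes with convex union, so
  summing over a triangulation would call for inclusion-exclusion. This is avoided by cutting P out
  of a large simplex: if a valuation vanishes on small simplices, so does its restriction to a
  half-space. In place of continuity, the slicing argument compares the growth in k of two
  expressions, and rational coefficients keep all base changes within finitely many exchanges.
  Through these only the vanishing of a value is traced, so that no volume factor has to be
  computed.\<close>

definition weak_comps :: "'a set \<Rightarrow> nat \<Rightarrow> ('a \<Rightarrow> nat) set" where
  "weak_comps W N = {m. (\<forall>x. x \<notin> W \<longrightarrow> m x = 0) \<and> sum m W = N}"

text \<open>Both sides count the subsets of {0,...,M} with a + b + 1 elements, sorted on the left by
  their element \<open>j\<close> in position a + 1. The induction applies Pascal's rule to the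
  second factor, which is why \<open>b\<close> varies.\<close>

lemma choose_convolution:
  "(\<Sum>j\<le>M. (j choose a) * ((M - j) choose b)) = Suc M choose Suc (a + b)"
proof (induction M arbitrary: b)
  case 0
  show ?case by (cases a; cases b) auto
next
  case (Suc M)
  show ?case
  proof (cases b)
    case 0
    then show ?thesis using sum_choose_lower sum_choose_upper[of a "Suc M"] by simp
  next
    case (Suc b')
    have "(\<Sum>j\<le>Suc M. (j choose a) * ((Suc M - j) choose b))
        = (\<Sum>j\<le>M. (j choose a) * ((Suc (M - j)) choose Suc b'))"
      using Suc by (simp add: Suc_diff_le)
    also have "\<dots> = (\<Sum>j\<le>M. (j choose a) * ((M - j) choose b')) + (\<Sum>j\<le>M. (j choose a) * ((M - j) choose Suc b'))"
      by (simp add: sum.distrib algebra_simps)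
    also have "\<dots> = Suc (Suc M) choose Suc (a + b)"
      using Suc.IH[of b'] Suc.IH[of "Suc b'"] Suc by simp
    finally show ?thesis .
  qed
qed

lemma weak_comps_insert:
  assumes "x \<notin> W" "finite W"
  shows "bij_betw (\<lambda>(j, m). m(x := j)) (SIGMA j:{..N}. weak_comps W (N - j)) (weak_comps (insert x W) N)"
proof (rule bij_betwI[where g = "\<lambda>m. (m x, m(x := 0))"])
  have *: "sum (m(x := j)) W = sum m W" for m :: "'a \<Rightarrow> nat" and j
    using assms by (intro sum.cong) auto
  have "m(x := j) \<in> weak_comps (insert x W) N" if "j \<le> N" "m \<in> weak_comps W (N - j)" for j m
  proof -
    have 1: "sum (m(x := j)) (insert x W) = N" using that assms *[of m j] by (simp add: weak_comps_def)
    have 2: "(m(x := j)) y = 0" if "y \<notin> insert x W" for y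
      using that \<open>m \<in> weak_comps W (N - j)\<close> by (simp add: weak_comps_def)
    show ?thesis unfolding weak_comps_def mem_Collect_eq by (intro conjI allI impI 1 2)
  qed
  then show "(\<lambda>(j, m). m(x := j)) \<in> (SIGMA j:{..N}. weak_comps W (N - j)) \<rightarrow> weak_comps (insert x W) N"
    by (auto simp del: fun_upd_apply)
  have "m x \<le> N \<and> m(x := 0) \<in> weak_comps W (N - m x)" if "m \<in> weak_comps (insert x W) N" for m
  proof -
    have "m x + sum m W = N" using that assms by (simp add: weak_comps_def)
    then have 1: "m x \<le> N" "sum (m(x := 0)) W = N - m x" using *[of m 0] by auto
    have 2: "(m(x := 0)) y = 0" if "y \<notin> W" for y
      using that \<open>m \<in> weak_comps (insert x W) N\<close> by (simp add: weak_comps_def)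
    show ?thesis unfolding weak_comps_def mem_Collect_eq by (intro conjI allI impI 1 2)
  qed
  then show "(\<lambda>m. (m x, m(x := 0))) \<in> weak_comps (insert x W) N \<rightarrow> (SIGMA j:{..N}. weak_comps W (N - j))"
    by (auto simp del: fun_upd_apply)
  fix p assume "p \<in> (SIGMA j:{..N}. weak_comps W (N - j))"
  then have "snd p x = 0" using assms(1) by (auto simp: weak_comps_def)
  then have "(snd p)(x := 0) = snd p" by (rule fun_upd_idem)
  then show "(\<lambda>m. (m x, m(x := 0))) (case p of (j, m) \<Rightarrow> m(x := j)) = p"
    by (cases p) simp
next
  fix m show "(case (m x, m(x := 0)) of (j, m) \<Rightarrow> m(x := j)) = m" by simp
qed

lemma finite_weak_comps: "finite W \<Longrightarrow> finite (weak_comps W N)"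
proof (induction W arbitrary: N rule: finite_induct)
  case empty
  have "weak_comps {} N \<subseteq> {\<lambda>_. 0}" by (auto simp: weak_comps_def)
  then show ?case using finite_subset by blast
next
  case (insert x W)
  have "finite (SIGMA j:{..N}. weak_comps W (N - j))" using insert by auto
  then show ?case using bij_betw_finite[OF weak_comps_insert[OF insert(2,1)], of N] by simp
qed

text \<open>The left side is the coefficient of z^N in the product of the series z^a / (1 - z)^(a +
  1) over the exponents a = \<open>\<alpha> w\<close>; iterating \<open>choose_convolution\<close>
  multiplies these out one factor at a time.\<close>

lemma sum_prod_choose_weak_comps:
  assumes "finite W" "W \<noteq> {}"
  shows "(\<Sum>m\<in>weak_comps W N. \<Prod>w\<in>W. (m w choose \<alpha> w)) =
    (N + card W - 1) choose (card W - 1 + sum \<alpha> W)"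
  using assms
proof (induction W arbitrary: N rule: finite_ne_induct)
  case (singleton x)
  have "weak_comps {x} N = {(\<lambda>_. 0)(x := N)}" by (auto simp: weak_comps_def)
  then show ?case by simp
next
  case (insert x W)
  let ?c = "card W - 1"
  have c: "card W = Suc ?c" using insert by (simp add: card_gt_0_iff)
  have "(\<Sum>m\<in>weak_comps (insert x W) N. \<Prod>w\<in>insert x W. (m w choose \<alpha> w)) =
     (\<Sum>(j,m)\<in>(SIGMA j:{..N}. weak_comps W (N - j)). \<Prod>w\<in>insert x W. ((m(x := j)) w choose \<alpha> w))"
    using weak_comps_insert[of x W N] insert
    by (subst sum.reindex_bij_betw[symmetric, OF weak_comps_insert]) (auto simp: case_prod_unfold)
  also have "\<dots> = (\<Sum>(j,m)\<in>(SIGMA j:{..N}. weak_comps W (N - j)). (j choose \<alpha> x) * (\<Prod>w\<in>W. (m w choose \<alpha> w)))"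
    using insert by (intro sum.cong refl) (auto intro!: prod.cong disjI2)
  also have "\<dots> = (\<Sum>j\<le>N. (j choose \<alpha> x) * (\<Sum>m\<in>weak_comps W (N - j). \<Prod>w\<in>W. (m w choose \<alpha> w)))"
    using insert.hyps by (subst sum.Sigma[symmetric]) (auto simp: sum_distrib_left finite_weak_comps)
  also have "\<dots> = (\<Sum>j\<le>N. (j choose \<alpha> x) * (((N + ?c) - j) choose (?c + sum \<alpha> W)))"
    using insert.IH c by (intro sum.cong refl) (simp add: Suc_diff_le)
  \<comment> \<open>For j > N the upper entry of the second binomial is below \<open>?c\<close>, so
    the added terms are zero and the convolution runs over its full range.\<close>
  also have "\<dots> = (\<Sum>j\<le>N + ?c. (j choose \<alpha> x) * (((N + ?c) - j) choose (?c + sum \<alpha> W)))"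
    by (intro sum.mono_neutral_left) auto
  also have "\<dots> = Suc (N + ?c) choose Suc (\<alpha> x + (?c + sum \<alpha> W))" by (rule choose_convolution)
  also have "\<dots> = (N + card (insert x W) - 1) choose (card (insert x W) - 1 + sum \<alpha> (insert x W))"
    using insert c by (simp add: add_ac)
  finally show ?case .
qed

lemma choose_poly: "\<exists>p::real poly. degree p \<le> e \<and> (\<forall>k::nat. real ((k + c) choose e) = poly p (real k))"
proof -
  define p :: "real poly" where "p = smult (1 / fact e) (\<Prod>i<e. [:real c - real i, 1:])"
  have "degree (\<Prod>i<e. [:real c - real i, 1:]) \<le> e"
    using degree_prod_sum_le[of "{..<e}" "\<lambda>i. [:real c - real i, 1:]"] by simp
  moreover have "real ((k + c) choose e) = poly p (real k)" for k
    by (simp add: p_def binomial_gbinomial gbinomial_prod_rev poly_prod atLeast0LessThan algebra_simps)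
  ultimately show ?thesis unfolding p_def using degree_smult_le order_trans by blast
qed

text \<open>Polynomials of degree at most \<open>r\<close> in the variables \<open>m w\<close>,
  spanned by products of binomials instead of monomials because those have a closed sum over
  compositions.\<close>

inductive poly_on :: "'a set \<Rightarrow> nat \<Rightarrow> (('a \<Rightarrow> nat) \<Rightarrow> real) \<Rightarrow> bool" for W r where
  basis: "sum \<alpha> W \<le> r \<Longrightarrow> poly_on W r (\<lambda>m. real (\<Prod>w\<in>W. (m w choose \<alpha> w)))"
| add: "poly_on W r g \<Longrightarrow> poly_on W r h \<Longrightarrow> poly_on W r (\<lambda>m. g m + h m)"
| scale: "poly_on W r g \<Longrightarrow> poly_on W r (\<lambda>m. c * g m)"

lemma poly_on_sum: "finite I \<Longrightarrow> (\<And>i. i \<in> I \<Longrightarrow> poly_on W r (g i)) \<Longrightarrow> poly_on W r (\<lambda>m. \<Sum>i\<in>I. g i m)"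
proof (induction I rule: finite_induct)
  case empty
  have "poly_on W r (\<lambda>m. 0 * real (\<Prod>w\<in>W. (m w choose (\<lambda>_. 0) w)))"
    by (intro poly_on.intros) simp
  then show ?case by simp
qed (auto intro: poly_on.add)

text \<open>In the binomial basis, multiplication by a variable is k C(k,a) = (a+1) C(k,a+1) + a
  C(k,a), so it raises the degree by one.\<close>

lemma poly_on_mult_var:
  assumes "poly_on W r g" "finite W" "x \<in> W"
  shows "poly_on W (Suc r) (\<lambda>m. real (m x) * g m)"
  using assms(1)
proof induction
  case (basis \<alpha>)
  let ?\<alpha> = "\<alpha>(x := Suc (\<alpha> x))"
  have s: "sum ?\<alpha> W = Suc (sum \<alpha> W)"
    using assms by (simp add: sum.remove[of W x])
  have key: "real k * real (k choose a) = real (Suc a) * real (k choose Suc a) + real a * real (k choose a)"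
    for k a :: nat
  proof (cases "a \<le> k")
    case True
    have "Suc a * (k choose Suc a) = (k - a) * (k choose a)"
      by (simp only: binomial_absorption binomial_absorb_comp)
    then have "real (Suc a) * real (k choose Suc a) = (real k - real a) * real (k choose a)"
      using True by (metis of_nat_diff of_nat_mult)
    then show ?thesis by (simp only: left_diff_distrib)
  qed (simp add: not_le binomial_eq_0)
  have "real (m x) * real (\<Prod>w\<in>W. (m w choose \<alpha> w)) =
     real (Suc (\<alpha> x)) * real (\<Prod>w\<in>W. (m w choose ?\<alpha> w)) + real (\<alpha> x) * real (\<Prod>w\<in>W. (m w choose \<alpha> w))" for m
  proof -
    define Q where "Q = (\<Prod>w\<in>W - {x}. (m w choose \<alpha> w))"
    have "(\<Prod>w\<in>W - {x}. (m w choose ?\<alpha> w)) = Q" unfolding Q_def by (intro prod.cong) auto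
    then have 1: "(\<Prod>w\<in>W. (m w choose ?\<alpha> w)) = (m x choose Suc (\<alpha> x)) * Q"
      using assms by (simp add: prod.remove[of W x])
    have 2: "(\<Prod>w\<in>W. (m w choose \<alpha> w)) = (m x choose \<alpha> x) * Q"
      using assms by (simp add: prod.remove[of W x] Q_def)
    show ?thesis
      unfolding 1 2 of_nat_mult mult.assoc[symmetric] key[of "m x" "\<alpha> x"] by (simp only: distrib_right)
  qed
  moreover have "poly_on W (Suc r) (\<lambda>m. real (Suc (\<alpha> x)) * real (\<Prod>w\<in>W. (m w choose ?\<alpha> w)) + real (\<alpha> x) * real (\<Prod>w\<in>W. (m w choose \<alpha> w)))"
    by (intro poly_on.intros) (use s basis in auto)
  ultimately show ?case by (simp only:)
next
  case (add g h)
  show ?case unfolding distrib_left by (rule poly_on.add) fact+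
next
  case (scale g c)
  have "(\<lambda>m. real (m x) * (c * g m)) = (\<lambda>m. c * (real (m x) * g m))" by auto
  then show ?case using poly_on.scale[OF scale.IH, of c] by (simp only:)
qed

lemma poly_on_Suc: "poly_on W r g \<Longrightarrow> poly_on W (Suc r) g"
proof (induction rule: poly_on.induct)
  case (basis \<alpha>)
  then show ?case by (intro poly_on.basis) simp
qed (rule poly_on.add poly_on.scale; assumption)+

lemma poly_on_prod_affine:
  assumes "finite W"
  shows "poly_on W r (\<lambda>m. \<Prod>i<r. (c i + (\<Sum>w\<in>W. real (m w) * l w i)))"
proof (induction r)
  case 0
  show ?case using poly_on.basis[of "\<lambda>_. 0" W 0] by simp
next
  case (Suc r)
  let ?g = "\<lambda>m::'a \<Rightarrow> nat. \<Prod>i<r. (c i + (\<Sum>w\<in>W. real (m w) * l w i))"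
  have "poly_on W (Suc r) (\<lambda>m. c r * ?g m + (\<Sum>w\<in>W. l w r * (real (m w) * ?g m)))"
  proof (rule poly_on.add)
    show "poly_on W (Suc r) (\<lambda>m. c r * ?g m)"
      by (rule poly_on_Suc[OF poly_on.scale[OF Suc]])
    show "poly_on W (Suc r) (\<lambda>m. \<Sum>w\<in>W. l w r * (real (m w) * ?g m))"
      by (rule poly_on_sum[OF assms], rule poly_on.scale, rule poly_on_mult_var[OF Suc assms])
  qed
  then show ?case by (simp add: distrib_right sum_distrib_right mult_ac)
qed

text \<open>\<open>h\<close> will be the height of a lattice point in a half-open parallelepiped.
  The bound \<open>h < card W\<close> makes one polynomial serve all \<open>k\<close>: for
  \<open>k < h\<close> the sum is empty, and the binomial of the closed form has upper entry below
  \<open>card W - 1\<close> and is zero as well.\<close>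

lemma poly_on_sum_weak_comps:
  assumes "poly_on W r g" "finite W" "W \<noteq> {}" "h < card W"
  shows "\<exists>p. degree p \<le> card W - 1 + r \<and>
    (\<forall>k. (\<Sum>m\<in>{m. (\<forall>x. x \<notin> W \<longrightarrow> m x = 0) \<and> sum m W + h = k}. g m) = poly p (real k))"
proof -
  have eq: "{m. (\<forall>x. x \<notin> W \<longrightarrow> m x = 0) \<and> sum m W + h = k} = (if h \<le> k then weak_comps W (k - h) else {})" for k
    by (auto simp: weak_comps_def)
  show ?thesis unfolding eq using assms(1)
  proof induction
    case (basis \<alpha>)
    obtain p :: "real poly" where p: "degree p \<le> card W - 1 + sum \<alpha> W"
      "\<And>k. real ((k + (card W - 1 - h)) choose (card W - 1 + sum \<alpha> W)) = poly p (real k)"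
      using choose_poly[of "card W - 1 + sum \<alpha> W" "card W - 1 - h"] by blast
    have "(\<Sum>m\<in>(if h \<le> k then weak_comps W (k - h) else {}). real (\<Prod>w\<in>W. (m w choose \<alpha> w))) = poly p (real k)" for k
    proof (cases "h \<le> k")
      case True
      have "(\<Sum>m\<in>weak_comps W (k - h). real (\<Prod>w\<in>W. (m w choose \<alpha> w))) = real (\<Sum>m\<in>weak_comps W (k - h). \<Prod>w\<in>W. (m w choose \<alpha> w))"
        by simp
      also have "\<dots> = poly p (real k)"
        using sum_prod_choose_weak_comps[OF assms(2,3), of \<alpha> "k - h"] p(2)[of k] True assms(4)
        by simp
      finally show ?thesis using True by simp
    next
      case False
      then have "real ((k + (card W - 1 - h)) choose (card W - 1 + sum \<alpha> W)) = 0" using assms(4) by simp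
      with p(2)[of k] have "poly p (real k) = 0" by linarith
      then show ?thesis using False by simp
    qed
    then show ?case using p(1) basis by (intro exI[of _ p]) auto
  next
    case (add g1 g2)
    then obtain p q where "degree p \<le> card W - 1 + r" "degree q \<le> card W - 1 + r"
      "\<forall>k. (\<Sum>m\<in>(if h \<le> k then weak_comps W (k - h) else {}). g1 m) = poly p (real k)"
      "\<forall>k. (\<Sum>m\<in>(if h \<le> k then weak_comps W (k - h) else {}). g2 m) = poly q (real k)" by blast
    then show ?case by (intro exI[of _ "p + q"]) (simp add: degree_add_le sum.distrib)
  next
    case (scale g c)
    then obtain p where "degree p \<le> card W - 1 + r"
      "\<forall>k. (\<Sum>m\<in>(if h \<le> k then weak_comps W (k - h) else {}). g m) = poly p (real k)" by blast
    then show ?case by (intro exI[of _ "smult c p"]) (simp flip: sum_distrib_left)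
  qed
qed

section \<open>Lattice sums over dilated simplices\<close>

definition lattice_sum :: "nat \<Rightarrow> (nat \<Rightarrow> real ^ 'n) \<Rightarrow> (real ^ 'n) set \<Rightarrow> real" where
  "lattice_sum r v S = (\<Sum>x\<in>S \<inter> int_lattice. tensor_power x r v)"

text \<open>
  The dilation factor 0 is treated separately because additivity fails there: it maps disjoint
  sets to the same point.
\<close>

definition ehrhart_poly :: "nat \<Rightarrow> nat \<Rightarrow> (nat \<Rightarrow> real ^ 'n) \<Rightarrow> (real ^ 'n) set \<Rightarrow> bool" where
  "ehrhart_poly D r v S \<longleftrightarrow> bounded S \<and> (\<exists>p. degree p \<le> D \<and>
     (\<forall>k>0. lattice_sum r v ((*\<^sub>R) (real k) ` S) = poly p (real k)) \<and> (r \<ge> 1 \<longrightarrow> poly p 0 = 0))"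

text \<open>For affinely independent \<open>W\<close> this is the relative interior of the hull; for
  \<open>W = {}\<close> it is empty, since the empty sum is not 1. Disjointness of these pieces is
  what makes lattice sums additive over a triangulation.\<close>

definition open_simplex :: "('a::real_vector) set \<Rightarrow> 'a set" where
  "open_simplex W = {x. \<exists>u. (\<forall>w\<in>W. 0 < u w) \<and> sum u W = 1 \<and> (\<Sum>w\<in>W. u w *\<^sub>R w) = x}"

lemma int_lattice_arith:
  "0 \<in> int_lattice"
  "x \<in> int_lattice \<Longrightarrow> y \<in> int_lattice \<Longrightarrow> x + y \<in> int_lattice"
  "x \<in> int_lattice \<Longrightarrow> y \<in> int_lattice \<Longrightarrow> x - y \<in> int_lattice"
  "x \<in> int_lattice \<Longrightarrow> c \<in> \<int> \<Longrightarrow> c *\<^sub>R x \<in> int_lattice"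
  by (auto simp: int_lattice_def)

lemma int_lattice_sum: "(\<And>i. i \<in> I \<Longrightarrow> f i \<in> int_lattice) \<Longrightarrow> sum f I \<in> int_lattice"
  by (induction I rule: infinite_finite_induct) (auto simp: int_lattice_arith)

lemma finite_bounded_int_lattice:
  fixes S :: "(real ^ 'n) set"
  assumes "bounded S"
  shows "finite (S \<inter> int_lattice)"
proof -
  obtain B where B: "\<And>x. x \<in> S \<Longrightarrow> norm x \<le> B" using assms by (auto simp: bounded_iff)
  define c where "c = \<lceil>B\<rceil>"
  let ?F = "(UNIV :: 'n set) \<rightarrow>\<^sub>E {-c..c}"
  have "S \<inter> int_lattice \<subseteq> (\<lambda>f. \<chi> i. of_int (f i)) ` ?F"
  proof
    fix x assume x: "x \<in> S \<inter> int_lattice"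
    have "\<lfloor>x $ i\<rfloor> \<in> {-c..c}" for i
    proof -
      have "\<bar>x $ i\<bar> \<le> B" using component_le_norm_cart[of x i] B[of x] x by auto
      then show ?thesis unfolding c_def by (auto simp: abs_le_iff; linarith)
    qed
    moreover have "x = (\<chi> i. of_int \<lfloor>x $ i\<rfloor>)"
      using x by (auto simp: vec_eq_iff int_lattice_def elim!: Ints_cases)
    ultimately show "x \<in> (\<lambda>f. \<chi> i. of_int (f i)) ` ?F"
      by (intro image_eqI[of _ _ "\<lambda>i. \<lfloor>x $ i\<rfloor>"]) auto
  qed
  moreover have "finite ?F" by (rule finite_PiE) auto
  ultimately show ?thesis using finite_surj by blast
qed

lemma affine_independent_unique:
  fixes W :: "('a::euclidean_space) set"
  assumes "\<not> affine_dependent W" "sum u W = sum u' W"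
    "(\<Sum>w\<in>W. u w *\<^sub>R w) = (\<Sum>w\<in>W. u' w *\<^sub>R w)" "w \<in> W"
  shows "u w = u' w"
proof -
  have "finite W" using assms(1) by (rule aff_independent_finite)
  moreover have "sum (\<lambda>w. u w - u' w) W = 0" using assms by (simp add: sum_subtractf)
  moreover have "(\<Sum>w\<in>W. (u w - u' w) *\<^sub>R w) = 0" using assms by (simp add: sum_subtractf scaleR_left_diff_distrib)
  ultimately show ?thesis using assms(1,4) affine_dependent_explicit_finite[of W] by fastforce
qed

lemma scaled_convex_hull:
  assumes "finite W" "W \<noteq> {}" "0 \<le> k"
  shows "(*\<^sub>R) k ` (convex hull W) = {x. \<exists>u. (\<forall>w\<in>W. 0 \<le> u w) \<and> sum u W = k \<and> (\<Sum>w\<in>W. u w *\<^sub>R w) = x}"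
proof (intro equalityI subsetI)
  fix x assume "x \<in> (*\<^sub>R) k ` (convex hull W)"
  then obtain u where u: "\<forall>w\<in>W. 0 \<le> u w" "sum u W = 1" "k *\<^sub>R (\<Sum>w\<in>W. u w *\<^sub>R w) = x"
    unfolding convex_hull_finite[OF assms(1)] by auto
  then show "x \<in> {x. \<exists>u. (\<forall>w\<in>W. 0 \<le> u w) \<and> sum u W = k \<and> (\<Sum>w\<in>W. u w *\<^sub>R w) = x}"
    using assms by (intro CollectI exI[of _ "\<lambda>w. k * u w"]) (auto simp: sum_distrib_left[symmetric] scaleR_sum_right)
next
  fix x assume "x \<in> {x. \<exists>u. (\<forall>w\<in>W. 0 \<le> u w) \<and> sum u W = k \<and> (\<Sum>w\<in>W. u w *\<^sub>R w) = x}"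
  then obtain u where u: "\<forall>w\<in>W. 0 \<le> u w" "sum u W = k" "(\<Sum>w\<in>W. u w *\<^sub>R w) = x" by auto
  show "x \<in> (*\<^sub>R) k ` (convex hull W)"
  proof (cases "k = 0")
    case True
    then have "\<forall>w\<in>W. u w = 0" using u assms sum_nonneg_eq_0_iff[of W u] by auto
    then have "x = 0" using u by auto
    then show ?thesis using True assms by (auto simp: image_iff)
  next
    case False
    have "(\<Sum>w\<in>W. (u w / k) *\<^sub>R w) \<in> convex hull W"
      unfolding convex_hull_finite[OF assms(1)] using u False assms
      by (intro CollectI exI[of _ "\<lambda>w. u w / k"]) (auto simp: sum_divide_distrib[symmetric])
    moreover have "k *\<^sub>R (\<Sum>w\<in>W. (u w / k) *\<^sub>R w) = x" using u(3) False by (simp add: scaleR_sum_right)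
    ultimately show ?thesis by blast
  qed
qed

text \<open>Barycentric coordinates of a lattice point in the k-fold dilate split into fractional
  parts and floors. The fractional parts form one of finitely many lattice points of the half-open
  parallelepiped in the cone over the simplex, the floors form a weak composition, and for each
  choice of the former \<open>poly_on_sum_weak_comps\<close> sums over the latter.\<close>

lemma ehrhart_poly_simplex:
  fixes W :: "(real ^ 'n) set"
  assumes ind: "\<not> affine_dependent W" and lat: "W \<subseteq> int_lattice" and ne: "W \<noteq> {}"
  shows "ehrhart_poly (card W - 1 + r) r v (convex hull W)"
proof -
  have fin: "finite W" using ind by (rule aff_independent_finite)
  define pt where "pt u = (\<Sum>w\<in>W. u w *\<^sub>R w)" for u :: "real ^ 'n \<Rightarrow> real"
  \<comment> \<open>Fractional coordinate vectors, set to 0 off \<open>W\<close> so that equality of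
    functions is equality of coordinates. The integrality of \<open>sum u W\<close> is the lattice
    condition in the height direction of the cone.\<close>
  define B where "B = {u. (\<forall>x. x \<notin> W \<longrightarrow> u x = 0) \<and> (\<forall>w\<in>W. 0 \<le> u w \<and> u w < 1) \<and> sum u W \<in> \<int> \<and> pt u \<in> int_lattice}"
  define h where "h u = nat \<lfloor>sum u W\<rfloor>" for u :: "real ^ 'n \<Rightarrow> real"
  define M where "M u k = {m. (\<forall>x. x \<notin> W \<longrightarrow> m x = 0) \<and> sum m W + h u = k}" for u :: "real ^ 'n \<Rightarrow> real" and k :: nat
  have uniq: "u w = u' w" if "sum u W = sum u' W" "pt u = pt u'" "w \<in> W" for u u' w
    using affine_independent_unique[OF ind that(1) _ that(3)] that(2) by (simp add: pt_def)
  have pt_add: "pt (\<lambda>w. u w + u' w) = pt u + pt u'" for u u'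
    by (simp add: pt_def scaleR_add_left sum.distrib)
  have pt_int: "pt (\<lambda>w. real (m w)) \<in> int_lattice" for m :: "real ^ 'n \<Rightarrow> nat"
    unfolding pt_def using lat by (intro int_lattice_sum int_lattice_arith) auto
  have h: "real (h u) = sum u W" "h u < card W" if uB: "u \<in> B" for u
  proof -
    obtain z where z: "sum u W = of_int z" using uB unfolding B_def by (blast elim: Ints_cases)
    have "sum u W \<ge> 0" using that by (auto simp: B_def intro: sum_nonneg)
    then show 1: "real (h u) = sum u W" using z by (simp add: h_def)
    have "sum u W < sum (\<lambda>_. 1) W"
      using that fin ne by (intro sum_strict_mono) (auto simp: B_def)
    then show "h u < card W" using 1 by simp
  qed
  have finB: "finite B"
  proof -
    \<comment> \<open>A vector in \<open>B\<close> is determined by its point and its height; the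
      points are lattice points of a ball and the heights are below \<open>card W\<close>.\<close>
    obtain C where C: "\<And>w. w \<in> W \<Longrightarrow> norm w \<le> C"
      using finite_imp_bounded[OF fin] by (auto simp: bounded_iff)
    let ?T = "(cball (0 :: real ^ 'n) (real (card W) * C) \<inter> int_lattice) \<times> {..card W}"
    have "(\<lambda>u. (pt u, h u)) ` B \<subseteq> ?T"
    proof (clarsimp simp: h(2) less_imp_le)
      fix u assume u: "u \<in> B"
      have "norm (pt u) \<le> (\<Sum>w\<in>W. C)" unfolding pt_def
      proof (rule sum_norm_le)
        fix w assume w: "w \<in> W"
        have "\<bar>u w\<bar> * norm w \<le> 1 * norm w" using u w by (intro mult_right_mono) (auto simp: B_def)
        then show "norm (u w *\<^sub>R w) \<le> C" using C[OF w] by simp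
      qed
      then show "norm (pt u) \<le> real (card W) * C \<and> pt u \<in> int_lattice" using u by (auto simp: B_def)
    qed
    moreover have "finite ?T" by (intro finite_cartesian_product finite_bounded_int_lattice bounded_cball finite_atMost)
    moreover have "inj_on (\<lambda>u. (pt u, h u)) B"
    proof (rule inj_onI)
      fix u u' assume *: "u \<in> B" "u' \<in> B" "(pt u, h u) = (pt u', h u')"
      then have "sum u W = sum u' W" using h(1)[of u] h(1)[of u'] by simp
      then have "u w = u' w" if "w \<in> W" for w using uniq[of u u' w] * that by simp
      then show "u = u'" using * by (auto simp: B_def fun_eq_iff) metis
    qed
    ultimately show ?thesis using finite_subset finite_imageD by blast
  qed
  have finM: "finite (M u k)" for u k
  proof -
    have "M u k \<subseteq> weak_comps W (k - h u)" by (auto simp: M_def weak_comps_def)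
    then show ?thesis using finite_weak_comps[OF fin] finite_subset by blast
  qed
  define X where "X k = (*\<^sub>R) (real k) ` (convex hull W) \<inter> int_lattice" for k
  define e where "e = (\<lambda>(u, m). pt (\<lambda>w. u w + real (m w)) :: real ^ 'n)"
  have bij: "bij_betw e (SIGMA u:B. M u k) (X k)" for k
  proof (rule bij_betw_imageI)
    show "inj_on e (SIGMA u:B. M u k)"
    proof (rule inj_onI, clarsimp)
      fix u m u' m' assume *: "u \<in> B" "m \<in> M u k" "u' \<in> B" "m' \<in> M u' k" "e (u, m) = e (u', m')"
      have s: "sum (\<lambda>w. u w + real (m w)) W = real k" if "u \<in> B" "m \<in> M u k" for u m
        using that h(1)[of u] by (auto simp: M_def sum.distrib)
      have eq: "u w + real (m w) = u' w + real (m' w)" if "w \<in> W" for w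
        by (rule uniq) (use * s[of u m] s[of u' m'] that in \<open>auto simp: e_def\<close>)
      have "u w = u' w \<and> m w = m' w" for w
      proof (cases "w \<in> W")
        case True
        have fl: "\<lfloor>u w + real (m w)\<rfloor> = int (m w)" if "u \<in> B" for u m
          using that True by (intro floor_unique) (auto simp: B_def)
        show ?thesis using eq[OF True] fl[of u m] fl[of u' m'] * by simp
      qed (use * in \<open>auto simp: B_def M_def\<close>)
      then show "u = u' \<and> m = m'" by auto
    qed
    show "e ` (SIGMA u:B. M u k) = X k"
    proof (intro equalityI subsetI)
      fix x assume "x \<in> e ` (SIGMA u:B. M u k)"
      then obtain u m where um: "u \<in> B" "m \<in> M u k" "x = e (u, m)" by auto
      have "sum (\<lambda>w. u w + real (m w)) W = real k"
        using um h(1)[of u] by (auto simp: M_def sum.distrib)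
      moreover have "\<forall>w\<in>W. 0 \<le> u w + real (m w)" using um by (auto simp: B_def)
      ultimately have "x \<in> (*\<^sub>R) (real k) ` (convex hull W)"
        unfolding scaled_convex_hull[OF fin ne of_nat_0_le_iff] using um(3)
        by (intro CollectI exI[of _ "\<lambda>w. u w + real (m w)"]) (auto simp: e_def pt_def)
      moreover have "x \<in> int_lattice"
        using um pt_int[of m] by (auto simp: e_def pt_add B_def intro: int_lattice_arith)
      ultimately show "x \<in> X k" by (auto simp: X_def)
    next
      fix x assume "x \<in> X k"
      then obtain l where l: "\<forall>w\<in>W. 0 \<le> l w" "sum l W = real k" "pt l = x" and xl: "x \<in> int_lattice"
        unfolding X_def scaled_convex_hull[OF fin ne of_nat_0_le_iff] pt_def by auto
      define m where "m w = (if w \<in> W then nat \<lfloor>l w\<rfloor> else 0)" for w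
      define u where "u w = (if w \<in> W then frac (l w) else 0)" for w
      have lw: "l w = u w + real (m w)" if "w \<in> W" for w
        using that l(1) by (simp add: u_def m_def frac_def)
      have sl: "sum l W = sum u W + real (sum m W)"
        using lw by (simp add: sum.distrib[symmetric])
      have "pt l = pt (\<lambda>w. u w + real (m w))"
        unfolding pt_def using lw by (intro sum.cong) auto
      then have pl: "x = pt u + pt (\<lambda>w. real (m w))" using l(3) by (simp add: pt_add)
      have "pt u = x - pt (\<lambda>w. real (m w))" using pl by simp
      then have "pt u \<in> int_lattice" using xl pt_int[of m] by (simp add: int_lattice_arith)
      moreover have "sum u W = real k - real (sum m W)" using sl l(2) by simp
      then have "sum u W \<in> \<int>" by (metis Ints_diff Ints_of_nat)
      ultimately have uB: "u \<in> B" by (auto simp: B_def u_def frac_lt_1)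
      have "real (sum m W + h u) = real k" using h(1)[OF uB] sl l(2) by simp
      then have "m \<in> M u k" unfolding M_def of_nat_eq_iff by (simp add: m_def)
      moreover have "x = e (u, m)" using pl by (simp add: e_def pt_add)
      ultimately show "x \<in> e ` (SIGMA u:B. M u k)" using uB by blast
    qed
  qed
  have "\<exists>p. degree p \<le> card W - 1 + r \<and> (\<forall>k. (\<Sum>m\<in>M u k. tensor_power (e (u, m)) r v) = poly p (real k))"
    if "u \<in> B" for u
  proof -
    have "tensor_power (e (u, m)) r v = (\<Prod>i<r. (pt u \<bullet> v i + (\<Sum>w\<in>W. real (m w) * (w \<bullet> v i))))" for m
      unfolding tensor_power_def e_def by (simp add: pt_add inner_add_left) (simp add: pt_def inner_sum_left)
    then show ?thesis
      using poly_on_sum_weak_comps[OF poly_on_prod_affine[OF fin, of r "\<lambda>i. pt u \<bullet> v i" "\<lambda>w i. w \<bullet> v i"] fin ne h(2)[OF that]]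
      unfolding M_def by simp
  qed
  then obtain p where p: "\<And>u. u \<in> B \<Longrightarrow> degree (p u) \<le> card W - 1 + r"
    "\<And>u k. u \<in> B \<Longrightarrow> (\<Sum>m\<in>M u k. tensor_power (e (u, m)) r v) = poly (p u) (real k)"
    by metis
  have val: "lattice_sum r v ((*\<^sub>R) (real k) ` (convex hull W)) = poly (sum p B) (real k)" for k
  proof -
    have "lattice_sum r v ((*\<^sub>R) (real k) ` (convex hull W)) = (\<Sum>x\<in>X k. tensor_power x r v)"
      by (simp add: lattice_sum_def X_def)
    also have "\<dots> = (\<Sum>q\<in>(SIGMA u:B. M u k). tensor_power (e q) r v)"
      by (rule sum.reindex_bij_betw[OF bij, symmetric])
    also have "\<dots> = (\<Sum>u\<in>B. \<Sum>m\<in>M u k. tensor_power (e (u, m)) r v)"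
      using finB finM by (subst sum.Sigma) (auto simp: split_beta)
    also have "\<dots> = poly (sum p B) (real k)" using p(2) by (simp add: poly_sum)
    finally show ?thesis .
  qed
  \<comment> \<open>The formula \<open>val\<close> also holds at k = 0, where the dilate is the
    origin alone; its tensor power is zero in positive rank. This is why the Ehrhart expansion has
    no constant term there.\<close>
  have "poly (sum p B) 0 = 0" if "r \<ge> 1"
  proof -
    have "(*\<^sub>R) (real 0) ` (convex hull W) = {0}"
    proof -
      obtain w where "w \<in> convex hull W" using ne hull_inc[of _ W convex] by blast
      then show ?thesis by (auto simp: image_iff)
    qed
    then have "lattice_sum r v ((*\<^sub>R) (real 0) ` (convex hull W)) = tensor_power 0 r v"
      by (simp only: lattice_sum_def) (simp add: int_lattice_arith)
    also have "\<dots> = 0" using that by (simp add: tensor_power_def)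
    finally show ?thesis using val[of 0] by simp
  qed
  moreover have "degree (sum p B) \<le> card W - 1 + r" using p(1) by (intro degree_sum_le finB) auto
  moreover have "bounded (convex hull W)" using fin by (simp add: bounded_convex_hull finite_imp_bounded)
  ultimately show ?thesis unfolding ehrhart_poly_def using val by blast
qed


section \<open>Disjoint pieces and triangulations\<close>

lemma lattice_sum_disjoint:
  assumes "bounded S" "bounded T" "S \<inter> T = {}"
  shows "lattice_sum r v (S \<union> T) = lattice_sum r v S + lattice_sum r v T"
  unfolding lattice_sum_def Int_Un_distrib2
  using assms by (intro sum.union_disjoint finite_bounded_int_lattice) auto

lemma ehrhart_poly_empty: "ehrhart_poly D r v {}"
  by (auto simp: ehrhart_poly_def lattice_sum_def intro!: exI[of _ 0])

lemma ehrhart_poly_Un: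
  assumes "ehrhart_poly D r v S" "ehrhart_poly D r v T" "S \<inter> T = {}"
  shows "ehrhart_poly D r v (S \<union> T)"
proof -
  obtain p q where p: "degree p \<le> D" "\<forall>k>0. lattice_sum r v ((*\<^sub>R) (real k) ` S) = poly p (real k)" "r \<ge> 1 \<longrightarrow> poly p 0 = 0"
    and q: "degree q \<le> D" "\<forall>k>0. lattice_sum r v ((*\<^sub>R) (real k) ` T) = poly q (real k)" "r \<ge> 1 \<longrightarrow> poly q 0 = 0"
    and b: "bounded S" "bounded T"
    using assms unfolding ehrhart_poly_def by blast
  have "lattice_sum r v ((*\<^sub>R) (real k) ` (S \<union> T)) = poly (p + q) (real k)" if "k > 0" for k
    unfolding image_Un using that p q b assms(3)
    by (subst lattice_sum_disjoint) (auto intro!: bounded_scaling)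
  then show ?thesis unfolding ehrhart_poly_def using p q b
    by (intro conjI exI[of _ "p + q"]) (auto intro: degree_add_le)
qed

lemma ehrhart_poly_Diff:
  assumes "ehrhart_poly D r v S" "ehrhart_poly D r v T" "T \<subseteq> S"
  shows "ehrhart_poly D r v (S - T)"
proof -
  obtain p q where p: "degree p \<le> D" "\<forall>k>0. lattice_sum r v ((*\<^sub>R) (real k) ` S) = poly p (real k)" "r \<ge> 1 \<longrightarrow> poly p 0 = 0"
    and q: "degree q \<le> D" "\<forall>k>0. lattice_sum r v ((*\<^sub>R) (real k) ` T) = poly q (real k)" "r \<ge> 1 \<longrightarrow> poly q 0 = 0"
    and b: "bounded S" "bounded T"
    using assms unfolding ehrhart_poly_def by blast
  have bd: "bounded (S - T)" using b by (meson Diff_subset bounded_subset)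
  have "lattice_sum r v ((*\<^sub>R) (real k) ` (S - T)) = poly (p - q) (real k)" if k: "k > 0" for k
  proof -
    have "(*\<^sub>R) (real k) ` S = (*\<^sub>R) (real k) ` (S - T) \<union> (*\<^sub>R) (real k) ` T"
      unfolding image_Un[symmetric] using assms(3) by (intro arg_cong[where f = "image _"]) blast
    then have "lattice_sum r v ((*\<^sub>R) (real k) ` S) = lattice_sum r v ((*\<^sub>R) (real k) ` (S - T) \<union> (*\<^sub>R) (real k) ` T)"
      by (rule arg_cong)
    also have "\<dots> = lattice_sum r v ((*\<^sub>R) (real k) ` (S - T)) + lattice_sum r v ((*\<^sub>R) (real k) ` T)"
      using k bd b by (intro lattice_sum_disjoint bounded_scaling) auto
    finally show ?thesis using k p q by simp
  qed
  then show ?thesis unfolding ehrhart_poly_def using p q bd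
    by (intro conjI exI[of _ "p - q"]) (auto intro: degree_diff_le)
qed

lemma ehrhart_poly_Union:
  assumes "finite \<F>" "\<And>S. S \<in> \<F> \<Longrightarrow> ehrhart_poly D r v (f S)"
    "\<And>S T. S \<in> \<F> \<Longrightarrow> T \<in> \<F> \<Longrightarrow> S \<noteq> T \<Longrightarrow> f S \<inter> f T = {}"
  shows "ehrhart_poly D r v (\<Union>(f ` \<F>))"
  using assms
proof (induction \<F> rule: finite_induct)
  case (insert S \<F>)
  have "f S \<inter> \<Union>(f ` \<F>) = {}" using insert.prems(2) insert.hyps by blast
  moreover have "ehrhart_poly D r v (\<Union>(f ` \<F>))" using insert by auto
  ultimately show ?case using insert.prems(1)[of S] by (simp add: ehrhart_poly_Un)
qed (simp add: ehrhart_poly_empty)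

lemma ehrhart_poly_mono: "ehrhart_poly D r v S \<Longrightarrow> D \<le> D' \<Longrightarrow> ehrhart_poly D' r v S"
  unfolding ehrhart_poly_def using order_trans by blast

text \<open>Extending coefficients by zero gives all faces the coordinates of \<open>W\<close>; a
  face is then recognized as the support of a coordinate vector, from which covering and
  disjointness of the open faces can be read off.\<close>

lemma open_simplex_face:
  assumes "finite W" "F \<subseteq> W"
  shows "x \<in> open_simplex F \<longleftrightarrow>
    (\<exists>u. (\<forall>w\<in>W. 0 \<le> u w) \<and> F = {w\<in>W. u w \<noteq> 0} \<and> sum u W = 1 \<and> (\<Sum>w\<in>W. u w *\<^sub>R w) = x)"
    (is "?l = ?r")
proof
  assume ?l
  then obtain u where u: "\<forall>w\<in>F. 0 < u w" "sum u F = 1" "(\<Sum>w\<in>F. u w *\<^sub>R w) = x"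
    by (auto simp: open_simplex_def)
  have "sum (\<lambda>w. if w \<in> F then u w else 0) W = 1"
    using u(2) assms by (simp add: sum.If_cases Int_absorb1)
  moreover have "(\<Sum>w\<in>W. (if w \<in> F then u w else 0) *\<^sub>R w) = x"
    using u(3) assms by (simp add: if_distrib[of "\<lambda>t. t *\<^sub>R _"] sum.If_cases Int_absorb1 cong: if_cong)
  moreover have "F = {w\<in>W. (if w \<in> F then u w else 0) \<noteq> 0}" using u(1) assms(2) by auto
  moreover have "\<forall>w\<in>W. 0 \<le> (if w \<in> F then u w else 0)" using u(1) by (simp add: less_imp_le)
  ultimately show ?r by (intro exI[of _ "\<lambda>w. if w \<in> F then u w else 0"] conjI)
next
  assume ?r
  then obtain u where u: "\<forall>w\<in>W. 0 \<le> u w" "F = {w\<in>W. u w \<noteq> 0}" "sum u W = 1" "(\<Sum>w\<in>W. u w *\<^sub>R w) = x"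
    by blast
  have "sum u F = 1" using u assms by (subst u(3)[symmetric], intro sum.mono_neutral_left) auto
  moreover have "(\<Sum>w\<in>F. u w *\<^sub>R w) = x" using u assms by (subst u(4)[symmetric], intro sum.mono_neutral_left) auto
  moreover have "\<forall>w\<in>F. 0 < u w" using u by (simp add: less_le)
  ultimately show ?l unfolding open_simplex_def by blast
qed

lemma convex_hull_open_simplices:
  assumes "finite W"
  shows "convex hull W = \<Union>(open_simplex ` Pow W)"
proof (intro equalityI subsetI)
  fix x assume "x \<in> convex hull W"
  then obtain u where u: "\<forall>w\<in>W. 0 \<le> u w" "sum u W = 1" "(\<Sum>w\<in>W. u w *\<^sub>R w) = x"
    unfolding convex_hull_finite[OF assms] by auto
  then have "x \<in> open_simplex {w\<in>W. u w \<noteq> 0}"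
    by (intro open_simplex_face[THEN iffD2, OF assms] exI[of _ u] conjI) auto
  then show "x \<in> \<Union>(open_simplex ` Pow W)" by (rule UN_I[rotated]) simp
next
  fix x assume "x \<in> \<Union>(open_simplex ` Pow W)"
  then obtain F where F: "F \<subseteq> W" "x \<in> open_simplex F" by blast
  from open_simplex_face[THEN iffD1, OF assms F] show "x \<in> convex hull W"
    unfolding convex_hull_finite[OF assms] by blast
qed

lemma open_simplex_disjoint:
  fixes W :: "('a::euclidean_space) set"
  assumes "\<not> affine_dependent W" "F \<subseteq> W" "G \<subseteq> W" "F \<noteq> G"
  shows "open_simplex F \<inter> open_simplex G = {}"
proof (rule ccontr)
  have fin: "finite W" using assms(1) by (rule aff_independent_finite)
  assume "open_simplex F \<inter> open_simplex G \<noteq> {}"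
  then obtain x where "x \<in> open_simplex F" "x \<in> open_simplex G" by blast
  then obtain u u' where u: "F = {w\<in>W. u w \<noteq> 0}" "sum u W = 1" "(\<Sum>w\<in>W. u w *\<^sub>R w) = x"
    and u': "G = {w\<in>W. u' w \<noteq> 0}" "sum u' W = 1" "(\<Sum>w\<in>W. u' w *\<^sub>R w) = x"
    using open_simplex_face[OF fin assms(2)] open_simplex_face[OF fin assms(3)] by blast
  have "u w = u' w" if "w \<in> W" for w
    by (rule affine_independent_unique[OF assms(1) _ _ that]) (use u u' in auto)
  then show False using assms(4) u(1) u'(1) by auto
qed

text \<open>The open simplex is the hull minus its proper open faces, which are covered by induction
  on the number of vertices.\<close>

lemma ehrhart_poly_open_simplex:
  fixes W :: "(real ^ 'n) set"
  assumes "\<not> affine_dependent W" "W \<subseteq> int_lattice"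
  shows "ehrhart_poly (CARD('n) + r) r v (open_simplex W)"
  using assms
proof (induction "card W" arbitrary: W rule: less_induct)
  case (less W)
  have fin: "finite W" using less.prems(1) by (rule aff_independent_finite)
  show ?case
  proof (cases "W = {}")
    case True
    then show ?thesis by (simp add: open_simplex_def ehrhart_poly_empty)
  next
    case False
    have "int (card W) - 1 \<le> int CARD('n)"
      using aff_dim_affine_independent[OF less.prems(1)] aff_dim_le_DIM[of W] by simp
    then have "card W - 1 + r \<le> CARD('n) + r" by simp
    then have 1: "ehrhart_poly (CARD('n) + r) r v (convex hull W)"
      using ehrhart_poly_simplex[OF less.prems False] ehrhart_poly_mono by blast
    have 2: "ehrhart_poly (CARD('n) + r) r v (\<Union>(open_simplex ` (Pow W - {W})))"
    proof (rule ehrhart_poly_Union)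
      show "ehrhart_poly (CARD('n) + r) r v (open_simplex F)" if "F \<in> Pow W - {W}" for F
      proof -
        have F: "F \<subset> W" using that by auto
        show ?thesis
        proof (rule less.hyps)
          show "card F < card W" using F fin by (simp add: psubset_card_mono)
          show "\<not> affine_dependent F" using F less.prems(1) affine_independent_subset by blast
          show "F \<subseteq> int_lattice" using F less.prems(2) by auto
        qed
      qed
    qed (use fin open_simplex_disjoint[OF less.prems(1)] in auto)
    have "open_simplex W = convex hull W - \<Union>(open_simplex ` (Pow W - {W}))"
      unfolding convex_hull_open_simplices[OF fin]
      using open_simplex_disjoint[OF less.prems(1) order_refl] by blast
    moreover have "\<Union>(open_simplex ` (Pow W - {W})) \<subseteq> convex hull W"
      unfolding convex_hull_open_simplices[OF fin] by blast
    ultimately show ?thesis using ehrhart_poly_Diff[OF 1 2] by simp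
  qed
qed

lemma open_simplex_sing: "open_simplex {w} = {w}"
  by (auto simp: open_simplex_def intro: exI[of _ "\<lambda>_. 1"])

lemma open_simplex_insert:
  assumes "finite W" "W \<noteq> {}" "w \<notin> W"
  shows "x \<in> open_simplex (insert w W) \<longleftrightarrow>
    (\<exists>y\<in>open_simplex W. \<exists>t. 0 < t \<and> t < 1 \<and> x = y + t *\<^sub>R (w - y))" (is "?l \<longleftrightarrow> ?r")
proof
  assume ?l
  then obtain u where u: "\<forall>x\<in>insert w W. 0 < u x" "sum u (insert w W) = 1" "(\<Sum>x\<in>insert w W. u x *\<^sub>R x) = x"
    by (auto simp: open_simplex_def)
  define t where "t = u w"
  have s: "sum u W = 1 - t" "(\<Sum>x\<in>W. u x *\<^sub>R x) = x - t *\<^sub>R w"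
    using u(2,3) assms by (auto simp: t_def algebra_simps)
  have "sum u W > 0" using u(1) assms by (intro sum_pos) auto
  then have t: "0 < t" "t < 1" using s u(1) by (auto simp: t_def)
  define y where "y = (\<Sum>x\<in>W. (u x / (1 - t)) *\<^sub>R x)"
  have "y \<in> open_simplex W"
    unfolding open_simplex_def y_def using u(1) t s(1)
    by (intro CollectI exI[of _ "\<lambda>x. u x / (1 - t)"]) (auto simp: sum_divide_distrib[symmetric])
  moreover have "(1 - t) *\<^sub>R y = x - t *\<^sub>R w"
    unfolding s(2)[symmetric] y_def using t by (simp add: scaleR_sum_right)
  then have "x = y + t *\<^sub>R (w - y)" by (simp add: algebra_simps)
  ultimately show ?r using t by blast
next
  assume ?r
  then obtain y t where yt: "y \<in> open_simplex W" "0 < t" "t < 1" "x = y + t *\<^sub>R (w - y)" by blast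
  then obtain u where u: "\<forall>x\<in>W. 0 < u x" "sum u W = 1" "(\<Sum>x\<in>W. u x *\<^sub>R x) = y"
    by (auto simp: open_simplex_def)
  let ?u = "\<lambda>x. if x = w then t else (1 - t) * u x"
  have 1: "sum ?u W = sum (\<lambda>x. (1 - t) * u x) W" using assms by (intro sum.cong) auto
  have 2: "(\<Sum>x\<in>W. ?u x *\<^sub>R x) = (\<Sum>x\<in>W. ((1 - t) * u x) *\<^sub>R x)" using assms by (intro sum.cong) auto
  have "sum ?u (insert w W) = 1" using assms 1 u(2) by (simp add: sum_distrib_left[symmetric])
  moreover have "(\<Sum>x\<in>W. ((1 - t) * u x) *\<^sub>R x) = (1 - t) *\<^sub>R y"
    unfolding u(3)[symmetric] by (simp add: scaleR_sum_right)
  then have S: "(\<Sum>x\<in>W. ?u x *\<^sub>R x) = (1 - t) *\<^sub>R y" unfolding 2 .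
  have "(\<Sum>x\<in>insert w W. ?u x *\<^sub>R x) = x"
    unfolding sum.insert[OF assms(1,3)] S yt(4) by (simp add: algebra_simps)
  moreover have "\<forall>x\<in>insert w W. 0 < ?u x" using u(1) yt by auto
  ultimately show ?l unfolding open_simplex_def by (intro CollectI exI[of _ ?u] conjI)
qed

text \<open>An open simplex is relatively open: coefficients \<open>c\<close> with sum 0 describe a
  direction within its affine hull, and a short step in it keeps all coefficients positive.\<close>

lemma open_simplex_move:
  assumes "finite W" "y \<in> open_simplex W" "sum c W = 0"
  shows "\<exists>d>0. d \<le> 1 \<and> y + d *\<^sub>R (\<Sum>w\<in>W. c w *\<^sub>R w) \<in> open_simplex W"
proof -
  obtain u where u: "\<forall>x\<in>W. 0 < u x" "sum u W = 1" "(\<Sum>x\<in>W. u x *\<^sub>R x) = y"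
    using assms(2) by (auto simp: open_simplex_def)
  have ne: "W \<noteq> {}" using u(2) by auto
  define m where "m = Min (u ` W)"
  have m: "m > 0" "\<And>w. w \<in> W \<Longrightarrow> m \<le> u w" using u(1) ne assms(1) by (auto simp: m_def)
  \<comment> \<open>\<open>s\<close> exceeds the absolute value of every \<open>c w\<close>, so a
    step of length at most \<open>m / s\<close> cannot use up the least coefficient
    \<open>m\<close>. The cap of \<open>d\<close> at 1 serves the visibility condition in the
    triangulation.\<close>
  define s where "s = 1 + (\<Sum>w\<in>W. \<bar>c w\<bar>)"
  have s: "s > 0" by (simp add: s_def sum_nonneg add_pos_nonneg)
  define d where "d = min 1 (m / s)"
  have d: "d > 0" "d \<le> 1" "d * s \<le> m" using m s by (auto simp: d_def field_simps min_def)
  have pos: "0 < u w + d * c w" if "w \<in> W" for w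
  proof -
    have "\<bar>c w\<bar> < s" using member_le_sum[of w W "\<lambda>w. \<bar>c w\<bar>"] that assms(1) by (simp add: s_def)
    then have "d * \<bar>c w\<bar> < d * s" using d(1) by simp
    moreover have "- (d * \<bar>c w\<bar>) \<le> d * c w"
      using mult_left_mono[of "- \<bar>c w\<bar>" "c w" d] d(1) abs_ge_minus_self[of "c w"] by simp
    ultimately show ?thesis using m(2)[OF that] d(3) by linarith
  qed
  have "y + d *\<^sub>R (\<Sum>w\<in>W. c w *\<^sub>R w) = (\<Sum>w\<in>W. (u w + d * c w) *\<^sub>R w)"
    by (simp add: u(3)[symmetric] scaleR_add_left sum.distrib scaleR_sum_right)
  moreover have "(\<Sum>w\<in>W. u w + d * c w) = 1"
    using u(2) assms(3) by (simp add: sum.distrib sum_distrib_left[symmetric])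
  ultimately have "y + d *\<^sub>R (\<Sum>w\<in>W. c w *\<^sub>R w) \<in> open_simplex W"
    unfolding open_simplex_def using pos by (intro CollectI exI[of _ "\<lambda>w. u w + d * c w"]) auto
  then show ?thesis using d by blast
qed

lemma convex_hull_insert_segment:
  "x \<in> convex hull (insert w V) \<longleftrightarrow>
    x = w \<or> x \<in> convex hull V \<or> (\<exists>y\<in>convex hull V. \<exists>t. 0 < t \<and> t < 1 \<and> x = y + t *\<^sub>R (w - y))"
    (is "?l \<longleftrightarrow> ?r")
proof
  assume ?l
  show ?r
  proof (cases "V = {}")
    case True
    then show ?thesis using \<open>?l\<close> by simp
  next
    case False
    obtain a b y where *: "a \<ge> 0" "b \<ge> 0" "a + b = 1" "y \<in> convex hull V" "x = a *\<^sub>R w + b *\<^sub>R y"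
      using \<open>?l\<close> unfolding convex_hull_insert[OF False] by blast
    have b: "b = 1 - a" using * by simp
    consider "a = 0" | "a = 1" | "0 < a" "a < 1" using * by linarith
    then show ?thesis
    proof cases
      case 3
      have "x = y + a *\<^sub>R (w - y)" using * b by (simp add: algebra_simps)
      then show ?thesis using 3 * by blast
    qed (use * b in auto)
  qed
next
  assume ?r
  moreover have "convex hull V \<subseteq> convex hull (insert w V)" by (intro hull_mono) auto
  moreover have "w \<in> convex hull (insert w V)" by (simp add: hull_inc)
  moreover have "y + t *\<^sub>R (w - y) \<in> convex hull (insert w V)"
    if "y \<in> convex hull (insert w V)" "0 < t" "t < 1" for y t
    using convexD_alt[OF convex_convex_hull, of y "insert w V" w t] that \<open>w \<in> _\<close>
    by (simp add: algebra_simps)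
  ultimately show ?l by blast
qed

text \<open>
  The vertices are inserted one at a time: the new simplices are the cones over those faces of
  the old hull that are visible from the new vertex.
\<close>

lemma convex_hull_triangulation:
  fixes V :: "('a::euclidean_space) set"
  assumes "finite V"
  shows "\<exists>T. finite T \<and> (\<forall>W\<in>T. W \<subseteq> V \<and> \<not> affine_dependent W) \<and>
    (\<forall>W\<in>T. \<forall>W'\<in>T. W \<noteq> W' \<longrightarrow> open_simplex W \<inter> open_simplex W' = {}) \<and>
    \<Union>(open_simplex ` T) = convex hull V"
  using assms
proof (induction V rule: finite_induct)
  case empty
  show ?case by (intro exI[of _ "{}"]) simp
next
  case (insert w V)
  define C where "C = convex hull V"
  obtain T where T: "finite T" "\<And>W. W \<in> T \<Longrightarrow> W \<subseteq> V" "\<And>W. W \<in> T \<Longrightarrow> \<not> affine_dependent W"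
    "\<And>W W'. W \<in> T \<Longrightarrow> W' \<in> T \<Longrightarrow> W \<noteq> W' \<Longrightarrow> open_simplex W \<inter> open_simplex W' = {}"
    "\<Union>(open_simplex ` T) = C"
    using insert.IH unfolding C_def by metis
  have VC: "V \<subseteq> C" unfolding C_def by (rule hull_subset)
  have C: "convex C" "compact C" using insert.hyps(1) finite_imp_compact_convex_hull by (auto simp: C_def)
  show ?case
  proof (cases "w \<in> C")
    case True
    then have "convex hull (insert w V) = C" unfolding C_def by (rule hull_redundant)
    then show ?thesis using T by (intro exI[of _ T]) blast
  next
    case False
    \<comment> \<open>A point of \<open>C\<close> is visible if the segment from it to
      \<open>w\<close> meets \<open>C\<close> nowhere else.\<close>
    define vis where "vis y \<longleftrightarrow> (\<forall>t. 0 < t \<and> t \<le> 1 \<longrightarrow> y + t *\<^sub>R (w - y) \<notin> C)" for y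
    define T' where "T' = {W\<in>T. \<exists>y\<in>open_simplex W. vis y}"
    have finW: "finite W" if "W \<in> T" for W using T(2)[OF that] insert.hyps(1) finite_subset by blast
    have sub: "open_simplex W \<subseteq> C" if "W \<in> T" for W using T(5) that by blast
    have wW: "w \<notin> W" if "W \<in> T" for W using T(2)[OF that] VC False by blast
    have neW: "W \<noteq> {}" if "W \<in> T'" for W using that by (auto simp: T'_def open_simplex_def)
    \<comment> \<open>Visibility is shared by all points of an open simplex. If the segment from
      \<open>y'\<close> met \<open>C\<close> again, joining that point to a point slightly beyond
      \<open>y\<close> on the line from \<open>y'\<close> through \<open>y\<close> would produce a
      further point of \<open>C\<close> on the segment from \<open>y\<close> to
      \<open>w\<close>.\<close>
    have vis_all: "vis y'" if W: "W \<in> T'" and y': "y' \<in> open_simplex W" for W y'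
    proof (rule ccontr)
      assume "\<not> vis y'"
      then obtain e where e: "0 < e" "e \<le> 1" "y' + e *\<^sub>R (w - y') \<in> C" by (auto simp: vis_def)
      obtain y where y: "y \<in> open_simplex W" "vis y" and WT: "W \<in> T" using W by (auto simp: T'_def)
      obtain u where u: "sum u W = 1" "(\<Sum>x\<in>W. u x *\<^sub>R x) = y"
        using y(1) by (auto simp: open_simplex_def)
      obtain u' where u': "sum u' W = 1" "(\<Sum>x\<in>W. u' x *\<^sub>R x) = y'"
        using y' by (auto simp: open_simplex_def)
      obtain d where d: "d > 0" "y + d *\<^sub>R (y - y') \<in> open_simplex W"
        using open_simplex_move[OF finW[OF WT] y(1), of "\<lambda>x. u x - u' x"] u u'
        by (auto simp: sum_subtractf scaleR_left_diff_distrib)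
      \<comment> \<open>Chosen so that \<open>y'\<close> cancels from the convex combination
        below.\<close>
      define s where "s = d / (d + 1 - e)"
      have den: "d + 1 - e > 0" using d e by linarith
      have s: "0 < s" "s \<le> 1" using d e den by (auto simp: s_def)
      have se: "s * (d + 1 - e) = d" using den by (simp add: s_def)
      have "(1 - s) *\<^sub>R (y + d *\<^sub>R (y - y')) + s *\<^sub>R (y' + e *\<^sub>R (w - y')) \<in> C"
        using convexD_alt[OF C(1), of "y + d *\<^sub>R (y - y')" "y' + e *\<^sub>R (w - y')" s] d(2) e(3) s sub[OF WT]
        by auto
      also have "(1 - s) *\<^sub>R (y + d *\<^sub>R (y - y')) + s *\<^sub>R (y' + e *\<^sub>R (w - y')) =
          ((1 - s) * (1 + d)) *\<^sub>R y + (s * e) *\<^sub>R w + (s * (d + 1 - e) - d) *\<^sub>R y'"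
        by (simp add: algebra_simps)
      also have "\<dots> = ((1 - s) * (1 + d)) *\<^sub>R y + (s * e) *\<^sub>R w" using se by simp
      also have "(1 - s) * (1 + d) = 1 - s * e" using se by (simp add: algebra_simps)
      finally have "y + (s * e) *\<^sub>R (w - y) \<in> C" by (simp add: algebra_simps)
      moreover have "0 < s * e" "s * e \<le> 1" using s e by (auto simp: mult_le_one)
      ultimately show False using y(2) by (auto simp: vis_def)
    qed
    have cone: "x \<in> open_simplex (insert w W) \<longleftrightarrow>
        (\<exists>y\<in>open_simplex W. \<exists>t. 0 < t \<and> t < 1 \<and> x = y + t *\<^sub>R (w - y))" if "W \<in> T'" for x W
      using that by (intro open_simplex_insert finW wW neW) (auto simp: T'_def)
    have coneC: "open_simplex (insert w W) \<inter> C = {}" if "W \<in> T'" for W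
      using vis_all[OF that] cone[OF that] by (auto simp: vis_def)
    have wcone: "w \<notin> open_simplex (insert w W)" if W: "W \<in> T'" for W
    proof
      assume "w \<in> open_simplex (insert w W)"
      then obtain y t where yt: "y \<in> open_simplex W" "t < 1" "w = y + t *\<^sub>R (w - y)" using cone[OF W] by blast
      then have "(1 - t) *\<^sub>R (w - y) = 0" by (simp add: algebra_simps)
      then have "w = y" using yt by simp
      then show False using False yt(1) sub[of W] W by (auto simp: T'_def)
    qed
    \<comment> \<open>Of two points of \<open>C\<close> on one ray from \<open>w\<close>, the
      farther one has the nearer one on its segment to \<open>w\<close>, so it is not
      visible.\<close>
    have same_ray: "y = y'" if vis: "vis y" "vis y'" and y: "y \<in> C" "y' \<in> C" and
      t: "0 < t" "t < 1" "0 < t'" "t' < 1" and eq: "y + t *\<^sub>R (w - y) = y' + t' *\<^sub>R (w - y')"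
    for y y' t t'
    proof -
      have less: False if "vis y'" "y \<in> C" "t < t''" "0 < t" "t'' < 1" "y + t *\<^sub>R (w - y) = y' + t'' *\<^sub>R (w - y')"
        for y y' :: 'a and t t'' :: real
      proof -
        have "(1 - t) *\<^sub>R y = (1 - t'') *\<^sub>R y' + (t'' - t) *\<^sub>R w" using that(6) by (simp add: algebra_simps)
        then have "(1 / (1 - t)) *\<^sub>R ((1 - t) *\<^sub>R y) = (1 / (1 - t)) *\<^sub>R ((1 - t'') *\<^sub>R y' + (t'' - t) *\<^sub>R w)" by simp
        then have "y = ((1 - t'') / (1 - t)) *\<^sub>R y' + ((t'' - t) / (1 - t)) *\<^sub>R w"
          using that by (simp add: scaleR_add_right)
        also have "(1 - t'') / (1 - t) = 1 - (t'' - t) / (1 - t)" using that by (simp add: field_simps)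
        finally have "y = y' + ((t'' - t) / (1 - t)) *\<^sub>R (w - y')" by (simp add: algebra_simps)
        moreover have "0 < (t'' - t) / (1 - t)" "(t'' - t) / (1 - t) \<le> 1" using that by auto
        ultimately show False using that(1,2) unfolding vis_def by metis
      qed
      have "t = t'"
        using less[of y' y t t'] less[of y y' t' t] vis y t eq by (metis linorder_neqE_linordered_idom)
      then have "(1 - t) *\<^sub>R y = (1 - t) *\<^sub>R y'" using eq by (simp add: algebra_simps)
      then show ?thesis using t by simp
    qed
    let ?N = "insert {w} (T \<union> insert w ` T')"
    have T'T: "T' \<subseteq> T" by (auto simp: T'_def)
    have N1: "finite ?N" using T(1) T'T finite_subset by auto
    have N2: "W \<subseteq> insert w V \<and> \<not> affine_dependent W" if "W \<in> ?N" for W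
    proof -
      have "\<not> affine_dependent (insert w W')" if W': "W' \<in> T'" for W'
      proof (rule affine_independent_insert)
        have WT: "W' \<in> T" using W' T'T by blast
        show "\<not> affine_dependent W'" using T(3) WT by blast
        \<comment> \<open>Otherwise \<open>w - y\<close> would be a direction within the simplex,
          and a short step towards \<open>w\<close> would stay in \<open>C\<close>.\<close>
        show "w \<notin> affine hull W'"
        proof
          assume "w \<in> affine hull W'"
          then obtain c where c: "sum c W' = 1" "(\<Sum>x\<in>W'. c x *\<^sub>R x) = w"
            unfolding affine_hull_finite[OF finW[OF WT]] by auto
          obtain y where y: "y \<in> open_simplex W'" "vis y" using W' by (auto simp: T'_def)
          obtain u where u: "sum u W' = 1" "(\<Sum>x\<in>W'. u x *\<^sub>R x) = y"
            using y(1) by (auto simp: open_simplex_def)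
          obtain d where "d > 0" "d \<le> 1" "y + d *\<^sub>R (w - y) \<in> open_simplex W'"
            using open_simplex_move[OF finW[OF WT] y(1), of "\<lambda>x. c x - u x"] u c
            by (auto simp: sum_subtractf scaleR_left_diff_distrib)
          then show False using y(2) sub[OF WT] by (auto simp: vis_def)
        qed
      qed
      then show ?thesis using that T(2,3) T'T by auto
    qed
    have N3: "open_simplex W \<inter> open_simplex W' = {}" if "W \<in> ?N" "W' \<in> ?N" "W \<noteq> W'" for W W'
    proof -
      have a: "open_simplex {w} \<inter> open_simplex U = {}" if "U \<in> T" for U
        using False sub[OF that] by (auto simp: open_simplex_sing)
      have b: "open_simplex {w} \<inter> open_simplex (insert w U) = {}" if "U \<in> T'" for U
        using wcone[OF that] by (auto simp: open_simplex_sing)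
      have c: "open_simplex U \<inter> open_simplex (insert w U') = {}" if "U \<in> T" "U' \<in> T'" for U U'
        using coneC[OF that(2)] sub[OF that(1)] by auto
      have d: "open_simplex (insert w U) \<inter> open_simplex (insert w U') = {}"
        if U: "U \<in> T'" "U' \<in> T'" "U \<noteq> U'" for U U'
      proof (rule ccontr)
        assume "open_simplex (insert w U) \<inter> open_simplex (insert w U') \<noteq> {}"
        then obtain x where "x \<in> open_simplex (insert w U)" "x \<in> open_simplex (insert w U')" by blast
        then obtain y t y' t' where "y \<in> open_simplex U" "y' \<in> open_simplex U'"
          "0 < t" "t < 1" "0 < t'" "t' < 1" "x = y + t *\<^sub>R (w - y)" "x = y' + t' *\<^sub>R (w - y')"
          unfolding cone[OF U(1)] cone[OF U(2)] by blast
        moreover from this have "y = y'"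
          using same_ray[of y y' t t'] vis_all[OF U(1)] vis_all[OF U(2)] sub[of U] sub[of U'] U T'T by auto
        ultimately show False using T(4)[of U U'] U T'T by blast
      qed
      from that(1,2) show ?thesis
        by (elim insertE UnE imageE) (metis a b c d T(4) that(3) Int_commute)+
    qed
    have N4: "\<Union>(open_simplex ` ?N) = convex hull (insert w V)"
    proof (intro equalityI subsetI)
      fix x assume "x \<in> \<Union>(open_simplex ` ?N)"
      then consider "x = w" | W where "W \<in> T" "x \<in> open_simplex W" | W where "W \<in> T'" "x \<in> open_simplex (insert w W)"
        by (auto simp: open_simplex_sing)
      then show "x \<in> convex hull (insert w V)"
      proof cases
        case 3
        then obtain y t where "y \<in> C" "0 < t" "t < 1" "x = y + t *\<^sub>R (w - y)"
          using cone[OF 3(1)] sub[of W] T'T by blast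
        then show ?thesis unfolding convex_hull_insert_segment C_def by blast
      qed (use sub in \<open>auto simp: convex_hull_insert_segment C_def\<close>)
    next
      fix x assume "x \<in> convex hull (insert w V)"
      then consider "x = w" | "x \<in> C" | y t where "x \<notin> C" "y \<in> C" "0 < t" "t < 1" "x = y + t *\<^sub>R (w - y)"
        unfolding convex_hull_insert_segment C_def by blast
      then show "x \<in> \<Union>(open_simplex ` ?N)"
      proof cases
        case 1
        then show ?thesis by (simp add: open_simplex_sing)
      next
        case 2
        then show ?thesis using T(5) by blast
      next
        case 3
        \<comment> \<open>The last point \<open>z\<close> of \<open>C\<close> on the way from
          \<open>y\<close> to \<open>x\<close> is visible, and \<open>x\<close> lies in the cone
          over its open simplex. On the segment from \<open>y\<close> to \<open>w\<close> the point
          \<open>z\<close> has parameter \<open>(1 - s) * t\<close>.\<close>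
        define K where "K = C \<inter> closed_segment x y"
        have "compact K" unfolding K_def using C by (intro compact_Int) auto
        moreover have "K \<noteq> {}" using 3 by (auto simp: K_def)
        ultimately obtain z where z: "z \<in> K" "\<And>z'. z' \<in> K \<Longrightarrow> dist x z \<le> dist x z'"
          using distance_attains_inf[of K x] compact_imp_closed by blast
        obtain s where s: "0 \<le> s" "s \<le> 1" "z = x + s *\<^sub>R (y - x)"
          using z(1) by (auto simp: K_def in_segment algebra_simps)
        have zC: "z \<in> C" using z(1) by (simp add: K_def)
        have s0: "s > 0" using s zC 3(1) by (cases "s = 0") auto
        have zl: "z = y + ((1 - s) * t) *\<^sub>R (w - y)" using s(3) 3(5) by (simp add: algebra_simps)
        have st: "0 \<le> (1 - s) * t" "(1 - s) * t < t" using s s0 3 by auto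
        have on: "y + r *\<^sub>R (w - y) \<in> closed_segment x y" if "0 \<le> r" "r \<le> t" for r
        proof -
          have "y + r *\<^sub>R (w - y) = (1 - (1 - r / t)) *\<^sub>R x + (1 - r / t) *\<^sub>R y"
            unfolding 3(5) using 3(3) by (simp add: algebra_simps)
          then show ?thesis using that 3 unfolding in_segment by (intro exI[of _ "1 - r / t"]) auto
        qed
        \<comment> \<open>Beyond \<open>z\<close> there are no points of \<open>C\<close>: up to
          \<open>x\<close> because \<open>z\<close> is nearest to \<open>x\<close>, and after
          \<open>x\<close> because convexity would then put \<open>x\<close> into
          \<open>C\<close>.\<close>
        have notC: "y + r *\<^sub>R (w - y) \<notin> C" if r: "(1 - s) * t < r" "r \<le> 1" for r
        proof
          assume *: "y + r *\<^sub>R (w - y) \<in> C"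
          show False
          proof (cases "r \<le> t")
            case True
            have "y + r *\<^sub>R (w - y) \<in> K" using * on[of r] True r st by (simp add: K_def)
            then have "dist x z \<le> dist x (y + r *\<^sub>R (w - y))" by (rule z(2))
            moreover have "x - z = (t - (1 - s) * t) *\<^sub>R (w - y)" unfolding zl 3(5) by (simp add: algebra_simps)
            moreover have "x - (y + r *\<^sub>R (w - y)) = (t - r) *\<^sub>R (w - y)" unfolding 3(5) by (simp add: algebra_simps)
            moreover have "norm (w - y) > 0" using 3 False by auto
            ultimately show False using r True st by (simp add: dist_norm)
          next
            case False
            have "(1 - t / r) *\<^sub>R y + (t / r) *\<^sub>R (y + r *\<^sub>R (w - y)) \<in> C"
              using convexD_alt[OF C(1) 3(2) *, of "t / r"] False 3 by simp
            moreover have "(1 - t / r) *\<^sub>R y + (t / r) *\<^sub>R (y + r *\<^sub>R (w - y)) = x"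
              unfolding 3(5) using False 3(3) by (simp add: algebra_simps)
            ultimately show False using 3(1) by simp
          qed
        qed
        have visz: "vis z"
          unfolding vis_def
        proof (intro allI impI)
          fix e :: real assume e: "0 < e \<and> e \<le> 1"
          let ?a = "(1 - s) * t"
          have "z + e *\<^sub>R (w - z) = y + (?a + e * (1 - ?a)) *\<^sub>R (w - y)"
            unfolding zl by (simp add: algebra_simps)
          moreover have a1: "1 - ?a > 0" using st 3(4) by linarith
          then have "e * (1 - ?a) > 0" using e by (intro mult_pos_pos) simp
          then have "?a < ?a + e * (1 - ?a)" by linarith
          moreover have "?a + e * (1 - ?a) \<le> 1"
          proof -
            have "a + e * (1 - a) \<le> 1" if "0 < 1 - a" for a
              using mult_left_le_one_le[OF less_imp_le[OF that], of e] e by (auto simp del: mult_le_cancel_right2)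
            then show ?thesis using a1 .
          qed
          ultimately show "z + e *\<^sub>R (w - z) \<notin> C" using notC by metis
        qed
        obtain W where W: "W \<in> T" "z \<in> open_simplex W" using T(5) zC by blast
        have WT': "W \<in> T'" using W visz by (auto simp: T'_def)
        let ?a = "(1 - s) * t"
        have "x = z + ((t - ?a) / (1 - ?a)) *\<^sub>R (w - z)"
        proof -
          have "w - z = (1 - ?a) *\<^sub>R (w - y)" unfolding zl by (simp add: algebra_simps)
          then have "((t - ?a) / (1 - ?a)) *\<^sub>R (w - z) = (t - ?a) *\<^sub>R (w - y)" using st(2) 3(4) by simp
          then show ?thesis unfolding zl 3(5) by (simp add: algebra_simps)
        qed
        moreover have *: "1 - ?a > 0" "t - ?a > 0" "t - ?a < 1 - ?a" using st 3(4) by linarith+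
        then have "0 < (t - ?a) / (1 - ?a)" by (intro divide_pos_pos)
        moreover have "(t - ?a) / (1 - ?a) < 1"
          using divide_less_eq_1_pos[THEN iffD2, OF *(1,3)] .
        ultimately have "x \<in> open_simplex (insert w W)" unfolding cone[OF WT'] using W(2) by blast
        then show ?thesis using WT' by blast
      qed
    qed
    show ?thesis
    proof (intro exI[of _ ?N] conjI ballI impI)
      show "W \<subseteq> insert w V" "\<not> affine_dependent W" if "W \<in> ?N" for W using N2[OF that] by blast+
    qed (rule N1 N3 N4; assumption)+
  qed
qed

lemma ehrhart_poly_convex_hull:
  fixes V :: "(real ^ 'n) set"
  assumes "finite V" "V \<subseteq> int_lattice"
  shows "ehrhart_poly (CARD('n) + r) r v (convex hull V)"
proof -
  obtain T where T: "finite T" "\<forall>W\<in>T. W \<subseteq> V \<and> \<not> affine_dependent W"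
    "\<forall>W\<in>T. \<forall>W'\<in>T. W \<noteq> W' \<longrightarrow> open_simplex W \<inter> open_simplex W' = {}"
    "\<Union>(open_simplex ` T) = convex hull V"
    using convex_hull_triangulation[OF assms(1)] by (elim exE conjE)
  have "ehrhart_poly (CARD('n) + r) r v (\<Union>(open_simplex ` T))"
  proof (rule ehrhart_poly_Union[OF T(1)])
    show "ehrhart_poly (CARD('n) + r) r v (open_simplex W)" if "W \<in> T" for W
      by (rule ehrhart_poly_open_simplex) (use that T(2) assms(2) in auto)
    show "open_simplex W \<inter> open_simplex W' = {}" if "W \<in> T" "W' \<in> T" "W \<noteq> W'" for W W'
      using T(3) that by simp
  qed
  then show ?thesis using T(4) by simp
qed

section \<open>Lattice polytopes and the leading moment\<close>

lemma lattice_polytopes_iff: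
  "P \<in> lattice_polytopes \<longleftrightarrow> (\<exists>V. finite V \<and> V \<subseteq> int_lattice \<and> P = convex hull V)"
proof
  assume P: "P \<in> lattice_polytopes"
  then obtain W where W: "finite W" "P = convex hull W" by (auto simp: lattice_polytopes_def polytope_def)
  have "{x. x extreme_point_of P} \<subseteq> W" using extreme_point_of_convex_hull W(2) by blast
  then have "finite {x. x extreme_point_of P}" using W(1) finite_subset by blast
  moreover have "P = convex hull {x. x extreme_point_of P}" using Krein_Milman_polytope[OF W(1)] W(2) by simp
  moreover have "{x. x extreme_point_of P} \<subseteq> int_lattice" using P by (auto simp: lattice_polytopes_def)
  ultimately show "\<exists>V. finite V \<and> V \<subseteq> int_lattice \<and> P = convex hull V" by (intro exI[of _ "{x. x extreme_point_of P}"] conjI)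
next
  assume "\<exists>V. finite V \<and> V \<subseteq> int_lattice \<and> P = convex hull V"
  then obtain V where "finite V" "V \<subseteq> int_lattice" "P = convex hull V" by blast
  then show "P \<in> lattice_polytopes"
    using extreme_point_of_convex_hull by (fastforce simp: lattice_polytopes_def polytope_def)
qed

lemma empty_lattice_polytope: "{} \<in> lattice_polytopes"
  unfolding lattice_polytopes_iff by (intro exI[of _ "{}"]) simp

lemma lattice_polytope_translate:
  assumes "P \<in> lattice_polytopes" "y \<in> int_lattice"
  shows "(\<lambda>x. x + y) ` P \<in> lattice_polytopes"
proof -
  obtain V where V: "finite V" "V \<subseteq> int_lattice" "P = convex hull V" using assms(1) lattice_polytopes_iff by blast
  have "(\<lambda>x. x + y) ` P = convex hull ((\<lambda>x. x + y) ` V)"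
    using convex_hull_translation[of y V] V(3) by (simp add: add.commute)
  then show ?thesis unfolding lattice_polytopes_iff using V assms(2)
    by (intro exI[of _ "(\<lambda>x. x + y) ` V"]) (auto intro: int_lattice_arith)
qed

lemma lattice_polytope_scale:
  assumes "P \<in> lattice_polytopes"
  shows "(\<lambda>x. real k *\<^sub>R x) ` P \<in> lattice_polytopes"
proof -
  obtain V where V: "finite V" "V \<subseteq> int_lattice" "P = convex hull V" using assms lattice_polytopes_iff by blast
  have "(\<lambda>x. real k *\<^sub>R x) ` P = convex hull ((\<lambda>x. real k *\<^sub>R x) ` V)"
    unfolding V(3) by (rule convex_hull_scaling[symmetric])
  then show ?thesis unfolding lattice_polytopes_iff using V
    by (intro exI[of _ "(\<lambda>x. real k *\<^sub>R x) ` V"]) (auto intro!: int_lattice_arith)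
qed

lemma bounded_lattice_polytope: "P \<in> lattice_polytopes \<Longrightarrow> bounded P"
  by (auto simp: lattice_polytopes_def polytope_imp_bounded)

lemma finite_lattice_polytope_points:
  "P \<in> lattice_polytopes \<Longrightarrow> finite (P \<inter> int_lattice)"
  by (intro finite_bounded_int_lattice bounded_lattice_polytope)

lemma poly_eq_on_nats:
  fixes p q :: "real poly"
  assumes "\<And>k::nat. k > 0 \<Longrightarrow> poly p (real k) = poly q (real k)"
  shows "p = q"
proof (rule ccontr)
  assume "p \<noteq> q"
  then have "finite {x. poly (p - q) x = 0}" by (intro poly_roots_finite) simp
  moreover have "real ` {0<..} \<subseteq> {x. poly (p - q) x = 0}" using assms by auto
  ultimately have "finite (real ` {0<..})" using finite_subset by blast
  then have "finite {0::nat<..}" by (rule finite_imageD) simp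
  then show False by (simp add: infinite_Ioi)
qed

lemma poly_over_power_tendsto:
  fixes p :: "real poly"
  assumes "degree p \<le> D"
  shows "(\<lambda>k::nat. poly p (real k) / real k ^ D) \<longlonglongrightarrow> coeff p D"
proof -
  have 1: "(\<lambda>k. coeff p i * (real k ^ i / real k ^ D)) \<longlonglongrightarrow> (if i = D then coeff p D else 0)" if "i \<le> D" for i
  proof (cases "i = D")
    case True
    have "\<forall>\<^sub>F k in sequentially. coeff p i * (real k ^ i / real k ^ D) = coeff p D"
      using eventually_gt_at_top[of 0] by eventually_elim (use True in simp)
    then show ?thesis using True by (simp add: tendsto_eventually)
  next
    case False
    have "(\<lambda>k. coeff p i * (inverse (real k)) ^ (D - i)) \<longlonglongrightarrow> coeff p i * 0 ^ (D - i)"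
      by (intro tendsto_intros lim_inverse_n)
    moreover have "\<forall>\<^sub>F k in sequentially. coeff p i * (inverse (real k)) ^ (D - i) = coeff p i * (real k ^ i / real k ^ D)"
      using eventually_gt_at_top[of 0]
      by eventually_elim (use that in \<open>simp add: power_diff field_simps power_inverse\<close>)
    ultimately have "(\<lambda>k. coeff p i * (real k ^ i / real k ^ D)) \<longlonglongrightarrow> coeff p i * 0 ^ (D - i)"
      by (rule Lim_transform_eventually)
    moreover have "D - i > 0" using False that by simp
    ultimately show ?thesis using False by (simp add: zero_power)
  qed
  have "(\<lambda>k. \<Sum>i\<le>D. coeff p i * (real k ^ i / real k ^ D)) \<longlonglongrightarrow> (\<Sum>i\<le>D. if i = D then coeff p D else 0)"
    by (intro tendsto_sum 1) simp
  moreover have "(\<Sum>i\<le>D. coeff p i * (real k ^ i / real k ^ D)) = poly p (real k) / real k ^ D" for k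
    unfolding poly_altdef using assms
    by (simp add: sum_divide_distrib) (intro sum.mono_neutral_right, auto simp: coeff_eq_0)
  ultimately show ?thesis by simp
qed

lemma discrete_moment_poly:
  fixes P :: "(real ^ 'n) set"
  assumes "P \<in> lattice_polytopes"
  shows "\<exists>p. degree p \<le> CARD('n) + r \<and>
    (\<forall>k>0. discrete_moment r ((\<lambda>x. real k *\<^sub>R x) ` P) v = poly p (real k)) \<and> (r \<ge> 1 \<longrightarrow> poly p 0 = 0)"
proof -
  obtain V where V: "finite V" "V \<subseteq> int_lattice" "P = convex hull V" using assms lattice_polytopes_iff by blast
  obtain p where "degree p \<le> CARD('n) + r" "\<forall>k>0. lattice_sum r v ((*\<^sub>R) (real k) ` P) = poly p (real k)"
    "r \<ge> 1 \<longrightarrow> poly p 0 = 0"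
    using ehrhart_poly_convex_hull[OF V(1,2)] unfolding ehrhart_poly_def V(3) by blast
  then show ?thesis
    by (intro exI[of _ "smult (1 / fact r) p"]) (auto simp: discrete_moment_def lattice_sum_def)
qed

lemma discrete_moment_0:
  assumes "r \<ge> 1"
  shows "discrete_moment r ((\<lambda>x. real 0 *\<^sub>R x) ` P) v = 0"
proof -
  have "tensor_power x r v = 0" if "x \<in> (\<lambda>x. real 0 *\<^sub>R x) ` P \<inter> int_lattice" for x
    using that assms by (auto simp: tensor_power_def intro!: exI[of _ 0])
  then show ?thesis by (simp add: discrete_moment_def)
qed

text \<open>As a limit it inherits additivity, homogeneity and covariance from the discrete moments.
  It also makes sense in rank 0, where it is the volume; this is the associated function of lowest
  rank of the leading Ehrhart tensor.\<close>

definition top_moment :: "nat \<Rightarrow> (real ^ 'n) set \<Rightarrow> 'n tensor" where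
  "top_moment r P v = lim (\<lambda>k. discrete_moment r ((\<lambda>x. real k *\<^sub>R x) ` P) v / real k ^ (CARD('n) + r))"

lemma top_moment_coeff:
  fixes P :: "(real ^ 'n) set"
  assumes "degree p \<le> CARD('n) + r"
    "\<forall>k>0. discrete_moment r ((\<lambda>x. real k *\<^sub>R x) ` P) v = poly p (real k)"
  shows "(\<lambda>k. discrete_moment r ((\<lambda>x. real k *\<^sub>R x) ` P) v / real k ^ (CARD('n) + r)) \<longlonglongrightarrow> coeff p (CARD('n) + r)"
    and "top_moment r P v = coeff p (CARD('n) + r)"
proof -
  have "\<forall>\<^sub>F k in sequentially. poly p (real k) / real k ^ (CARD('n) + r) =
      discrete_moment r ((\<lambda>x. real k *\<^sub>R x) ` P) v / real k ^ (CARD('n) + r)"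
    using eventually_gt_at_top[of 0] by eventually_elim (use assms(2) in simp)
  then show *: "(\<lambda>k. discrete_moment r ((\<lambda>x. real k *\<^sub>R x) ` P) v / real k ^ (CARD('n) + r)) \<longlonglongrightarrow> coeff p (CARD('n) + r)"
    by (rule Lim_transform_eventually[OF poly_over_power_tendsto[OF assms(1)]])
  then show "top_moment r P v = coeff p (CARD('n) + r)" unfolding top_moment_def by (rule limI)
qed

lemma top_moment_tendsto:
  fixes P :: "(real ^ 'n) set"
  assumes "P \<in> lattice_polytopes"
  shows "(\<lambda>k. discrete_moment r ((\<lambda>x. real k *\<^sub>R x) ` P) v / real k ^ (CARD('n) + r)) \<longlonglongrightarrow> top_moment r P v"
proof -
  obtain p where "degree p \<le> CARD('n) + r" "\<forall>k>0. discrete_moment r ((\<lambda>x. real k *\<^sub>R x) ` P) v = poly p (real k)"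
    using discrete_moment_poly[OF assms] by blast
  from top_moment_coeff[OF this] show ?thesis by simp
qed

lemma discrete_moment_sym_tensor: "discrete_moment r P \<in> sym_tensors r"
proof -
  have "discrete_moment r P v = discrete_moment r P w" if "\<forall>i<r. v i = w i" for v w
    using that by (simp add: discrete_moment_def tensor_power_def)
  moreover have "linear (\<lambda>x. discrete_moment r P (v(i := x)))" if i: "i < r" for v i
  proof -
    have "discrete_moment r P (v(i := x)) =
      (\<Sum>z\<in>P \<inter> int_lattice. (\<Prod>j\<in>{..<r} - {i}. z \<bullet> v j) * (z \<bullet> x)) / fact r" for x
    proof -
      have "(\<Prod>j<r. z \<bullet> (v(i := x)) j) = (z \<bullet> x) * (\<Prod>j\<in>{..<r} - {i}. z \<bullet> v j)" for z
      proof -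
        have "(\<Prod>j\<in>{..<r} - {i}. z \<bullet> (v(i := x)) j) = (\<Prod>j\<in>{..<r} - {i}. z \<bullet> v j)" by (intro prod.cong) auto
        then show ?thesis using i by (simp add: prod.remove[of _ i])
      qed
      then show ?thesis by (simp add: discrete_moment_def tensor_power_def mult.commute)
    qed
    then show ?thesis
      by (intro linearI) (simp_all add: inner_add_right distrib_left distrib_right sum.distrib add_divide_distrib
        sum_distrib_left mult_ac)
  qed
  moreover have "discrete_moment r P (v \<circ> \<sigma>) = discrete_moment r P v" if "\<sigma> permutes {..<r}" for v \<sigma>
    using prod.permute[OF that, of "\<lambda>i. _ \<bullet> v i"] by (simp add: discrete_moment_def tensor_power_def comp_def)
  ultimately show ?thesis by (simp add: sym_tensors_def)
qed

text \<open>The polynomial in \<open>k\<close> is chosen for each \<open>v\<close> separately. Its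
  values at positive integers determine it, so locality, linearity and symmetry in \<open>v\<close>
  pass to every coefficient. The same argument gives the uniqueness behind the definite
  description.\<close>

lemma ehrhart_tensor_top:
  fixes P :: "(real ^ 'n) set"
  assumes "P \<in> lattice_polytopes" "r \<ge> 1"
  shows "ehrhart_tensor r (CARD('n) + r) P = top_moment r P" "top_moment r P \<in> sym_tensors r"
proof -
  let ?D = "CARD('n) + r"
  let ?d = "\<lambda>k. discrete_moment r ((\<lambda>x. real k *\<^sub>R x) ` P)"
  define p where "p v = (SOME q. degree q \<le> ?D \<and> (\<forall>k>0. ?d k v = poly q (real k)) \<and> (r \<ge> 1 \<longrightarrow> poly q 0 = 0))" for v
  have pp: "degree (p v) \<le> ?D \<and> (\<forall>k>0. ?d k v = poly (p v) (real k)) \<and> (r \<ge> 1 \<longrightarrow> poly (p v) 0 = 0)" for v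
    unfolding p_def by (rule someI_ex) (rule discrete_moment_poly[OF assms(1)])
  have p: "\<And>v. degree (p v) \<le> ?D" "\<And>v k. k > 0 \<Longrightarrow> ?d k v = poly (p v) (real k)" "\<And>v. poly (p v) 0 = 0"
    using pp assms(2) by simp_all
  define c where "c i v = coeff (p v) i" for i v
  have sym: "c i \<in> sym_tensors r" for i
  proof -
    have d: "(\<forall>v w. (\<forall>i<r. v i = w i) \<longrightarrow> ?d k v = ?d k w)" "\<And>v i. i < r \<Longrightarrow> linear (\<lambda>x. ?d k (v(i := x)))"
      "\<And>v \<sigma>. \<sigma> permutes {..<r} \<Longrightarrow> ?d k (v \<circ> \<sigma>) = ?d k v" for k
      using discrete_moment_sym_tensor[of r "(\<lambda>x. real k *\<^sub>R x) ` P"] unfolding sym_tensors_def by auto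
    have "c i v = c i w" if "\<forall>i<r. v i = w i" for v w
    proof -
      have "p v = p w" by (rule poly_eq_on_nats) (use d(1) p(2) that in metis)
      then show ?thesis by (simp add: c_def)
    qed
    moreover have "linear (\<lambda>x. c i (v(j := x)))" if j: "j < r" for v j
    proof (rule linearI)
      fix x y and t :: real
      have "p (v(j := x + y)) = p (v(j := x)) + p (v(j := y))"
        by (rule poly_eq_on_nats) (use linear_add[OF d(2)[OF j]] p(2) in \<open>simp flip: p(2)\<close>)
      then show "c i (v(j := x + y)) = c i (v(j := x)) + c i (v(j := y))" by (simp add: c_def)
      have "p (v(j := t *\<^sub>R x)) = smult t (p (v(j := x)))"
        by (rule poly_eq_on_nats) (use linear_scale[OF d(2)[OF j]] p(2) in \<open>simp flip: p(2)\<close>)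
      then show "c i (v(j := t *\<^sub>R x)) = t *\<^sub>R c i (v(j := x))" by (simp add: c_def)
    qed
    moreover have "c i (v \<circ> \<sigma>) = c i v" if "\<sigma> permutes {..<r}" for v \<sigma>
    proof -
      have "p (v \<circ> \<sigma>) = p v" by (rule poly_eq_on_nats) (use d(3)[OF that] p(2) in \<open>simp flip: p(2)\<close>)
      then show ?thesis by (simp add: c_def)
    qed
    ultimately show ?thesis by (simp add: sym_tensors_def)
  qed
  have pd: "poly (p v) (real k) = ?d k v" for v k
    using p(2)[of k v] p(3)[of v] discrete_moment_0[OF assms(2)] by (cases "k = 0") auto
  have E: "ehrhart_coeffs r P c"
    unfolding ehrhart_coeffs_def
  proof (intro conjI ballI allI)
    fix k v
    have "poly (p v) (real k) = (\<Sum>i\<le>?D. coeff (p v) i * real k ^ i)"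
      unfolding poly_altdef using p(1)[of v] by (intro sum.mono_neutral_left) (auto simp: coeff_eq_0)
    also have "\<dots> = (\<Sum>i = 1..?D. c i v * real k ^ i)"
      using p(3)[of v] by (intro sum.mono_neutral_cong_right) (auto simp: c_def poly_0_coeff_0 not_less_eq_eq)
    finally show "?d k v = (\<Sum>i = 1..?D. c i v * real k ^ i)" by (simp add: pd)
  qed (rule sym)
  have U: "c' ?D = c ?D" if c': "ehrhart_coeffs r P c'" for c'
  proof
    fix v
    let ?q = "\<Sum>i = 1..?D. monom (c' i v) i"
    have "p v = ?q"
      by (rule poly_eq_on_nats) (use c' pd in \<open>simp add: ehrhart_coeffs_def poly_sum poly_monom\<close>)
    then have "coeff (p v) ?D = coeff ?q ?D" by simp
    also have "\<dots> = c' ?D v" using assms(2) by (simp add: coeff_sum)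
    finally show "c' ?D v = c ?D v" by (simp add: c_def)
  qed
  have "ehrhart_tensor r ?D P = c ?D"
    unfolding ehrhart_tensor_def
  proof (rule the_equality)
    show "\<exists>c'. ehrhart_coeffs r P c' \<and> c ?D = c' ?D" by (rule exI[of _ c]) (simp add: E)
  next
    fix A assume "\<exists>c'. ehrhart_coeffs r P c' \<and> A = c' ?D"
    then show "A = c ?D" by (elim exE conjE) (simp add: U)
  qed
  moreover have "c ?D = top_moment r P"
  proof
    fix v show "c ?D v = top_moment r P v"
      using top_moment_coeff(2)[of "p v" r P v] p(1,2) by (simp add: c_def)
  qed
  ultimately show "ehrhart_tensor r ?D P = top_moment r P" "top_moment r P \<in> sym_tensors r"
    using sym[of ?D] by simp_all
qed

lemma top_moment_empty: "top_moment r {} v = 0"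
  by (simp add: top_moment_def discrete_moment_def)

lemma top_moment_valuation:
  fixes P :: "(real ^ 'n) set"
  assumes "P \<in> lattice_polytopes" "Q \<in> lattice_polytopes" "P \<union> Q \<in> lattice_polytopes" "P \<inter> Q \<in> lattice_polytopes"
  shows "top_moment r P v + top_moment r Q v = top_moment r (P \<union> Q) v + top_moment r (P \<inter> Q) v"
proof -
  let ?d = "\<lambda>P k. discrete_moment r ((\<lambda>x. real k *\<^sub>R x) ` P) v"
  let ?D = "CARD('n) + r"
  have eq: "?d P k + ?d Q k = ?d (P \<union> Q) k + ?d (P \<inter> Q) k" if "k > 0" for k
  proof -
    have "inj (\<lambda>x::real^'n. real k *\<^sub>R x)" using that by (auto intro: injI)
    then have "(\<lambda>x. real k *\<^sub>R x) ` (P \<inter> Q) = (\<lambda>x. real k *\<^sub>R x) ` P \<inter> (\<lambda>x. real k *\<^sub>R x) ` Q" by (rule image_Int)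
    moreover have "finite ((\<lambda>x. real k *\<^sub>R x) ` P \<inter> int_lattice)" "finite ((\<lambda>x. real k *\<^sub>R x) ` Q \<inter> int_lattice)"
      using assms(1,2) by (auto intro: finite_lattice_polytope_points lattice_polytope_scale)
    ultimately show ?thesis
      using sum.union_inter[of "(\<lambda>x. real k *\<^sub>R x) ` P \<inter> int_lattice" "(\<lambda>x. real k *\<^sub>R x) ` Q \<inter> int_lattice" "\<lambda>x. tensor_power x r v"]
      by (simp add: discrete_moment_def image_Un Int_Un_distrib Int_Un_distrib2 add_divide_distrib[symmetric] Int_ac)
  qed
  have a: "(\<lambda>k. ?d P k / real k ^ ?D + ?d Q k / real k ^ ?D) \<longlonglongrightarrow> top_moment r P v + top_moment r Q v"
    using assms by (intro tendsto_add top_moment_tendsto)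
  have b: "(\<lambda>k. ?d (P \<union> Q) k / real k ^ ?D + ?d (P \<inter> Q) k / real k ^ ?D) \<longlonglongrightarrow> top_moment r (P \<union> Q) v + top_moment r (P \<inter> Q) v"
    using assms by (intro tendsto_add top_moment_tendsto)
  have c: "\<forall>\<^sub>F k in sequentially. ?d P k / real k ^ ?D + ?d Q k / real k ^ ?D =
      ?d (P \<union> Q) k / real k ^ ?D + ?d (P \<inter> Q) k / real k ^ ?D"
    using eventually_gt_at_top[of 0] by eventually_elim (simp add: eq add_divide_distrib[symmetric])
  show ?thesis by (rule LIMSEQ_unique[OF Lim_transform_eventually[OF a c] b])
qed

text \<open>The dilates of mP are the dilates of P by multiples of \<open>m\<close>, so the limit is
  taken along a subsequence.\<close>

lemma top_moment_scale:
  fixes P :: "(real ^ 'n) set"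
  assumes "P \<in> lattice_polytopes" "m > 0"
  shows "top_moment r ((\<lambda>x. real m *\<^sub>R x) ` P) v = real m ^ (CARD('n) + r) * top_moment r P v"
proof -
  let ?d = "\<lambda>P k. discrete_moment r ((\<lambda>x. real k *\<^sub>R x) ` P) v"
  let ?D = "CARD('n) + r"
  have "(\<lambda>k. ?d P (m * k) / real (m * k) ^ ?D) \<longlonglongrightarrow> top_moment r P v"
    using LIMSEQ_subseq_LIMSEQ[OF top_moment_tendsto[OF assms(1), of r v], of "\<lambda>k. m * k"] assms(2)
    by (simp add: comp_def strict_mono_def)
  then have "(\<lambda>k. real m ^ ?D * (?d P (m * k) / real (m * k) ^ ?D)) \<longlonglongrightarrow> real m ^ ?D * top_moment r P v"
    by (rule tendsto_mult_left)
  moreover have "real m ^ ?D * (?d P (m * k) / real (m * k) ^ ?D) = ?d ((\<lambda>x. real m *\<^sub>R x) ` P) k / real k ^ ?D" for k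
    using assms(2) by (simp add: image_image mult.commute power_mult_distrib)
  ultimately have "(\<lambda>k. ?d ((\<lambda>x. real m *\<^sub>R x) ` P) k / real k ^ ?D) \<longlonglongrightarrow> real m ^ ?D * top_moment r P v" by simp
  then show ?thesis
    by (rule LIMSEQ_unique[OF top_moment_tendsto[OF lattice_polytope_scale[OF assms(1)]]])
qed

text \<open>The k-fold dilate of P + y is that of P moved by ky. In the binomial expansion the j-th
  term carries k^j, which turns the normalization for rank \<open>r\<close> into the one for rank
  \<open>r - j\<close>. On diagonal arguments tensor products are plain products.\<close>

lemma top_moment_translate:
  fixes P :: "(real ^ 'n) set"
  assumes "P \<in> lattice_polytopes" "y \<in> int_lattice"
  shows "top_moment r ((\<lambda>x. x + y) ` P) (\<lambda>_. u) =
    (\<Sum>j\<le>r. top_moment (r - j) P (\<lambda>_. u) * (y \<bullet> u) ^ j / fact j)"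
proof -
  let ?d = "\<lambda>r P k. discrete_moment r ((\<lambda>x. real k *\<^sub>R x) ` P) (\<lambda>_. u)"
  let ?n = "CARD('n)"
  have eq: "?d r ((\<lambda>x. x + y) ` P) k = (\<Sum>j\<le>r. ?d (r - j) P k * real k ^ j * (y \<bullet> u) ^ j / fact j)" for k
  proof -
    let ?K = "(\<lambda>x. real k *\<^sub>R x) ` P"
    have im: "(\<lambda>x. real k *\<^sub>R x) ` (\<lambda>x. x + y) ` P \<inter> int_lattice = (\<lambda>x. x + real k *\<^sub>R y) ` (?K \<inter> int_lattice)"
    proof -
      have "real k *\<^sub>R y \<in> int_lattice" using assms(2) by (simp add: int_lattice_arith)
      then have "x + real k *\<^sub>R y \<in> int_lattice \<longleftrightarrow> x \<in> int_lattice" for x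
        using int_lattice_arith(2)[of x "real k *\<^sub>R y"] int_lattice_arith(3)[of "x + real k *\<^sub>R y" "real k *\<^sub>R y"] by auto
      moreover have "(\<lambda>x. real k *\<^sub>R x) ` (\<lambda>x. x + y) ` P = (\<lambda>x. x + real k *\<^sub>R y) ` ?K"
        by (simp add: image_image scaleR_add_right)
      ultimately show ?thesis by auto
    qed
    have "?d r ((\<lambda>x. x + y) ` P) k = (\<Sum>x\<in>?K \<inter> int_lattice. ((x + real k *\<^sub>R y) \<bullet> u) ^ r) / fact r"
      unfolding discrete_moment_def im by (subst sum.reindex) (auto simp: tensor_power_def inj_on_def)
    also have "(\<Sum>x\<in>?K \<inter> int_lattice. ((x + real k *\<^sub>R y) \<bullet> u) ^ r) =
       (\<Sum>x\<in>?K \<inter> int_lattice. \<Sum>j\<le>r. of_nat (r choose j) * (real k * (y \<bullet> u)) ^ j * (x \<bullet> u) ^ (r - j))"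
      by (simp only: inner_add_left inner_scaleR_left add.commute[of "_ \<bullet> u" "real k * _"] binomial_ring)
    also have "\<dots> = (\<Sum>j\<le>r. \<Sum>x\<in>?K \<inter> int_lattice. of_nat (r choose j) * (real k * (y \<bullet> u)) ^ j * (x \<bullet> u) ^ (r - j))"
      by (rule sum.swap)
    also have "\<dots> / fact r = (\<Sum>j\<le>r. ?d (r - j) P k * real k ^ j * (y \<bullet> u) ^ j / fact j)"
      unfolding sum_divide_distrib[of _ "{..r}"]
      by (intro sum.cong refl) (simp only: sum_distrib_left[symmetric],
        simp add: discrete_moment_def tensor_power_def binomial_fact power_mult_distrib mult_ac)
    finally show ?thesis .
  qed
  have "(\<lambda>k. \<Sum>j\<le>r. ?d (r - j) P k / real k ^ (?n + (r - j)) * (y \<bullet> u) ^ j / fact j) \<longlonglongrightarrow>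
      (\<Sum>j\<le>r. top_moment (r - j) P (\<lambda>_. u) * (y \<bullet> u) ^ j / fact j)"
    by (intro tendsto_intros top_moment_tendsto assms) auto
  moreover have "\<forall>\<^sub>F k in sequentially. (\<Sum>j\<le>r. ?d (r - j) P k / real k ^ (?n + (r - j)) * (y \<bullet> u) ^ j / fact j) =
      ?d r ((\<lambda>x. x + y) ` P) k / real k ^ (?n + r)"
    using eventually_gt_at_top[of 0]
  proof eventually_elim
    case (elim k)
    show ?case
      unfolding eq sum_divide_distrib
    proof (intro sum.cong refl)
      fix j assume "j \<in> {..r}"
      then have "real k ^ (?n + r) = real k ^ (?n + (r - j)) * real k ^ j" by (simp flip: power_add)
      then show "?d (r - j) P k / real k ^ (?n + (r - j)) * (y \<bullet> u) ^ j / fact j =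
        ?d (r - j) P k * real k ^ j * (y \<bullet> u) ^ j / fact j / real k ^ (?n + r)"
        using elim by simp
    qed
  qed
  ultimately have "(\<lambda>k. ?d r ((\<lambda>x. x + y) ` P) k / real k ^ (?n + r)) \<longlonglongrightarrow>
      (\<Sum>j\<le>r. top_moment (r - j) P (\<lambda>_. u) * (y \<bullet> u) ^ j / fact j)"
    by (rule Lim_transform_eventually)
  then show ?thesis
    by (rule LIMSEQ_unique[OF top_moment_tendsto[OF lattice_polytope_translate[OF assms]]])
qed

definition unit_cube :: "(real ^ 'n) set" where
  "unit_cube = {x. \<forall>i. 0 \<le> x $ i \<and> x $ i \<le> 1}"

text \<open>The k-fold cube has (k + 1)^n lattice points. This value normalizes the constant of the
  theorem.\<close>

lemma top_moment_cube: "top_moment 0 (unit_cube :: (real ^ 'n) set) v = 1"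
proof -
  let ?n = "CARD('n)"
  have d: "discrete_moment 0 ((\<lambda>x. real k *\<^sub>R x) ` (unit_cube :: (real ^ 'n) set)) v = (real k + 1) ^ ?n" if "k > 0" for k
  proof -
    let ?K = "(\<lambda>x. real k *\<^sub>R x) ` (unit_cube :: (real ^ 'n) set) \<inter> int_lattice"
    let ?F = "(UNIV :: 'n set) \<rightarrow>\<^sub>E {0..k}"
    have "bij_betw (\<lambda>f. (\<chi> i. real (f i)) :: real ^ 'n) ?F ?K"
    proof (rule bij_betw_imageI)
      show "inj_on (\<lambda>f. (\<chi> i. real (f i)) :: real ^ 'n) ?F" by (auto simp: inj_on_def vec_eq_iff)
      show "(\<lambda>f. (\<chi> i. real (f i)) :: real ^ 'n) ` ?F = ?K"
      proof (intro equalityI subsetI)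
        fix x assume "x \<in> (\<lambda>f. (\<chi> i. real (f i)) :: real ^ 'n) ` ?F"
        then obtain f where "f \<in> ?F" "x = (\<chi> i. real (f i))" by blast
        then have f: "\<And>i. f i \<le> k" "x = (\<chi> i. real (f i))" by (auto simp: PiE_iff)
        have "x = real k *\<^sub>R (\<chi> i. real (f i) / real k)" using f that by (simp add: vec_eq_iff)
        moreover have "(\<chi> i. real (f i) / real k) \<in> unit_cube" using f that by (auto simp: unit_cube_def)
        ultimately show "x \<in> ?K" using f by (auto simp: int_lattice_def)
      next
        fix x assume x: "x \<in> ?K"
        then have *: "0 \<le> x $ i" "x $ i \<le> real k" "x $ i \<in> \<int>" for i
          by (auto simp: unit_cube_def int_lattice_def mult_left_le)
        have "real (nat \<lfloor>x $ i\<rfloor>) = x $ i" for i using *[of i] by (auto elim: Ints_cases)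
        moreover from this have "nat \<lfloor>x $ i\<rfloor> \<le> k" for i using *(2)[of i] by (metis of_nat_le_iff)
        ultimately show "x \<in> (\<lambda>f. (\<chi> i. real (f i)) :: real ^ 'n) ` ?F"
          by (intro image_eqI[of _ _ "\<lambda>i. nat \<lfloor>x $ i\<rfloor>"]) (auto simp: vec_eq_iff)
      qed
    qed
    then have "card ?K = card ?F" by (simp add: bij_betw_same_card)
    also have "\<dots> = (k + 1) ^ ?n" by (simp add: card_PiE)
    finally show ?thesis by (simp add: discrete_moment_def tensor_power_def add.commute)
  qed
  have "(\<lambda>k. (1 + inverse (real k)) ^ ?n) \<longlonglongrightarrow> (1 + 0) ^ ?n" by (intro tendsto_intros lim_inverse_n)
  moreover have "\<forall>\<^sub>F k in sequentially. (1 + inverse (real k)) ^ ?n =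
      discrete_moment 0 ((\<lambda>x. real k *\<^sub>R x) ` (unit_cube :: (real ^ 'n) set)) v / real k ^ (?n + 0)"
    using eventually_gt_at_top[of 0]
    by eventually_elim (simp add: d field_simps flip: power_divide power_mult_distrib)
  ultimately have "(\<lambda>k. discrete_moment 0 ((\<lambda>x. real k *\<^sub>R x) ` (unit_cube :: (real ^ 'n) set)) v / real k ^ (?n + 0)) \<longlonglongrightarrow> (1 + 0) ^ ?n"
    by (rule Lim_transform_eventually)
  then show ?thesis unfolding top_moment_def by (simp add: limI)
qed

section \<open>Rational polytopes\<close>

definition rat_vecs :: "(real ^ 'n) set" where
  "rat_vecs = {x. \<forall>i. x $ i \<in> \<rat>}"

definition rat_polytopes :: "(real ^ 'n) set set" where
  "rat_polytopes = {P. \<exists>V. finite V \<and> V \<subseteq> rat_vecs \<and> P = convex hull V}"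

lemma rat_vecs_arith:
  "0 \<in> rat_vecs"
  "x \<in> rat_vecs \<Longrightarrow> y \<in> rat_vecs \<Longrightarrow> x + y \<in> rat_vecs"
  "x \<in> rat_vecs \<Longrightarrow> y \<in> rat_vecs \<Longrightarrow> x - y \<in> rat_vecs"
  "x \<in> rat_vecs \<Longrightarrow> - x \<in> rat_vecs"
  "x \<in> rat_vecs \<Longrightarrow> c \<in> \<rat> \<Longrightarrow> c *\<^sub>R x \<in> rat_vecs"
  "c \<in> \<rat> \<Longrightarrow> axis i c \<in> rat_vecs"
  by (auto simp: rat_vecs_def axis_def)

lemma rat_vecs_sum: "(\<And>i. i \<in> I \<Longrightarrow> f i \<in> rat_vecs) \<Longrightarrow> sum f I \<in> rat_vecs"
  by (induction I rule: infinite_finite_induct) (auto simp: rat_vecs_arith)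

lemma Rats_sum: "(\<And>i. i \<in> I \<Longrightarrow> f i \<in> \<rat>) \<Longrightarrow> sum f I \<in> \<rat>"
  by (induction I rule: infinite_finite_induct) auto

lemma rat_vecs_inner:
  assumes "x \<in> rat_vecs" "y \<in> rat_vecs"
  shows "x \<bullet> y \<in> \<rat>"
proof -
  have "x \<bullet> y = (\<Sum>i\<in>UNIV. x $ i * y $ i)" by (simp add: inner_vec_def)
  then show ?thesis using assms by (auto simp: rat_vecs_def intro!: Rats_sum)
qed

lemma int_lattice_rat: "int_lattice \<subseteq> rat_vecs"
  using Ints_subset_Rats by (auto simp: int_lattice_def rat_vecs_def)

lemma lattice_rat_polytope: "P \<in> lattice_polytopes \<Longrightarrow> P \<in> rat_polytopes"
  unfolding lattice_polytopes_iff rat_polytopes_def using int_lattice_rat by blast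

lemma rat_polytopeI: "finite V \<Longrightarrow> V \<subseteq> rat_vecs \<Longrightarrow> convex hull V \<in> rat_polytopes"
  by (auto simp: rat_polytopes_def)

text \<open>The hypothesis \<open>le\<close> says that the weights on \<open>a\<close> and
  \<open>b\<close> balance on the side of \<open>a\<close> as seen from the new point of the edge,
  so that all weight on \<open>b\<close> can be traded for weight on that point.\<close>

lemma convex_hull_edge_split_aux:
  fixes V :: "('a::real_vector) set"
  assumes V: "finite V" "a \<in> V" "b \<in> V" "a \<noteq> b" and s: "0 < s" "s < 1"
    and u: "\<forall>x\<in>V. 0 \<le> u x" "sum u V = 1" and le: "u b * (1 - s) \<le> u a * s"
  shows "(\<Sum>x\<in>V. u x *\<^sub>R x) \<in> convex hull (insert ((1 - s) *\<^sub>R a + s *\<^sub>R b) (V - {b}))"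
proof -
  define q where "q = (1 - s) *\<^sub>R a + s *\<^sub>R b"
  \<comment> \<open>\<open>t\<close> units of \<open>q\<close> contain \<open>u b\<close> units of
    \<open>b\<close> and \<open>t * (1 - s)\<close> units of \<open>a\<close>, which must not exceed
    \<open>u a\<close>.\<close>
  define t where "t = u b / s"
  define c where "c x = (if x = b then t else if x = a then u a - t * (1 - s) else u x)" for x
  define y where "y x = (if x = b then q else x)" for x
  let ?R = "V - {a} - {b}"
  have t: "t \<ge> 0" "t * s = u b" using u V s by (auto simp: t_def)
  have "t * (1 - s) \<le> u a" using le s by (simp add: t_def divide_le_eq)
  then have c0: "\<forall>x\<in>V. 0 \<le> c x" using t u by (auto simp: c_def)
  have split: "sum f V = f a + (f b + sum f ?R)" for f :: "'a \<Rightarrow> 'b::comm_monoid_add"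
    using V by (simp add: sum.remove[of V a] sum.remove[of "V - {a}" b])
  have "sum c ?R = sum u ?R" by (intro sum.cong) (auto simp: c_def)
  then have "sum c V = 1"
    using u(2) t unfolding split[of c] split[of u] using V(4) by (simp add: c_def algebra_simps)
  moreover have "(\<Sum>x\<in>V. c x *\<^sub>R y x) = (\<Sum>x\<in>V. u x *\<^sub>R x)"
  proof -
    have "(\<Sum>x\<in>?R. c x *\<^sub>R y x) = (\<Sum>x\<in>?R. u x *\<^sub>R x)" by (intro sum.cong) (auto simp: c_def y_def)
    then show ?thesis unfolding split[of "\<lambda>x. c x *\<^sub>R y x"] split[of "\<lambda>x. u x *\<^sub>R x"]
      using V(4) t(2)[symmetric] by (simp add: c_def y_def q_def algebra_simps)
  qed
  moreover have "\<forall>x\<in>V. y x \<in> convex hull (insert q (V - {b}))"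
    by (auto simp: y_def intro: hull_inc)
  ultimately have "(\<Sum>x\<in>V. u x *\<^sub>R x) \<in> convex hull (insert q (V - {b}))"
    using convex_sum[OF V(1) convex_convex_hull, of c y "insert q (V - {b})"] c0 by auto
  then show ?thesis by (simp add: q_def)
qed

lemma convex_hull_edge_split:
  fixes V :: "('a::real_vector) set"
  assumes V: "finite V" "a \<in> V" "b \<in> V" "a \<noteq> b" and s: "0 < s" "s < 1" and q: "q = (1 - s) *\<^sub>R a + s *\<^sub>R b"
  shows "convex hull V = convex hull (insert q (V - {b})) \<union> convex hull (insert q (V - {a}))"
proof (intro equalityI subsetI)
  fix x assume "x \<in> convex hull V"
  then obtain u where u: "\<forall>x\<in>V. 0 \<le> u x" "sum u V = 1" "(\<Sum>x\<in>V. u x *\<^sub>R x) = x"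
    unfolding convex_hull_finite[OF V(1)] by auto
  have q': "q = (1 - (1 - s)) *\<^sub>R b + (1 - s) *\<^sub>R a" using q by (simp add: add.commute)
  consider "u b * (1 - s) \<le> u a * s" | "u a * (1 - (1 - s)) \<le> u b * (1 - s)" by fastforce
  then show "x \<in> convex hull (insert q (V - {b})) \<union> convex hull (insert q (V - {a}))"
  proof cases
    case 1
    then show ?thesis using convex_hull_edge_split_aux[OF V s u(1,2)] u(3) q by simp
  next
    case 2
    then show ?thesis
      using convex_hull_edge_split_aux[OF V(1,3,2) V(4)[symmetric] _ _ u(1,2), of "1 - s"] u(3) q' s by simp
  qed
next
  have "q \<in> convex hull V" unfolding q
    by (rule convexD_alt[OF convex_convex_hull]) (use V s in \<open>auto intro: hull_inc\<close>)
  then have "insert q (V - {b}) \<subseteq> convex hull V" "insert q (V - {a}) \<subseteq> convex hull V"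
    by (auto intro: hull_inc)
  then have "convex hull (insert q (V - {b})) \<subseteq> convex hull V" "convex hull (insert q (V - {a})) \<subseteq> convex hull V"
    by (simp_all only: hull_minimal convex_convex_hull)
  then show "x \<in> convex hull (insert q (V - {b})) \<union> convex hull (insert q (V - {a})) \<Longrightarrow> x \<in> convex hull V" for x
    by blast
qed

lemma crossing_point:
  fixes c a b :: "'a::real_inner" and e :: real
  assumes "c \<bullet> a > e" "c \<bullet> b < e" and s: "s = (c \<bullet> a - e) / (c \<bullet> a - c \<bullet> b)"
  shows "0 < s" "s < 1" "c \<bullet> ((1 - s) *\<^sub>R a + s *\<^sub>R b) = e"
proof -
  have "c \<bullet> a - c \<bullet> b > 0" using assms by simp
  then show "0 < s" "s < 1" unfolding s using assms by (auto simp: divide_less_eq_1)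
  have "s * (c \<bullet> a - c \<bullet> b) = c \<bullet> a - e" using \<open>c \<bullet> a - c \<bullet> b > 0\<close> s by simp
  then show "c \<bullet> ((1 - s) *\<^sub>R a + s *\<^sub>R b) = e" by (simp add: inner_add_right algebra_simps)
qed

text \<open>Splitting a crossing edge at its point \<open>q\<close> on the hyperplane lowers the
  number of vertices off it. Stating the claim for any \<open>K\<close> that contains the crossing
  points makes the induction work: \<open>q\<close> lies on the hyperplane and creates no further
  crossing edges.\<close>

lemma convex_hull_cut_subset:
  fixes V :: "('a::euclidean_space) set" and e :: real
  assumes "finite V" "{v\<in>V. c \<bullet> v \<ge> e} \<subseteq> K"
    "\<And>a b s. a \<in> V \<Longrightarrow> b \<in> V \<Longrightarrow> c \<bullet> a > e \<Longrightarrow> c \<bullet> b < e \<Longrightarrow> s = (c \<bullet> a - e) / (c \<bullet> a - c \<bullet> b) \<Longrightarrow>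
       (1 - s) *\<^sub>R a + s *\<^sub>R b \<in> K"
  shows "convex hull V \<inter> {x. c \<bullet> x \<ge> e} \<subseteq> convex hull K"
  using assms
proof (induction "card {v\<in>V. c \<bullet> v > e} + card {v\<in>V. c \<bullet> v < e}" arbitrary: V rule: less_induct)
  case (less V)
  note fin = less.prems(1)
  show ?case
  proof (cases "\<exists>a\<in>V. \<exists>b\<in>V. c \<bullet> a > e \<and> c \<bullet> b < e")
    case True
    then obtain a b where ab: "a \<in> V" "b \<in> V" "c \<bullet> a > e" "c \<bullet> b < e" by blast
    define s where "s = (c \<bullet> a - e) / (c \<bullet> a - c \<bullet> b)"
    define q where "q = (1 - s) *\<^sub>R a + s *\<^sub>R b"
    have s: "0 < s" "s < 1" "c \<bullet> q = e" using crossing_point[OF ab(3,4) s_def] by (simp_all add: q_def)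
    have qK: "q \<in> K" unfolding q_def by (rule less.prems(3)[OF ab s_def])
    have "convex hull (insert q (V - {z})) \<inter> {x. c \<bullet> x \<ge> e} \<subseteq> convex hull K" if z: "z = a \<or> z = b" for z
    proof (rule less.hyps)
      have 1: "{v\<in>insert q (V - {z}). c \<bullet> v > e} = {v\<in>V. c \<bullet> v > e} - {z}"
        "{v\<in>insert q (V - {z}). c \<bullet> v < e} = {v\<in>V. c \<bullet> v < e} - {z}" using s(3) by auto
      have "card ({v\<in>V. c \<bullet> v > e} - {z}) \<le> card {v\<in>V. c \<bullet> v > e}"
        "card ({v\<in>V. c \<bullet> v < e} - {z}) \<le> card {v\<in>V. c \<bullet> v < e}"
        using fin by (auto intro!: card_mono)
      moreover have "card ({v\<in>V. c \<bullet> v > e} - {z}) < card {v\<in>V. c \<bullet> v > e} \<or>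
        card ({v\<in>V. c \<bullet> v < e} - {z}) < card {v\<in>V. c \<bullet> v < e}"
        using z ab fin by (auto intro!: card_Diff1_less)
      ultimately show "card {v\<in>insert q (V - {z}). c \<bullet> v > e} + card {v\<in>insert q (V - {z}). c \<bullet> v < e}
        < card {v\<in>V. c \<bullet> v > e} + card {v\<in>V. c \<bullet> v < e}" unfolding 1 by linarith
      show "finite (insert q (V - {z}))" using fin by simp
      show "{v\<in>insert q (V - {z}). c \<bullet> v \<ge> e} \<subseteq> K" using less.prems(2) qK by auto
      fix a' b' s' assume "a' \<in> insert q (V - {z})" "b' \<in> insert q (V - {z})" "c \<bullet> a' > e" "c \<bullet> b' < e"
        "s' = (c \<bullet> a' - e) / (c \<bullet> a' - c \<bullet> b')"
      then show "(1 - s') *\<^sub>R a' + s' *\<^sub>R b' \<in> K" using s(3) by (intro less.prems(3)) auto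
    qed
    moreover have "convex hull V = convex hull (insert q (V - {b})) \<union> convex hull (insert q (V - {a}))"
      by (rule convex_hull_edge_split[OF fin ab(1,2) _ s(1,2) q_def]) (use ab in auto)
    ultimately show ?thesis by blast
  next
    case False
    show ?thesis
    proof (cases "\<exists>b\<in>V. c \<bullet> b < e")
      case True
      \<comment> \<open>No vertex is strictly above, so a point of the half-space puts weight only
        on vertices lying on the hyperplane.\<close>
      then have np: "c \<bullet> v \<le> e" if "v \<in> V" for v using False that by force
      show ?thesis
      proof
        fix x assume "x \<in> convex hull V \<inter> {x. c \<bullet> x \<ge> e}"
        then obtain u where u: "\<forall>v\<in>V. 0 \<le> u v" "sum u V = 1" "(\<Sum>v\<in>V. u v *\<^sub>R v) = x" and x: "c \<bullet> x \<ge> e"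
          unfolding convex_hull_finite[OF fin] by auto
        have "(\<Sum>v\<in>V. u v * (e - c \<bullet> v)) = e - c \<bullet> x"
          using u(2) unfolding u(3)[symmetric]
          by (simp add: inner_sum_right right_diff_distrib sum_subtractf sum_distrib_right[symmetric])
        moreover have "u v * (e - c \<bullet> v) \<ge> 0" if "v \<in> V" for v using u(1) np that by simp
        ultimately have "u v * (e - c \<bullet> v) = 0" if "v \<in> V" for v
          using sum_nonneg_eq_0_iff[OF fin, of "\<lambda>v. u v * (e - c \<bullet> v)"] x that sum_nonneg[of V "\<lambda>v. u v * (e - c \<bullet> v)"]
          by fastforce
        then have z: "u v = 0" if "v \<in> V" "v \<notin> K" for v using less.prems(2) that by force
        have "(\<Sum>v\<in>V. u v *\<^sub>R v) = (\<Sum>v\<in>V \<inter> K. u v *\<^sub>R v)" "sum u V = sum u (V \<inter> K)"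
          by (intro sum.mono_neutral_right ballI; simp add: fin z)+
        then have "x \<in> convex hull (V \<inter> K)"
          using u fin unfolding convex_hull_finite[OF finite_Int[OF disjI1[OF fin]]] by auto
        then show "x \<in> convex hull K" using hull_mono[of "V \<inter> K" K convex] by auto
      qed
    next
      case False
      then have "V \<subseteq> K" using less.prems(2) by force
      then show ?thesis using hull_mono[of V K convex] by blast
    qed
  qed
qed

lemma rat_polytope_cut:
  assumes "P \<in> rat_polytopes" "c \<in> rat_vecs" "e \<in> \<rat>"
  shows "P \<inter> {x. c \<bullet> x \<ge> e} \<in> rat_polytopes"
proof -
  obtain V where V: "finite V" "V \<subseteq> rat_vecs" "P = convex hull V" using assms(1) by (auto simp: rat_polytopes_def)
  define q where "q = (\<lambda>(a, b). let s = (c \<bullet> a - e) / (c \<bullet> a - c \<bullet> b) in (1 - s) *\<^sub>R a + s *\<^sub>R b)"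
  define E where "E = {(a, b). a \<in> V \<and> b \<in> V \<and> c \<bullet> a > e \<and> c \<bullet> b < e}"
  define K where "K = {v\<in>V. c \<bullet> v \<ge> e} \<union> q ` E"
  have "E \<subseteq> V \<times> V" by (auto simp: E_def)
  then have "finite E" using V(1) finite_subset by blast
  then have finK: "finite K" using V(1) by (simp add: K_def)
  have "P \<inter> {x. c \<bullet> x \<ge> e} \<subseteq> convex hull K"
    unfolding V(3)
  proof (rule convex_hull_cut_subset[OF V(1)])
    show "{v\<in>V. c \<bullet> v \<ge> e} \<subseteq> K" by (simp add: K_def)
    fix a b s assume "a \<in> V" "b \<in> V" "c \<bullet> a > e" "c \<bullet> b < e" "s = (c \<bullet> a - e) / (c \<bullet> a - c \<bullet> b)"
    then have "q (a, b) \<in> K" "q (a, b) = (1 - s) *\<^sub>R a + s *\<^sub>R b" by (auto simp: K_def E_def q_def Let_def)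
    then show "(1 - s) *\<^sub>R a + s *\<^sub>R b \<in> K" by simp
  qed
  moreover have "convex hull K \<subseteq> P \<inter> {x. c \<bullet> x \<ge> e}"
  proof (rule hull_minimal)
    show "convex (P \<inter> {x. c \<bullet> x \<ge> e})"
      unfolding V(3) by (intro convex_Int convex_convex_hull convex_halfspace_ge)
    have "q (a, b) \<in> P \<inter> {x. c \<bullet> x \<ge> e}" if "(a, b) \<in> E" for a b
    proof -
      define s where "s = (c \<bullet> a - e) / (c \<bullet> a - c \<bullet> b)"
      have qe: "q (a, b) = (1 - s) *\<^sub>R a + s *\<^sub>R b" by (simp add: q_def s_def Let_def)
      have s: "0 < s" "s < 1" "c \<bullet> q (a, b) = e"
        using crossing_point[of e c a b, OF _ _ s_def] that qe by (auto simp: E_def)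
      have "q (a, b) \<in> P" unfolding qe V(3)
        by (rule convexD_alt[OF convex_convex_hull]) (use s that in \<open>auto simp: E_def intro: hull_inc\<close>)
      then show ?thesis using s by simp
    qed
    then show "K \<subseteq> P \<inter> {x. c \<bullet> x \<ge> e}" unfolding K_def V(3) by (auto intro: hull_inc)
  qed
  moreover have "q p \<in> rat_vecs" if "p \<in> E" for p
    using that V(2) assms(2,3)
    by (auto simp: E_def q_def Let_def intro!: rat_vecs_arith Rats_diff Rats_divide rat_vecs_inner)
  then have "K \<subseteq> rat_vecs" using V(2) by (auto simp: K_def)
  ultimately show ?thesis using rat_polytopeI[OF finK] by auto
qed

lemma rat_polytope_cuts:
  assumes "finite G" "G \<subseteq> rat_vecs \<times> \<rat>" "P \<in> rat_polytopes"
  shows "P \<inter> {x. \<forall>(c, e)\<in>G. c \<bullet> x \<ge> e} \<in> rat_polytopes"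
  using assms
proof (induction G rule: finite_induct)
  case (insert g G)
  obtain c e where g: "g = (c, e)" by (cases g)
  have "P \<inter> {x. \<forall>(c, e)\<in>G. c \<bullet> x \<ge> e} \<in> rat_polytopes" using insert by auto
  then have "P \<inter> {x. \<forall>(c, e)\<in>G. c \<bullet> x \<ge> e} \<inter> {x. c \<bullet> x \<ge> e} \<in> rat_polytopes"
    by (rule rat_polytope_cut) (use insert.prems g in auto)
  moreover have "P \<inter> {x. \<forall>(c, e)\<in>insert g G. c \<bullet> x \<ge> e} = P \<inter> {x. \<forall>(c, e)\<in>G. c \<bullet> x \<ge> e} \<inter> {x. c \<bullet> x \<ge> e}"
    using g by auto
  ultimately show ?case by simp
qed simp

text \<open>Fourier-Motzkin elimination for the cone over the polytope.\<close>

lemma cone_halfspaces: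
  fixes V :: "(real ^ 'n) set"
  assumes "finite V" "V \<subseteq> rat_vecs"
  shows "\<exists>G. finite G \<and> G \<subseteq> rat_vecs \<times> \<rat> \<and>
    (\<forall>x t. (\<exists>u. (\<forall>v\<in>V. 0 \<le> u v) \<and> (\<Sum>v\<in>V. u v *\<^sub>R v) = x \<and> sum u V = t) \<longleftrightarrow> (\<forall>(c, e)\<in>G. c \<bullet> x + e * t \<ge> 0))"
  using assms
proof (induction V rule: finite_induct)
  case empty
  \<comment> \<open>The cone over the empty set is the origin, cut out here by pairs of opposite
    half-spaces.\<close>
  let ?G = "(\<lambda>i. (axis i 1, 0)) ` (UNIV :: 'n set) \<union> (\<lambda>i. (axis i (-1), 0)) ` (UNIV :: 'n set) \<union> {(0, 1), (0, -1)}"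
  have gi: "x = 0 \<and> t = 0 \<longleftrightarrow> (\<forall>(c, e)\<in>?G. c \<bullet> x + e * t \<ge> 0)" for x :: "real ^ 'n" and t
  proof -
    have "(\<forall>(c, e)\<in>?G. c \<bullet> x + e * t \<ge> 0) \<longleftrightarrow> (\<forall>i. x $ i \<ge> 0) \<and> (\<forall>i. - (x $ i) \<ge> 0) \<and> t \<ge> 0 \<and> - t \<ge> 0"
      by (auto simp: ball_Un inner_axis')
    then show ?thesis by (auto simp: vec_eq_iff intro: antisym)
  qed
  have gs: "?G \<subseteq> rat_vecs \<times> \<rat>" by (auto intro!: rat_vecs_arith)
  show ?case
  proof (intro exI[of _ ?G] conjI allI)
    fix x :: "real ^ 'n" and t :: real
    show "(\<exists>u. (\<forall>v\<in>{}. 0 \<le> u v) \<and> (\<Sum>v\<in>{}. u v *\<^sub>R v) = x \<and> sum u {} = t) \<longleftrightarrow>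
        (\<forall>(c, e)\<in>?G. c \<bullet> x + e * t \<ge> 0)"
      unfolding gi[symmetric] by auto
  qed (simp, rule gs)
next
  case (insert w V)
  obtain G where G: "finite G" "G \<subseteq> rat_vecs \<times> \<rat>" and
    iff: "\<And>x t. (\<exists>u. (\<forall>v\<in>V. 0 \<le> u v) \<and> (\<Sum>v\<in>V. u v *\<^sub>R v) = x \<and> sum u V = t) \<longleftrightarrow> (\<forall>g\<in>G. fst g \<bullet> x + snd g * t \<ge> 0)"
    using insert.IH insert.prems by (auto simp: split_beta)
  define ev where "ev g = fst g \<bullet> w + snd g" for g :: "(real ^ 'n) \<times> real"
  \<comment> \<open>The positive combination of an upper bound \<open>g\<close> and a lower bound
    \<open>h\<close> on the weight of \<open>w\<close> in which this weight cancels.\<close>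
  define comb where "comb = (\<lambda>(g, h). (ev g *\<^sub>R fst h - ev h *\<^sub>R fst g, ev g * snd h - ev h * snd g))"
  define N where "N = {g\<in>G. ev g \<ge> 0} \<union> comb ` ({g\<in>G. ev g > 0} \<times> {g\<in>G. ev g < 0})"
  have w: "w \<in> rat_vecs" using insert.prems by simp
  have evQ: "ev g \<in> \<rat>" if "g \<in> G" for g
    using G(2) that w unfolding ev_def by (intro Rats_add rat_vecs_inner) auto
  have "finite N" using G(1) by (simp add: N_def)
  moreover have "N \<subseteq> rat_vecs \<times> \<rat>"
    using G(2) evQ by (auto simp: N_def comb_def intro!: rat_vecs_arith Rats_diff Rats_mult)
  moreover have "(\<exists>u. (\<forall>v\<in>insert w V. 0 \<le> u v) \<and> (\<Sum>v\<in>insert w V. u v *\<^sub>R v) = x \<and> sum u (insert w V) = t)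
      \<longleftrightarrow> (\<forall>g\<in>N. fst g \<bullet> x + snd g * t \<ge> 0)" (is "?L \<longleftrightarrow> ?R") for x t
  proof -
    define f where "f g = fst g \<bullet> x + snd g * t" for g
    have "?L \<longleftrightarrow> (\<exists>r\<ge>0. \<exists>u. (\<forall>v\<in>V. 0 \<le> u v) \<and> (\<Sum>v\<in>V. u v *\<^sub>R v) = x - r *\<^sub>R w \<and> sum u V = t - r)"
    proof
      assume ?L
      then obtain u where "\<forall>v\<in>insert w V. 0 \<le> u v" "(\<Sum>v\<in>insert w V. u v *\<^sub>R v) = x" "sum u (insert w V) = t" by blast
      then show "\<exists>r\<ge>0. \<exists>u. (\<forall>v\<in>V. 0 \<le> u v) \<and> (\<Sum>v\<in>V. u v *\<^sub>R v) = x - r *\<^sub>R w \<and> sum u V = t - r"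
        using insert.hyps by (intro exI[of _ "u w"] conjI exI[of _ u]) auto
    next
      assume "\<exists>r\<ge>0. \<exists>u. (\<forall>v\<in>V. 0 \<le> u v) \<and> (\<Sum>v\<in>V. u v *\<^sub>R v) = x - r *\<^sub>R w \<and> sum u V = t - r"
      then obtain r u where r: "r \<ge> 0" "\<forall>v\<in>V. 0 \<le> u v" "(\<Sum>v\<in>V. u v *\<^sub>R v) = x - r *\<^sub>R w" "sum u V = t - r" by blast
      have 1: "sum (u(w := r)) V = sum u V" "(\<Sum>v\<in>V. (u(w := r)) v *\<^sub>R v) = (\<Sum>v\<in>V. u v *\<^sub>R v)"
        using insert.hyps by (auto intro!: sum.cong)
      show ?L
      proof (intro exI[of _ "u(w := r)"] conjI)
        show "\<forall>v\<in>insert w V. 0 \<le> (u(w := r)) v" using r by simp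
        show "(\<Sum>v\<in>insert w V. (u(w := r)) v *\<^sub>R v) = x" "sum (u(w := r)) (insert w V) = t"
          unfolding sum.insert[OF insert.hyps(1,2)] 1 using r by simp_all
      qed
    qed
    also have "\<dots> \<longleftrightarrow> (\<exists>r\<ge>0. \<forall>g\<in>G. f g \<ge> r * ev g)"
      unfolding iff f_def ev_def by (simp add: inner_diff_right algebra_simps)
    also have "\<dots> \<longleftrightarrow> (\<forall>g\<in>G. ev g \<ge> 0 \<longrightarrow> f g \<ge> 0) \<and> (\<forall>g\<in>G. \<forall>h\<in>G. ev g > 0 \<longrightarrow> ev h < 0 \<longrightarrow> ev g * f h - ev h * f g \<ge> 0)"
      (is "?A \<longleftrightarrow> ?B")
    proof
      assume ?A
      then obtain r where r: "r \<ge> 0" "\<And>g. g \<in> G \<Longrightarrow> f g \<ge> r * ev g" by blast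
      have "f g \<ge> 0" if "g \<in> G" "ev g \<ge> 0" for g using r(2)[OF that(1)] r(1) that(2) by (meson mult_nonneg_nonneg order_trans)
      moreover have "ev g * f h - ev h * f g \<ge> 0" if "g \<in> G" "h \<in> G" "ev g > 0" "ev h < 0" for g h
      proof -
        have "ev g * f h \<ge> ev g * (r * ev h)" "- ev h * f g \<ge> - ev h * (r * ev g)"
          using r(2) that by (auto intro!: mult_left_mono)
        then show ?thesis by (simp add: algebra_simps)
      qed
      ultimately show ?B by blast
    next
      assume B: ?B
      \<comment> \<open>Inequalities with negative \<open>ev\<close> bound \<open>r\<close> from
        below. The largest of these bounds and 0 is taken for \<open>r\<close>; the combined
        inequalities keep it under the upper bounds.\<close>
      define S where "S = insert 0 ((\<lambda>h. f h / ev h) ` {h\<in>G. ev h < 0})"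
      define r where "r = Max S"
      have S: "finite S" using G(1) by (simp add: S_def)
      have r0: "r \<ge> 0" unfolding r_def using S by (intro Max_ge) (auto simp: S_def)
      have "f g \<ge> r * ev g" if g: "g \<in> G" for g
      proof -
        consider "ev g < 0" | "ev g = 0" | "ev g > 0" by linarith
        then show ?thesis
        proof cases
          case 1
          then have "f g / ev g \<le> r" unfolding r_def using S g by (intro Max_ge) (auto simp: S_def)
          then show ?thesis using 1 by (simp add: divide_le_eq mult.commute)
        next
          case 2
          then show ?thesis using B g by simp
        next
          case 3
          have "r \<in> S" unfolding r_def using S by (intro Max_in) (auto simp: S_def)
          then consider "r = 0" | h where "h \<in> G" "ev h < 0" "r = f h / ev h" by (auto simp: S_def)
          then show ?thesis
          proof cases
            case 1
            then show ?thesis using B g 3 by simp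
          next
            case h: 2
            have "ev g * f h - ev h * f g \<ge> 0" using B g 3 h by blast
            then have "f h * ev g \<ge> f g * ev h" by (simp add: mult.commute)
            then have "f h * ev g / ev h \<le> f g" using h(2) by (simp add: neg_divide_le_eq)
            then show ?thesis using h by simp
          qed
        qed
      qed
      then show ?A using r0 by blast
    qed
    also have "\<dots> \<longleftrightarrow> ?R"
    proof -
      have "ev g * f h - ev h * f g = fst (comb (g, h)) \<bullet> x + snd (comb (g, h)) * t" for g h
        by (simp add: f_def comb_def inner_diff_left algebra_simps)
      then show ?thesis unfolding N_def ball_Un by (auto simp: f_def simp del: comb_def)
    qed
    finally show ?thesis .
  qed
  ultimately show ?case by (intro exI[of _ N]) (simp add: split_beta)
qed

text \<open>The hull is the slice t = 1 of the cone over the polytope. Intersections of rational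
  polytopes and the cutting argument rely on this description with rational data.\<close>

lemma rat_polytope_halfspaces:
  assumes "P \<in> rat_polytopes"
  obtains G where "finite G" "G \<subseteq> rat_vecs \<times> \<rat>" "P = {x. \<forall>(c, e)\<in>G. c \<bullet> x \<ge> e}"
proof -
  obtain V where V: "finite V" "V \<subseteq> rat_vecs" "P = convex hull V" using assms by (auto simp: rat_polytopes_def)
  obtain G where G: "finite G" "G \<subseteq> rat_vecs \<times> \<rat>" and
    iff: "\<And>x t. (\<exists>u. (\<forall>v\<in>V. 0 \<le> u v) \<and> (\<Sum>v\<in>V. u v *\<^sub>R v) = x \<and> sum u V = t) \<longleftrightarrow> (\<forall>(c, e)\<in>G. c \<bullet> x + e * t \<ge> 0)"
    using cone_halfspaces[OF V(1,2)] by blast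
  have "x \<in> P \<longleftrightarrow> (\<exists>u. (\<forall>v\<in>V. 0 \<le> u v) \<and> (\<Sum>v\<in>V. u v *\<^sub>R v) = x \<and> sum u V = 1)" for x
    unfolding V(3) convex_hull_finite[OF V(1)] by blast
  then have "x \<in> P \<longleftrightarrow> (\<forall>(c, e)\<in>G. c \<bullet> x + e * 1 \<ge> 0)" for x unfolding iff .
  moreover have eq: "0 \<le> s + e \<longleftrightarrow> - e \<le> s" for s e :: real by linarith
  ultimately have "P = {x. \<forall>(c, e)\<in>(\<lambda>(c, e). (c, - e)) ` G. c \<bullet> x \<ge> e}" by (simp add: set_eq_iff split_beta eq)
  then show ?thesis using G by (intro that[of "(\<lambda>(c, e). (c, - e)) ` G"]) auto
qed

lemma rat_polytope_Int:
  assumes "P \<in> rat_polytopes" "Q \<in> rat_polytopes"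
  shows "P \<inter> Q \<in> rat_polytopes"
proof -
  obtain G where "finite G" "G \<subseteq> rat_vecs \<times> \<rat>" "Q = {x. \<forall>(c, e)\<in>G. c \<bullet> x \<ge> e}"
    using rat_polytope_halfspaces[OF assms(2)] by blast
  then show ?thesis using rat_polytope_cuts[OF _ _ assms(1)] by simp
qed

text \<open>The number of vertices is tied to \<open>card I\<close> so that, for polytopes in a
  coordinate subspace, the simplex respects the bound in \<open>vanishes\<close>.\<close>

lemma big_simplex:
  fixes P :: "(real ^ 'n) set" and I :: "'n set"
  assumes "bounded P" "P \<subseteq> {x. \<forall>i. i \<notin> I \<longrightarrow> x $ i = 0}"
  shows "\<exists>W. W \<subseteq> rat_vecs \<and> \<not> affine_dependent W \<and> card W \<le> card I + 1 \<and> P \<subseteq> convex hull W"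
proof -
  obtain B where B: "\<And>x. x \<in> P \<Longrightarrow> norm x \<le> B" using assms(1) by (auto simp: bounded_iff)
  define M where "M = real (nat \<lceil>B\<rceil>)"
  have M: "M \<ge> 0" "\<bar>x $ i\<bar> \<le> M" if "x \<in> P" for x i
    using B[OF that] component_le_norm_cart[of x i] by (auto simp: M_def) linarith
  have M0: "M \<ge> 0" by (simp add: M_def)
  \<comment> \<open>Coordinates relative to the corner \<open>w\<close> lie between 0 and 2M, so
    their sum is at most \<open>L\<close>; the extra 1 keeps \<open>L\<close> positive.\<close>
  define L where "L = 2 * M * card I + 1"
  have L: "L > 0" using M0 by (simp add: L_def add_nonneg_pos)
  define w where "w = (\<Sum>i\<in>I. axis i (- M) :: real ^ 'n)"
  define W where "W = insert w ((\<lambda>i. w + axis i L) ` I)"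
  have "W \<subseteq> rat_vecs"
    unfolding W_def w_def by (auto intro!: rat_vecs_arith rat_vecs_sum simp: M_def L_def)
  moreover have "\<not> affine_dependent W"
  proof -
    have nz: "axis i L \<noteq> 0" for i :: 'n using L by (simp add: axis_eq_0_iff)
    have "affine_dependent W = dependent ((+) (- w) ` (W - {w}))"
      by (rule affine_dependent_iff_dependent2) (simp add: W_def)
    also have "(+) (- w) ` (W - {w}) = (\<lambda>i. axis i L) ` I"
      using nz by (auto simp: W_def image_iff)
    also have "independent \<dots>"
      by (rule pairwise_orthogonal_independent)
         (use nz in \<open>auto simp: pairwise_def orthogonal_def inner_axis_axis axis_eq_axis\<close>)
    finally show ?thesis by blast
  qed
  moreover have "card W \<le> card I + 1"
    unfolding W_def by (rule order_trans[OF card_insert_le_m1]) (auto intro: card_image_le)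
  moreover have "P \<subseteq> convex hull W"
  proof
    fix x assume x: "x \<in> P"
    define c where "c i = (x $ i + M) / L" for i
    have c0: "c i \<ge> 0" for i using M(2)[OF x, of i] L by (simp add: c_def abs_le_iff)
    have "sum c I \<le> (\<Sum>i\<in>I. 2 * M / L)"
      using M(2)[OF x] L by (intro sum_mono) (auto simp: c_def abs_le_iff divide_right_mono)
    also have "\<dots> \<le> 1" using L by (simp add: L_def field_simps)
    finally have c1: "sum c I \<le> 1" .
    have "x = (1 - sum c I) *\<^sub>R w + (\<Sum>i\<in>I. c i *\<^sub>R (w + axis i L))"
    proof -
      have "(\<Sum>i\<in>I. c i *\<^sub>R (w + axis i L)) = sum c I *\<^sub>R w + (\<Sum>i\<in>I. c i *\<^sub>R axis i L)"
        by (simp add: scaleR_add_right sum.distrib scaleR_sum_left)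
      moreover have "x = w + (\<Sum>i\<in>I. c i *\<^sub>R axis i L)"
      proof -
        have "(w + (\<Sum>i\<in>I. c i *\<^sub>R axis i L)) $ j = x $ j" for j
          using L x assms(2)
          by (cases "j \<in> I") (auto simp: w_def axis_def c_def sum.delta if_distrib cong: if_cong)
        then show ?thesis by (simp add: vec_eq_iff)
      qed
      ultimately show ?thesis by (simp add: algebra_simps)
    qed
    moreover have "(1 - sum c I) *\<^sub>R w + (\<Sum>i\<in>I. c i *\<^sub>R (w + axis i L)) \<in> convex hull W"
    proof -
      define d where "d j = (case j of None \<Rightarrow> 1 - sum c I | Some i \<Rightarrow> c i)" for j
      define y where "y j = (case j of None \<Rightarrow> w | Some i \<Rightarrow> w + axis i L)" for j
      have "(\<Sum>j\<in>insert None (Some ` I). d j *\<^sub>R y j) \<in> convex hull W"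
      proof (rule convex_sum)
        show "sum d (insert None (Some ` I)) = 1" by (simp add: d_def sum.reindex)
        show "d j \<ge> 0" if "j \<in> insert None (Some ` I)" for j using that c0 c1 by (auto simp: d_def)
        show "y j \<in> convex hull W" if "j \<in> insert None (Some ` I)" for j
          using that by (auto simp: y_def W_def intro: hull_inc)
      qed auto
      then show ?thesis by (simp add: d_def y_def sum.reindex)
    qed
    ultimately show "x \<in> convex hull W" by simp
  qed
  ultimately show ?thesis by blast
qed

lemma rat_polytope_bounded_polyhedron:
  fixes G :: "((real ^ 'n) \<times> real) set"
  assumes "finite G" "G \<subseteq> rat_vecs \<times> \<rat>" "bounded {x. \<forall>(c, e)\<in>G. c \<bullet> x \<ge> e}"
  shows "{x. \<forall>(c, e)\<in>G. c \<bullet> x \<ge> e} \<in> rat_polytopes"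
proof -
  obtain W where W: "W \<subseteq> rat_vecs" "\<not> affine_dependent W" "{x. \<forall>(c, e)\<in>G. c \<bullet> x \<ge> e} \<subseteq> convex hull W"
    using big_simplex[OF assms(3), of UNIV] by auto
  have "convex hull W \<in> rat_polytopes" by (rule rat_polytopeI[OF aff_independent_finite[OF W(2)] W(1)])
  then have "convex hull W \<inter> {x. \<forall>(c, e)\<in>G. c \<bullet> x \<ge> e} \<in> rat_polytopes" by (rule rat_polytope_cuts[OF assms(1,2)])
  then show ?thesis using W(3) by (simp add: Int_absorb1)
qed

section \<open>Homogeneous valuations on rational polytopes\<close>

definition hom_valuation :: "nat \<Rightarrow> ((real ^ 'n) set \<Rightarrow> real) \<Rightarrow> bool" where
  "hom_valuation d \<phi> \<longleftrightarrow> \<phi> {} = 0 \<and>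
    (\<forall>P Q. P \<in> rat_polytopes \<longrightarrow> Q \<in> rat_polytopes \<longrightarrow> P \<union> Q \<in> rat_polytopes \<longrightarrow>
       \<phi> P + \<phi> Q = \<phi> (P \<union> Q) + \<phi> (P \<inter> Q)) \<and>
    (\<forall>P y. P \<in> rat_polytopes \<longrightarrow> y \<in> rat_vecs \<longrightarrow> \<phi> ((\<lambda>x. x + y) ` P) = \<phi> P) \<and>
    (\<forall>P k. P \<in> rat_polytopes \<longrightarrow> k > 0 \<longrightarrow> \<phi> ((\<lambda>x. real k *\<^sub>R x) ` P) = real k ^ d * \<phi> P)"

lemma hom_valuation_empty: "hom_valuation d \<phi> \<Longrightarrow> \<phi> {} = 0"
  and hom_valuation_valuation: "hom_valuation d \<phi> \<Longrightarrow> P \<in> rat_polytopes \<Longrightarrow> Q \<in> rat_polytopes \<Longrightarrow> P \<union> Q \<in> rat_polytopes \<Longrightarrow>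
       \<phi> P + \<phi> Q = \<phi> (P \<union> Q) + \<phi> (P \<inter> Q)"
  and hom_valuation_translate: "hom_valuation d \<phi> \<Longrightarrow> P \<in> rat_polytopes \<Longrightarrow> y \<in> rat_vecs \<Longrightarrow> \<phi> ((\<lambda>x. x + y) ` P) = \<phi> P"
  and hom_valuation_scale: "hom_valuation d \<phi> \<Longrightarrow> P \<in> rat_polytopes \<Longrightarrow> k > 0 \<Longrightarrow> \<phi> ((\<lambda>x. real k *\<^sub>R x) ` P) = real k ^ d * \<phi> P"
  by (simp_all add: hom_valuation_def)

lemma rat_polytope_translate:
  assumes "P \<in> rat_polytopes" "y \<in> rat_vecs"
  shows "(\<lambda>x. x + y) ` P \<in> rat_polytopes"
proof -
  obtain V where V: "finite V" "V \<subseteq> rat_vecs" "P = convex hull V" using assms(1) by (auto simp: rat_polytopes_def)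
  have "(\<lambda>x. x + y) ` P = convex hull ((\<lambda>x. x + y) ` V)"
    using convex_hull_translation[of y V] V(3) by (simp add: add.commute)
  then show ?thesis using V assms(2) by (auto intro!: rat_polytopeI rat_vecs_arith)
qed

lemma rat_polytope_linear_image:
  assumes "P \<in> rat_polytopes" "linear A" "A ` rat_vecs \<subseteq> rat_vecs"
  shows "A ` P \<in> rat_polytopes"
proof -
  obtain V where V: "finite V" "V \<subseteq> rat_vecs" "P = convex hull V" using assms(1) by (auto simp: rat_polytopes_def)
  have "A ` P = convex hull (A ` V)" unfolding V(3) by (rule convex_hull_linear_image[OF assms(2)])
  moreover have "A ` V \<subseteq> rat_vecs" using V(2) assms(3) by blast
  ultimately show ?thesis using V(1) by (simp add: rat_polytopeI)
qed

lemma rat_polytope_scale: "P \<in> rat_polytopes \<Longrightarrow> (\<lambda>x. real k *\<^sub>R x) ` P \<in> rat_polytopes"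
  by (rule rat_polytope_linear_image) (auto intro: rat_vecs_arith linearI simp: scaleR_add_right)

lemma hom_valuation_linear_image:
  fixes A :: "real ^ 'n \<Rightarrow> real ^ 'n"
  assumes "hom_valuation d \<phi>" "linear A" "inj A" "A ` rat_vecs \<subseteq> rat_vecs"
  shows "hom_valuation d (\<lambda>P. \<phi> (A ` P))"
  unfolding hom_valuation_def
proof (intro conjI allI impI)
  note im = rat_polytope_linear_image[OF _ assms(2,4)]
  show "\<phi> (A ` {}) = 0" using hom_valuation_empty[OF assms(1)] by simp
  fix P Q :: "(real ^ 'n) set"
  assume PQ: "P \<in> rat_polytopes" "Q \<in> rat_polytopes" "P \<union> Q \<in> rat_polytopes"
  show "\<phi> (A ` P) + \<phi> (A ` Q) = \<phi> (A ` (P \<union> Q)) + \<phi> (A ` (P \<inter> Q))"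
    using hom_valuation_valuation[OF assms(1) im[OF PQ(1)] im[OF PQ(2)]] im[OF PQ(3)]
    by (simp add: image_Un image_Int[OF assms(3)])
next
  fix P :: "(real ^ 'n) set" and y :: "real ^ 'n" assume P: "P \<in> rat_polytopes" "y \<in> rat_vecs"
  have "A ` (\<lambda>x. x + y) ` P = (\<lambda>x. x + A y) ` A ` P" by (auto simp: image_image linear_add[OF assms(2)])
  then show "\<phi> (A ` (\<lambda>x. x + y) ` P) = \<phi> (A ` P)"
    using hom_valuation_translate[OF assms(1) rat_polytope_linear_image[OF P(1) assms(2,4)], of "A y"] P(2) assms(4) by auto
next
  fix P :: "(real ^ 'n) set" and k :: nat assume P: "P \<in> rat_polytopes" "k > 0"
  have "A ` (\<lambda>x. real k *\<^sub>R x) ` P = (\<lambda>x. real k *\<^sub>R x) ` A ` P" by (auto simp: image_image linear_scale[OF assms(2)])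
  then show "\<phi> (A ` (\<lambda>x. real k *\<^sub>R x) ` P) = real k ^ d * \<phi> (A ` P)"
    using hom_valuation_scale[OF assms(1) rat_polytope_linear_image[OF P(1) assms(2,4)] P(2)] by simp
qed

lemma common_denominator:
  assumes "finite S" "S \<subseteq> \<rat>"
  shows "\<exists>m::nat. m > 0 \<and> (\<forall>x\<in>S. real m * x \<in> \<int>)"
  using assms
proof (induction S rule: finite_induct)
  case empty
  show ?case by (intro exI[of _ 1]) simp
next
  case (insert x S)
  obtain m :: nat where m: "m > 0" "\<forall>x\<in>S. real m * x \<in> \<int>" using insert by auto
  obtain a b :: int where "b > 0" "x = of_int a / of_int b"
    using insert.prems by (auto elim: Rats_cases')
  then have ab: "b > 0" "real (nat b) * x = of_int a" by auto
  have "real (m * nat b) * y \<in> \<int>" if "y \<in> insert x S" for y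
  proof (cases "y = x")
    case True
    have "real (m * nat b) * y = real m * of_int a" using ab True by (simp add: mult.assoc)
    then show ?thesis by (simp only: Ints_mult Ints_of_nat Ints_of_int)
  next
    case False
    have "real (m * nat b) * y = real (nat b) * (real m * y)" by simp
    then show ?thesis using m(2) that False by (metis Ints_mult Ints_of_nat insertE)
  qed
  then show ?case using m(1) ab(1) by (intro exI[of _ "m * nat b"]) auto
qed

lemma rat_vecs_common_denominator:
  fixes V :: "(real ^ 'n) set"
  assumes "finite V" "V \<subseteq> rat_vecs"
  shows "\<exists>m::nat. m > 0 \<and> (\<forall>x\<in>V. real m *\<^sub>R x \<in> int_lattice)"
proof -
  have "finite ((\<lambda>(x, i). x $ i) ` (V \<times> UNIV))" "(\<lambda>(x, i). x $ i) ` (V \<times> UNIV) \<subseteq> \<rat>"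
    using assms by (auto simp: rat_vecs_def)
  from common_denominator[OF this] show ?thesis by (force simp: int_lattice_def)
qed

lemma rat_polytope_denominator:
  fixes P :: "(real ^ 'n) set"
  assumes "P \<in> rat_polytopes"
  shows "\<exists>m::nat. m > 0 \<and> (\<lambda>x. real m *\<^sub>R x) ` P \<in> lattice_polytopes"
proof -
  obtain V where V: "finite V" "V \<subseteq> rat_vecs" "P = convex hull V" using assms by (auto simp: rat_polytopes_def)
  obtain m :: nat where m: "m > 0" "\<forall>x\<in>V. real m *\<^sub>R x \<in> int_lattice"
    using rat_vecs_common_denominator[OF V(1,2)] by blast
  have "(\<lambda>x. real m *\<^sub>R x) ` P = convex hull ((\<lambda>x. real m *\<^sub>R x) ` V)"
    unfolding V(3) by (rule convex_hull_scaling[symmetric])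
  moreover have "finite ((\<lambda>x. real m *\<^sub>R x) ` V)" "(\<lambda>x. real m *\<^sub>R x) ` V \<subseteq> int_lattice" using V(1) m(2) by auto
  ultimately show ?thesis using m(1) unfolding lattice_polytopes_iff by blast
qed

lemma scale_scale_image: "(\<lambda>x. real a *\<^sub>R x) ` (\<lambda>x. real b *\<^sub>R x) ` P = (\<lambda>x. real (a * b) *\<^sub>R (x :: 'a::real_vector)) ` P"
  by (simp add: image_image)

text \<open>The extension is \<phi>(mP) / m^d for any \<open>m\<close> clearing the denominators of
  P; homogeneity makes it independent of \<open>m\<close>.\<close>

lemma extend_to_rational:
  fixes \<phi> :: "(real ^ 'n) set \<Rightarrow> real"
  assumes empty: "\<phi> {} = 0"
    and val: "\<And>P Q. P \<in> lattice_polytopes \<Longrightarrow> Q \<in> lattice_polytopes \<Longrightarrow> P \<union> Q \<in> lattice_polytopes \<Longrightarrow>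
       P \<inter> Q \<in> lattice_polytopes \<Longrightarrow> \<phi> P + \<phi> Q = \<phi> (P \<union> Q) + \<phi> (P \<inter> Q)"
    and trans: "\<And>P y. P \<in> lattice_polytopes \<Longrightarrow> y \<in> int_lattice \<Longrightarrow> \<phi> ((\<lambda>x. x + y) ` P) = \<phi> P"
    and hom: "\<And>P k. P \<in> lattice_polytopes \<Longrightarrow> k > 0 \<Longrightarrow> \<phi> ((\<lambda>x. real k *\<^sub>R x) ` P) = real k ^ d * \<phi> P"
  shows "\<exists>\<psi>. hom_valuation d \<psi> \<and> (\<forall>P\<in>lattice_polytopes. \<psi> P = \<phi> P)"
proof -
  define den where "den P = (SOME m::nat. m > 0 \<and> (\<lambda>x. real m *\<^sub>R x) ` P \<in> lattice_polytopes)" for P :: "(real ^ 'n) set"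
  define \<psi> where "\<psi> P = \<phi> ((\<lambda>x. real (den P) *\<^sub>R x) ` P) / real (den P) ^ d" for P
  have den: "den P > 0" "(\<lambda>x. real (den P) *\<^sub>R x) ` P \<in> lattice_polytopes" if "P \<in> rat_polytopes" for P
    using someI_ex[OF rat_polytope_denominator[OF that]] unfolding den_def by simp_all
  have \<psi>: "real m ^ d * \<psi> P = \<phi> ((\<lambda>x. real m *\<^sub>R x) ` P)"
    if P: "P \<in> rat_polytopes" and m: "m > 0" "(\<lambda>x. real m *\<^sub>R x) ` P \<in> lattice_polytopes" for P m
  proof -
    \<comment> \<open>Both sides are the value of \<open>\<phi>\<close> on the dilate of P by the
      product of \<open>m\<close> and \<open>den P\<close>, reached in two orders.\<close>
    have "real (den P) ^ d * \<phi> ((\<lambda>x. real m *\<^sub>R x) ` P) = real m ^ d * \<phi> ((\<lambda>x. real (den P) *\<^sub>R x) ` P)"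
      using hom[OF m(2) den(1)[OF P]] hom[OF den(2)[OF P] m(1)] scale_scale_image[of m "den P" P] scale_scale_image[of "den P" m P]
      by (simp add: mult.commute)
    then show ?thesis using den(1)[OF P] by (simp add: \<psi>_def field_simps)
  qed
  have mult: "(\<lambda>x. real (a * b) *\<^sub>R x) ` P \<in> lattice_polytopes" if "(\<lambda>x. real b *\<^sub>R x) ` P \<in> lattice_polytopes" for P :: "(real ^ 'n) set" and a b
    unfolding scale_scale_image[symmetric] by (rule lattice_polytope_scale[OF that])
  \<comment> \<open>Several polytopes need a single denominator before the valuation identity for
    lattice polytopes can be applied to their dilates.\<close>
  have common: "\<exists>m. m > 0 \<and> (\<forall>P\<in>F. (\<lambda>x. real m *\<^sub>R x) ` P \<in> lattice_polytopes)"
    if "finite F" "F \<subseteq> rat_polytopes" for F :: "(real ^ 'n) set set"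
    using that
  proof (induction F rule: finite_induct)
    case empty
    show ?case by (intro exI[of _ 1]) simp
  next
    case (insert P F)
    then obtain m where m: "m > 0" "\<forall>P\<in>F. (\<lambda>x. real m *\<^sub>R x) ` P \<in> lattice_polytopes" by auto
    have P: "P \<in> rat_polytopes" using insert.prems by simp
    show ?case
    proof (intro exI[of _ "m * den P"] conjI ballI)
      show "m * den P > 0" using m(1) den(1)[OF P] by simp
      fix Q assume Q: "Q \<in> insert P F"
      show "(\<lambda>x. real (m * den P) *\<^sub>R x) ` Q \<in> lattice_polytopes"
      proof (cases "Q = P")
        case True
        then show ?thesis using mult[OF den(2)[OF P], of m] by simp
      next
        case False
        then have "(\<lambda>x. real m *\<^sub>R x) ` Q \<in> lattice_polytopes" using m(2) Q by simp
        from mult[OF this, of "den P"] show ?thesis by (simp only: mult.commute[of m])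
      qed
    qed
  qed
  have "hom_valuation d \<psi>"
    unfolding hom_valuation_def
  proof (intro conjI allI impI)
    show "\<psi> {} = 0" using empty by (simp add: \<psi>_def)
  next
    fix P Q :: "(real ^ 'n) set"
    assume PQ: "P \<in> rat_polytopes" "Q \<in> rat_polytopes" "P \<union> Q \<in> rat_polytopes"
    have PQ4: "P \<inter> Q \<in> rat_polytopes" by (rule rat_polytope_Int[OF PQ(1,2)])
    obtain m where m: "m > 0" "\<forall>R\<in>{P, Q, P \<union> Q, P \<inter> Q}. (\<lambda>x. real m *\<^sub>R x) ` R \<in> lattice_polytopes"
      using common[of "{P, Q, P \<union> Q, P \<inter> Q}"] PQ PQ4 by auto
    have "inj (\<lambda>x::real^'n. real m *\<^sub>R x)" using m(1) by (auto intro: injI)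
    note I = image_Int[OF this]
    have "real m ^ d * (\<psi> P + \<psi> Q) = real m ^ d * (\<psi> (P \<union> Q) + \<psi> (P \<inter> Q))"
      using val[of "(\<lambda>x. real m *\<^sub>R x) ` P" "(\<lambda>x. real m *\<^sub>R x) ` Q"] m
        \<psi>[OF PQ(1) m(1)] \<psi>[OF PQ(2) m(1)] \<psi>[OF PQ(3) m(1)] \<psi>[OF PQ4 m(1)]
      by (simp add: distrib_left image_Un I)
    then show "\<psi> P + \<psi> Q = \<psi> (P \<union> Q) + \<psi> (P \<inter> Q)" using m(1) by simp
  next
    fix P :: "(real ^ 'n) set" and y :: "real ^ 'n" assume P: "P \<in> rat_polytopes" and y: "y \<in> rat_vecs"
    have Py: "(\<lambda>x. x + y) ` P \<in> rat_polytopes" by (rule rat_polytope_translate[OF P y])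
    obtain q :: nat where q: "q > 0" "real q *\<^sub>R y \<in> int_lattice"
      using rat_vecs_common_denominator[of "{y}"] y by auto
    define m where "m = q * den P"
    have m: "m > 0" using q(1) den(1)[OF P] by (simp add: m_def)
    have mP: "(\<lambda>x. real m *\<^sub>R x) ` P \<in> lattice_polytopes" unfolding m_def by (rule mult[OF den(2)[OF P]])
    have "real m *\<^sub>R y = real (den P) *\<^sub>R (real q *\<^sub>R y)" by (simp add: m_def)
    then have my: "real m *\<^sub>R y \<in> int_lattice"
      using int_lattice_arith(4)[OF q(2) Ints_of_nat, of "den P"] by (simp only:)
    have eq: "(\<lambda>x. real m *\<^sub>R x) ` (\<lambda>x. x + y) ` P = (\<lambda>x. x + real m *\<^sub>R y) ` (\<lambda>x. real m *\<^sub>R x) ` P"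
      by (simp add: image_image scaleR_add_right)
    have "(\<lambda>x. real m *\<^sub>R x) ` (\<lambda>x. x + y) ` P \<in> lattice_polytopes"
      unfolding eq by (rule lattice_polytope_translate[OF mP my])
    from \<psi>[OF Py m this] have "real m ^ d * \<psi> ((\<lambda>x. x + y) ` P) = real m ^ d * \<psi> P"
      unfolding eq trans[OF mP my] using \<psi>[OF P m mP] by simp
    then show "\<psi> ((\<lambda>x. x + y) ` P) = \<psi> P" using m by simp
  next
    fix P :: "(real ^ 'n) set" and k :: nat assume P: "P \<in> rat_polytopes" and k: "k > 0"
    let ?m = "den P"
    have eq: "(\<lambda>x. real ?m *\<^sub>R x) ` (\<lambda>x. real k *\<^sub>R x) ` P = (\<lambda>x. real k *\<^sub>R x) ` (\<lambda>x. real ?m *\<^sub>R x) ` P"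
      by (simp only: scale_scale_image mult.commute)
    have "(\<lambda>x. real ?m *\<^sub>R x) ` (\<lambda>x. real k *\<^sub>R x) ` P \<in> lattice_polytopes"
      unfolding eq by (rule lattice_polytope_scale[OF den(2)[OF P]])
    from \<psi>[OF rat_polytope_scale[OF P] den(1)[OF P] this]
    have "real ?m ^ d * \<psi> ((\<lambda>x. real k *\<^sub>R x) ` P) = real k ^ d * \<phi> ((\<lambda>x. real ?m *\<^sub>R x) ` P)"
      unfolding eq using hom[OF den(2)[OF P] k] by simp
    also have "\<dots> = real ?m ^ d * (real k ^ d * \<psi> P)" using \<psi>[OF P den[OF P]] by simp
    finally show "\<psi> ((\<lambda>x. real k *\<^sub>R x) ` P) = real k ^ d * \<psi> P" using den(1)[OF P] by simp
  qed
  moreover have "\<psi> P = \<phi> P" if "P \<in> lattice_polytopes" for P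
    using \<psi>[OF lattice_rat_polytope[OF that], of 1] that by simp
  ultimately show ?thesis by blast
qed

section \<open>Valuations vanishing on simplices\<close>

text \<open>Only additivity is kept: it survives replacing \<phi> by P -> \<phi>(P \<inter> H) for a
  half-space H, whereas translation invariance and homogeneity do not.\<close>

definition rat_valuation :: "((real ^ 'n) set \<Rightarrow> real) \<Rightarrow> bool" where
  "rat_valuation \<phi> \<longleftrightarrow> \<phi> {} = 0 \<and>
    (\<forall>P Q. P \<in> rat_polytopes \<longrightarrow> Q \<in> rat_polytopes \<longrightarrow> P \<union> Q \<in> rat_polytopes \<longrightarrow>
       \<phi> P + \<phi> Q = \<phi> (P \<union> Q) + \<phi> (P \<inter> Q))"

text \<open>\<open>m\<close> counts vertices, so the simplices have dimension below
  \<open>m\<close>.\<close>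

definition vanishes :: "nat \<Rightarrow> ((real ^ 'n) set \<Rightarrow> real) \<Rightarrow> bool" where
  "vanishes m \<phi> \<longleftrightarrow> (\<forall>W. W \<subseteq> rat_vecs \<longrightarrow> \<not> affine_dependent W \<longrightarrow> card W \<le> m \<longrightarrow> \<phi> (convex hull W) = 0)"

lemma hom_valuation_rat_valuation: "hom_valuation d \<phi> \<Longrightarrow> rat_valuation \<phi>"
  by (simp add: hom_valuation_def rat_valuation_def)

text \<open>The two halves of a bisected simplex are simplices and meet in the simplex spanned by
  \<open>q\<close> and the vertices off the edge, so an induction over simplices covers all three
  pieces of the valuation identity.\<close>

lemma simplex_edge_split:
  fixes V :: "('a::euclidean_space) set"
  assumes V: "\<not> affine_dependent V" "a \<in> V" "b \<in> V" "a \<noteq> b" and s: "0 < s" "s < 1"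
    and q: "q = (1 - s) *\<^sub>R a + s *\<^sub>R b"
  shows "\<not> affine_dependent (insert q (V - {b}))"
    and "convex hull (insert q (V - {b})) \<inter> convex hull (insert q (V - {a})) = convex hull (insert q (V - {a, b}))"
proof -
  have fin: "finite V" using V(1) by (rule aff_independent_finite)
  show "\<not> affine_dependent (insert q (V - {b}))"
  proof (rule affine_independent_insert)
    show "\<not> affine_dependent (V - {b})" using V(1) by (rule affine_independent_Diff)
    show "q \<notin> affine hull (V - {b})"
    proof
      assume *: "q \<in> affine hull (V - {b})"
      have "a \<in> affine hull (V - {b})" using V by (simp add: hull_inc)
      then have "(1 / s) *\<^sub>R q + (- (1 - s) / s) *\<^sub>R a \<in> affine hull (V - {b})"
        using * s by (intro mem_affine affine_affine_hull) (auto simp: field_simps)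
      also have "(1 / s) *\<^sub>R q + (- (1 - s) / s) *\<^sub>R a = (1 / s * (1 - s) + - (1 - s) / s) *\<^sub>R a + (1 / s * s) *\<^sub>R b"
        unfolding q by (simp only: scaleR_add_right scaleR_add_left scaleR_scaleR add_ac)
      also have "\<dots> = b" using s by (simp add: field_simps)
      finally show False using V(1,3) by (auto simp: affine_dependent_def)
    qed
  qed
  show "convex hull (insert q (V - {b})) \<inter> convex hull (insert q (V - {a})) = convex hull (insert q (V - {a, b}))"
  proof (intro equalityI subsetI)
    fix x assume x: "x \<in> convex hull (insert q (V - {b})) \<inter> convex hull (insert q (V - {a}))"
    have ne: "V - {b} \<noteq> {}" "V - {a} \<noteq> {}" using V by auto
    obtain \<alpha> \<beta> y where y: "\<alpha> \<ge> 0" "\<beta> \<ge> 0" "\<alpha> + \<beta> = 1" "y \<in> convex hull (V - {b})" "x = \<alpha> *\<^sub>R q + \<beta> *\<^sub>R y"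
      using x convex_hull_insert[OF ne(1), of q] by auto
    obtain \<alpha>' \<beta>' y' where y': "\<alpha>' \<ge> 0" "\<beta>' \<ge> 0" "\<alpha>' + \<beta>' = 1" "y' \<in> convex hull (V - {a})" "x = \<alpha>' *\<^sub>R q + \<beta>' *\<^sub>R y'"
      using x convex_hull_insert[OF ne(2), of q] by auto
    obtain u where u: "\<forall>v\<in>V - {b}. 0 \<le> u v" "sum u (V - {b}) = 1" "(\<Sum>v\<in>V - {b}. u v *\<^sub>R v) = y"
      using y(4) unfolding convex_hull_finite[OF finite_Diff[OF fin]] by auto
    obtain u' where u': "\<forall>v\<in>V - {a}. 0 \<le> u' v" "sum u' (V - {a}) = 1" "(\<Sum>v\<in>V - {a}. u' v *\<^sub>R v) = y'"
      using y'(4) unfolding convex_hull_finite[OF finite_Diff[OF fin]] by auto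
    \<comment> \<open>\<open>e\<close> holds the coordinates of \<open>q\<close>, and
      \<open>c\<close>, \<open>c'\<close> below those of \<open>x\<close> computed from the two
      halves; they agree because \<open>V\<close> is affinely independent. Comparing them at
      \<open>b\<close> gives \<alpha>' \<le> \<alpha>, and then at \<open>a\<close> it leaves no
      weight of \<open>x\<close> on \<open>a\<close> except through \<open>q\<close>.\<close>
    define e where "e v = (if v = a then 1 - s else if v = b then s else 0)" for v
    have e: "sum e V = 1" "(\<Sum>v\<in>V. e v *\<^sub>R v) = q"
      using fin V q by (simp_all add: e_def sum.remove[of V a] sum.remove[of "V - {a}" b] cong: sum.cong)
         (simp_all add: sum.neutral)
    have ext: "sum (\<lambda>v. if v = z then 0 else w v) V = sum w (V - {z})"
      "(\<Sum>v\<in>V. (if v = z then 0 else w v) *\<^sub>R v) = (\<Sum>v\<in>V - {z}. w v *\<^sub>R v)" for z and w :: "'a \<Rightarrow> real"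
      using fin by (auto intro!: sum.mono_neutral_cong_right split: if_splits)
    define c where "c v = \<alpha> * e v + \<beta> * (if v = b then 0 else u v)" for v
    define c' where "c' v = \<alpha>' * e v + \<beta>' * (if v = a then 0 else u' v)" for v
    have "sum c V = \<alpha> * sum e V + \<beta> * sum (\<lambda>v. if v = b then 0 else u v) V"
      unfolding c_def by (simp only: sum.distrib sum_distrib_left)
    then have sc: "sum c V = 1" using e(1) ext(1)[of b u] u(2) y(3) by simp
    have "sum c' V = \<alpha>' * sum e V + \<beta>' * sum (\<lambda>v. if v = a then 0 else u' v) V"
      unfolding c'_def by (simp only: sum.distrib sum_distrib_left)
    then have sc': "sum c' V = 1" using e(1) ext(1)[of a u'] u'(2) y'(3) by simp
    have "(\<Sum>v\<in>V. c v *\<^sub>R v) = \<alpha> *\<^sub>R (\<Sum>v\<in>V. e v *\<^sub>R v) + \<beta> *\<^sub>R (\<Sum>v\<in>V. (if v = b then 0 else u v) *\<^sub>R v)"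
      unfolding c_def by (simp only: scaleR_add_left sum.distrib scaleR_sum_right scaleR_scaleR)
    then have pc: "(\<Sum>v\<in>V. c v *\<^sub>R v) = x" using e(2) ext(2)[of b u] u(3) y(5) by simp
    have "(\<Sum>v\<in>V. c' v *\<^sub>R v) = \<alpha>' *\<^sub>R (\<Sum>v\<in>V. e v *\<^sub>R v) + \<beta>' *\<^sub>R (\<Sum>v\<in>V. (if v = a then 0 else u' v) *\<^sub>R v)"
      unfolding c'_def by (simp only: scaleR_add_left sum.distrib scaleR_sum_right scaleR_scaleR)
    then have pc': "(\<Sum>v\<in>V. c' v *\<^sub>R v) = x" using e(2) ext(2)[of a u'] u'(3) y'(5) by simp
    have cc: "c v = c' v" if "v \<in> V" for v
      by (rule affine_independent_unique[OF V(1) _ _ that]) (simp_all only: sc sc' pc pc')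
    have "\<alpha> * s = \<alpha>' * s + \<beta>' * u' b" using cc[OF V(3)] V(4) by (simp add: c_def c'_def e_def)
    moreover have "\<beta>' * u' b \<ge> 0" using y'(2) u'(1) V by simp
    ultimately have "\<alpha>' * s \<le> \<alpha> * s" by linarith
    then have 1: "\<alpha>' \<le> \<alpha>" using s by simp
    have 2: "\<alpha> * (1 - s) + \<beta> * u a = \<alpha>' * (1 - s)" using cc[OF V(2)] V(4) by (simp add: c_def c'_def e_def)
    have "\<beta> * u a \<ge> 0" using y(2) u(1) V by simp
    moreover have "\<alpha>' * (1 - s) \<le> \<alpha> * (1 - s)" using 1 s by (intro mult_right_mono) auto
    ultimately have z: "\<beta> * u a = 0" using 2 by linarith
    show "x \<in> convex hull (insert q (V - {a, b}))"
    proof (cases "\<beta> = 0")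
      case True
      then show ?thesis using y by (simp add: hull_inc)
    next
      case False
      then have ua: "u a = 0" using z by simp
      have eq: "V - {b} - {a} = V - {a, b}" by auto
      have "sum u (V - {a, b}) = 1" "(\<Sum>v\<in>V - {a, b}. u v *\<^sub>R v) = y"
        using u(2,3) ua fin V(2,4) unfolding eq[symmetric]
        by (simp_all add: sum.remove[of "V - {b}" a])
      then have "y \<in> convex hull (V - {a, b})"
        unfolding convex_hull_finite[OF finite_Diff[OF fin]] using u(1) by auto
      then have "y \<in> convex hull (insert q (V - {a, b}))" using hull_mono[of "V - {a, b}" "insert q (V - {a, b})" convex] by blast
      moreover have "q \<in> convex hull (insert q (V - {a, b}))" by (simp add: hull_inc)
      ultimately show ?thesis unfolding y(5) by (intro convexD[OF convex_convex_hull]) (use y in auto)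
    qed
  next
    fix x assume x: "x \<in> convex hull (insert q (V - {a, b}))"
    have "convex hull (insert q (V - {a, b})) \<subseteq> convex hull (insert q (V - {b}))"
      "convex hull (insert q (V - {a, b})) \<subseteq> convex hull (insert q (V - {a}))"
      by (rule hull_mono, blast)+
    then show "x \<in> convex hull (insert q (V - {b})) \<inter> convex hull (insert q (V - {a}))" using x by blast
  qed
qed

lemma rat_valuation_cut:
  fixes \<phi> :: "(real ^ 'n) set \<Rightarrow> real"
  assumes "rat_valuation \<phi>" "c \<in> rat_vecs" "e \<in> \<rat>"
  shows "rat_valuation (\<lambda>P. \<phi> (P \<inter> {x. c \<bullet> x \<ge> e}))"
  unfolding rat_valuation_def
proof (intro conjI allI impI)
  show "\<phi> ({} \<inter> {x. c \<bullet> x \<ge> e}) = 0" using assms(1) by (simp add: rat_valuation_def)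
  fix P Q :: "(real ^ 'n) set" assume PQ: "P \<in> rat_polytopes" "Q \<in> rat_polytopes" "P \<union> Q \<in> rat_polytopes"
  let ?H = "{x. c \<bullet> x \<ge> e}"
  have "\<phi> (P \<inter> ?H) + \<phi> (Q \<inter> ?H) = \<phi> (P \<inter> ?H \<union> Q \<inter> ?H) + \<phi> (P \<inter> ?H \<inter> (Q \<inter> ?H))"
    using assms(1) rat_polytope_cut[OF PQ(1) assms(2,3)] rat_polytope_cut[OF PQ(2) assms(2,3)]
      rat_polytope_cut[OF PQ(3) assms(2,3)]
    unfolding rat_valuation_def by (simp only: Int_Un_distrib2)
  moreover have "P \<inter> ?H \<union> Q \<inter> ?H = (P \<union> Q) \<inter> ?H" "P \<inter> ?H \<inter> (Q \<inter> ?H) = P \<inter> Q \<inter> ?H" by auto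
  ultimately show "\<phi> (P \<inter> ?H) + \<phi> (Q \<inter> ?H) = \<phi> ((P \<union> Q) \<inter> ?H) + \<phi> (P \<inter> Q \<inter> ?H)" by simp
qed

text \<open>
  A simplex crossed by the hyperplane is bisected through the point where the hyperplane meets
  one of its edges; this decreases the number of vertices off the hyperplane.
\<close>

lemma vanishes_cut:
  fixes \<phi> :: "(real ^ 'n) set \<Rightarrow> real"
  assumes val: "rat_valuation \<phi>" and van: "vanishes m \<phi>" and ce: "c \<in> rat_vecs" "e \<in> \<rat>"
  shows "vanishes m (\<lambda>P. \<phi> (P \<inter> {x. c \<bullet> x \<ge> e}))"
  unfolding vanishes_def
proof (intro allI impI)
  fix W :: "(real ^ 'n) set" assume "W \<subseteq> rat_vecs" "\<not> affine_dependent W" "card W \<le> m"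
  then show "\<phi> (convex hull W \<inter> {x. c \<bullet> x \<ge> e}) = 0"
  proof (induction "card {v\<in>W. c \<bullet> v > e} + card {v\<in>W. c \<bullet> v < e}" arbitrary: W rule: less_induct)
    case (less V)
    let ?H = "{x. c \<bullet> x \<ge> e}"
    note V = less.prems
    have fin: "finite V" using V(2) by (rule aff_independent_finite)
    show ?case
    proof (cases "\<exists>a\<in>V. \<exists>b\<in>V. c \<bullet> a > e \<and> c \<bullet> b < e")
      case True
      then obtain a b where ab: "a \<in> V" "b \<in> V" "c \<bullet> a > e" "c \<bullet> b < e" by blast
      have neq: "a \<noteq> b" using ab by auto
      define s where "s = (c \<bullet> a - e) / (c \<bullet> a - c \<bullet> b)"
      define q where "q = (1 - s) *\<^sub>R a + s *\<^sub>R b"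
      have s: "0 < s" "s < 1" "c \<bullet> q = e" using crossing_point[OF ab(3,4) s_def] by (simp_all add: q_def)
      have sQ: "s \<in> \<rat>" unfolding s_def using ab V(1) ce by (auto intro!: Rats_divide Rats_diff rat_vecs_inner)
      then have qr: "q \<in> rat_vecs" unfolding q_def using ab V(1) by (auto intro!: rat_vecs_arith Rats_diff)
      have q': "q = (1 - (1 - s)) *\<^sub>R b + (1 - s) *\<^sub>R a" by (simp add: q_def add.commute)
      have indb: "\<not> affine_dependent (insert q (V - {b}))"
        by (rule simplex_edge_split(1)[OF V(2) ab(1,2) neq s(1,2) q_def])
      have inda: "\<not> affine_dependent (insert q (V - {a}))"
        by (rule simplex_edge_split(1)[OF V(2) ab(2,1) neq[symmetric] _ _ q']) (use s in auto)
      have ind0: "\<not> affine_dependent (insert q (V - {a, b}))"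
        by (rule affine_independent_subset[OF indb]) auto
      \<comment> \<open>\<open>Z\<close> will be {b}, {a} or {a, b}, for the two halves and their
        common face.\<close>
      have IH: "\<phi> (convex hull (insert q (V - Z)) \<inter> ?H) = 0"
        if Z: "Z \<noteq> {}" "Z \<subseteq> {a, b}" "\<not> affine_dependent (insert q (V - Z))" for Z
      proof (rule less.hyps)
        have ZV: "Z \<subseteq> V" "finite Z" using Z ab finite_subset[of Z "{a, b}"] by auto
        have 1: "{v\<in>insert q (V - Z). c \<bullet> v > e} = {v\<in>V. c \<bullet> v > e} - Z"
          "{v\<in>insert q (V - Z). c \<bullet> v < e} = {v\<in>V. c \<bullet> v < e} - Z" using s(3) by auto
        have "card ({v\<in>V. c \<bullet> v > e} - Z) \<le> card {v\<in>V. c \<bullet> v > e}"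
          "card ({v\<in>V. c \<bullet> v < e} - Z) \<le> card {v\<in>V. c \<bullet> v < e}"
          using fin by (auto intro!: card_mono)
        moreover have "card ({v\<in>V. c \<bullet> v > e} - Z) < card {v\<in>V. c \<bullet> v > e} \<or>
          card ({v\<in>V. c \<bullet> v < e} - Z) < card {v\<in>V. c \<bullet> v < e}"
        proof -
          have "a \<in> Z \<or> b \<in> Z" using Z(1,2) by auto
          then have "{v\<in>V. c \<bullet> v > e} - Z \<subset> {v\<in>V. c \<bullet> v > e} \<or> {v\<in>V. c \<bullet> v < e} - Z \<subset> {v\<in>V. c \<bullet> v < e}"
            using ab by auto
          then show ?thesis using fin by (auto intro!: psubset_card_mono)
        qed
        ultimately show "card {v\<in>insert q (V - Z). c \<bullet> v > e} + card {v\<in>insert q (V - Z). c \<bullet> v < e}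
          < card {v\<in>V. c \<bullet> v > e} + card {v\<in>V. c \<bullet> v < e}" unfolding 1 by linarith
        show "insert q (V - Z) \<subseteq> rat_vecs" using V(1) qr by auto
        show "\<not> affine_dependent (insert q (V - Z))" by (rule Z(3))
        have "card (insert q (V - Z)) \<le> Suc (card (V - Z))" by (rule card_insert_le_m1) auto
        also have "card (V - Z) < card V" using Z(1) ZV fin by (intro psubset_card_mono) auto
        finally show "card (insert q (V - Z)) \<le> m" using V(3) by simp
      qed
      let ?A = "convex hull (insert q (V - {b}))" and ?B = "convex hull (insert q (V - {a}))"
      have "rat_valuation (\<lambda>P. \<phi> (P \<inter> ?H))" by (rule rat_valuation_cut[OF val ce])
      moreover have "?A \<in> rat_polytopes" "?B \<in> rat_polytopes" "?A \<union> ?B \<in> rat_polytopes"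
        unfolding convex_hull_edge_split[OF fin ab(1,2) neq s(1,2) q_def, symmetric]
        using fin V(1) qr by (auto intro!: rat_polytopeI)
      ultimately have "\<phi> (?A \<inter> ?H) + \<phi> (?B \<inter> ?H) = \<phi> ((?A \<union> ?B) \<inter> ?H) + \<phi> (?A \<inter> ?B \<inter> ?H)"
        unfolding rat_valuation_def by blast
      then have "\<phi> (?A \<inter> ?H) + \<phi> (?B \<inter> ?H) = \<phi> (convex hull V \<inter> ?H) + \<phi> (convex hull (insert q (V - {a, b})) \<inter> ?H)"
        unfolding convex_hull_edge_split[OF fin ab(1,2) neq s(1,2) q_def, symmetric]
          simplex_edge_split(2)[OF V(2) ab(1,2) neq s(1,2) q_def] .
      moreover have "\<phi> (?A \<inter> ?H) = 0" by (rule IH) (use indb in auto)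
      moreover have "\<phi> (?B \<inter> ?H) = 0" by (rule IH) (use inda in auto)
      moreover have "\<phi> (convex hull (insert q (V - {a, b})) \<inter> ?H) = 0" by (rule IH) (use ind0 in auto)
      ultimately show ?thesis by simp
    next
      case no_cross: False
      show ?thesis
      proof (cases "\<exists>b\<in>V. c \<bullet> b < e")
        case True
        \<comment> \<open>No vertex is strictly above, so the cut is the face on the hyperplane,
          possibly empty; it is again a simplex with at most \<open>m\<close> vertices.\<close>
        define F where "F = {v\<in>V. c \<bullet> v \<ge> e}"
        have np: "c \<bullet> v \<le> e" if "v \<in> V" for v using no_cross True that by force
        have "convex hull V \<inter> ?H \<subseteq> convex hull F"
          by (rule convex_hull_cut_subset[OF fin]) (use np in \<open>force simp: F_def\<close>)+
        moreover have "convex hull F \<subseteq> convex hull V \<inter> ?H"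
        proof (rule hull_minimal)
          show "F \<subseteq> convex hull V \<inter> ?H" by (auto simp: F_def intro: hull_inc)
          show "convex (convex hull V \<inter> ?H)" by (intro convex_Int convex_convex_hull convex_halfspace_ge)
        qed
        ultimately have eq: "convex hull V \<inter> ?H = convex hull F" by blast
        have FV: "F \<subseteq> V" by (auto simp: F_def)
        show ?thesis unfolding eq
          using van FV V affine_independent_subset[OF V(2) FV] card_mono[OF fin FV]
          by (auto simp: vanishes_def)
      next
        case False
        then have "V \<subseteq> ?H" by auto
        then have "convex hull V \<subseteq> ?H" by (rule hull_minimal) (rule convex_halfspace_ge)
        then have "convex hull V \<inter> ?H = convex hull V" by blast
        then show ?thesis using van V by (simp add: vanishes_def)
      qed
    qed
  qed
qed

lemma vanishes_cuts:
  fixes \<phi> :: "(real ^ 'n) set \<Rightarrow> real"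
  assumes "finite G" "G \<subseteq> rat_vecs \<times> \<rat>" "rat_valuation \<phi>" "vanishes m \<phi>"
  shows "rat_valuation (\<lambda>P. \<phi> (P \<inter> {x. \<forall>(c, e)\<in>G. c \<bullet> x \<ge> e})) \<and> vanishes m (\<lambda>P. \<phi> (P \<inter> {x. \<forall>(c, e)\<in>G. c \<bullet> x \<ge> e}))"
  using assms
proof (induction G rule: finite_induct)
  case (insert g G)
  obtain c e where g: "g = (c, e)" by (cases g)
  let ?\<psi> = "\<lambda>P. \<phi> (P \<inter> {x. \<forall>(c, e)\<in>G. c \<bullet> x \<ge> e})"
  have ce: "c \<in> rat_vecs" "e \<in> \<rat>" using insert.prems g by auto
  have IH: "rat_valuation ?\<psi>" "vanishes m ?\<psi>" using insert by auto
  have eq: "(\<lambda>P. \<phi> (P \<inter> {x. \<forall>(c, e)\<in>insert g G. c \<bullet> x \<ge> e})) = (\<lambda>P. ?\<psi> (P \<inter> {x. c \<bullet> x \<ge> e}))"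
  proof
    fix P :: "(real ^ 'n) set"
    have "P \<inter> {x. \<forall>(c, e)\<in>insert g G. c \<bullet> x \<ge> e} = P \<inter> {x. c \<bullet> x \<ge> e} \<inter> {x. \<forall>(c, e)\<in>G. c \<bullet> x \<ge> e}" using g by auto
    then show "\<phi> (P \<inter> {x. \<forall>(c, e)\<in>insert g G. c \<bullet> x \<ge> e}) = ?\<psi> (P \<inter> {x. c \<bullet> x \<ge> e})" by simp
  qed
  show ?case unfolding eq using rat_valuation_cut[OF IH(1) ce] vanishes_cut[OF IH ce] by blast
qed simp

text \<open>\<open>P\<close> is cut out of a large simplex by its defining half-spaces, and each cut
  preserves vanishing on simplices. This replaces a formula for unions of many polytopes.\<close>

lemma vanishes_rat_polytope:
  fixes \<phi> :: "(real ^ 'n) set \<Rightarrow> real"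
  assumes "rat_valuation \<phi>" "vanishes (card I + 1) \<phi>" "P \<in> rat_polytopes" "P \<subseteq> {x. \<forall>i. i \<notin> I \<longrightarrow> x $ i = 0}"
  shows "\<phi> P = 0"
proof -
  obtain G where G: "finite G" "G \<subseteq> rat_vecs \<times> \<rat>" "P = {x. \<forall>(c, e)\<in>G. c \<bullet> x \<ge> e}"
    using rat_polytope_halfspaces[OF assms(3)] by blast
  have "bounded P"
    using assms(3) by (auto simp: rat_polytopes_def bounded_convex_hull finite_imp_bounded)
  then obtain W where W: "W \<subseteq> rat_vecs" "\<not> affine_dependent W" "card W \<le> card I + 1" "P \<subseteq> convex hull W"
    using big_simplex[OF _ assms(4)] by blast
  have "\<phi> (convex hull W \<inter> P) = 0"
    using vanishes_cuts[OF G(1,2) assms(1,2)] W(1,2,3) unfolding vanishes_def G(3)[symmetric] by blast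
  then show ?thesis using W(4) by (simp add: Int_absorb1)
qed

section \<open>Dissecting chain simplices\<close>

definition rat_polyhedron :: "(real ^ 'n) set \<Rightarrow> bool" where
  "rat_polyhedron C \<longleftrightarrow> (\<exists>G. finite G \<and> G \<subseteq> rat_vecs \<times> \<rat> \<and> C = {x. \<forall>(c, e)\<in>G. c \<bullet> x \<ge> e})"

definition coord_space :: "'n set \<Rightarrow> (real ^ 'n) set" where
  "coord_space I = {x. \<forall>i. i \<notin> I \<longrightarrow> x $ i = 0}"

definition coord_box :: "real \<Rightarrow> real \<Rightarrow> 'n set \<Rightarrow> (real ^ 'n) set" where
  "coord_box lo hi I = {x. \<forall>i\<in>I. lo \<le> x $ i \<and> x $ i \<le> hi}"

definition descending :: "'n list \<Rightarrow> (real ^ 'n) set" where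
  "descending xs = {x. sorted_wrt (\<lambda>i j. x $ j \<le> x $ i) xs}"

lemma rat_polyhedron_ge: "c \<in> rat_vecs \<Longrightarrow> e \<in> \<rat> \<Longrightarrow> rat_polyhedron {x. c \<bullet> x \<ge> e}"
  unfolding rat_polyhedron_def by (intro exI[of _ "{(c, e)}"]) simp

lemma rat_polyhedron_le: "c \<in> rat_vecs \<Longrightarrow> e \<in> \<rat> \<Longrightarrow> rat_polyhedron {x. c \<bullet> x \<le> e}"
  using rat_polyhedron_ge[of "- c" "- e"] by (simp add: rat_vecs_arith)

lemma rat_polyhedron_Int:
  assumes "rat_polyhedron C" "rat_polyhedron D"
  shows "rat_polyhedron (C \<inter> D)"
proof -
  obtain G H where "finite G" "G \<subseteq> rat_vecs \<times> \<rat>" "C = {x. \<forall>(c, e)\<in>G. c \<bullet> x \<ge> e}"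
    "finite H" "H \<subseteq> rat_vecs \<times> \<rat>" "D = {x. \<forall>(c, e)\<in>H. c \<bullet> x \<ge> e}"
    using assms unfolding rat_polyhedron_def by blast
  then show ?thesis unfolding rat_polyhedron_def by (intro exI[of _ "G \<union> H"]) auto
qed

lemma rat_polyhedron_INT:
  assumes "finite I" "\<And>i. i \<in> I \<Longrightarrow> rat_polyhedron (S i)"
  shows "rat_polyhedron (\<Inter>i\<in>I. S i)"
  using assms
proof (induction I rule: finite_induct)
  case empty
  show ?case unfolding rat_polyhedron_def by (intro exI[of _ "{}"]) simp
qed (simp add: rat_polyhedron_Int)

lemma rat_polyhedron_coord_ge: "e \<in> \<rat> \<Longrightarrow> rat_polyhedron {x. x $ i \<ge> e}"
  and rat_polyhedron_coord_le: "e \<in> \<rat> \<Longrightarrow> rat_polyhedron {x. x $ i \<le> e}"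
  using rat_polyhedron_ge[of "axis i 1" e] rat_polyhedron_le[of "axis i 1" e]
  by (simp_all add: inner_axis' rat_vecs_arith)

lemma rat_polyhedron_coord_box:
  fixes I :: "'n::finite set"
  assumes "lo \<in> \<rat>" "hi \<in> \<rat>"
  shows "rat_polyhedron (coord_box lo hi I)"
proof -
  have "coord_box lo hi I = (\<Inter>i\<in>I. {x. x $ i \<ge> lo} \<inter> {x. x $ i \<le> hi})"
    by (auto simp: coord_box_def)
  then show ?thesis
    using assms by (auto intro!: rat_polyhedron_INT rat_polyhedron_Int rat_polyhedron_coord_ge rat_polyhedron_coord_le)
qed

lemma rat_polyhedron_coord_space: "rat_polyhedron (coord_space I)"
proof -
  have "coord_space I = coord_box 0 0 (- I)" by (auto simp: coord_space_def coord_box_def intro: antisym)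
  then show ?thesis by (simp add: rat_polyhedron_coord_box)
qed

lemma rat_polyhedron_descending: "rat_polyhedron (descending xs)"
proof (induction xs)
  case Nil
  show ?case using rat_polyhedron_coord_space[of UNIV] by (simp add: descending_def coord_space_def)
next
  case (Cons i xs)
  have "descending (i # xs) = (\<Inter>j\<in>set xs. {x. (axis i 1 - axis j 1) \<bullet> x \<ge> 0}) \<inter> descending xs"
    by (auto simp: descending_def inner_diff_left inner_axis')
  then show ?case
    using Cons by (auto intro!: rat_polyhedron_INT rat_polyhedron_Int rat_polyhedron_ge rat_vecs_arith)
qed

lemma bounded_coord_box: "bounded (coord_box lo hi UNIV)"
proof (rule boundedI)
  fix x :: "real ^ 'n" assume x: "x \<in> coord_box lo hi UNIV"
  have "norm x \<le> (\<Sum>i\<in>UNIV. norm (x $ i))" using norm_le_l1_cart[of x] by simp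
  also have "\<dots> \<le> (\<Sum>i\<in>(UNIV :: 'n set). \<bar>lo\<bar> + \<bar>hi\<bar>)"
  proof (rule sum_mono)
    fix i show "norm (x $ i) \<le> \<bar>lo\<bar> + \<bar>hi\<bar>"
      using x by (auto simp: coord_box_def abs_le_iff) (smt (verit))+
  qed
  finally show "norm x \<le> (\<Sum>i\<in>(UNIV :: 'n set). \<bar>lo\<bar> + \<bar>hi\<bar>)" .
qed

lemma rat_polytope_in_box:
  assumes "rat_polyhedron C" "C \<subseteq> coord_box lo hi UNIV"
  shows "C \<in> rat_polytopes"
  using assms rat_polytope_bounded_polyhedron bounded_subset[OF bounded_coord_box assms(2)]
  unfolding rat_polyhedron_def by blast

text \<open>An intermediate stage of the slicing: coordinates in \<open>xs\<close> may still be
  large while those in \<open>ys\<close> are known to be at most 1. \<open>slab_split\<close> is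
  reached when those in \<open>xs\<close> are known to be at least 1; then the two chains no longer
  interact.\<close>

definition slab_mixed :: "(real ^ 'n) set \<Rightarrow> nat \<Rightarrow> 'n list \<Rightarrow> 'n list \<Rightarrow> (real ^ 'n) set" where
  "slab_mixed C k xs ys = C \<inter> coord_box 0 (real k + 1) (set xs) \<inter> coord_box 0 1 (set ys) \<inter> descending (xs @ ys)"

definition slab_split :: "(real ^ 'n) set \<Rightarrow> nat \<Rightarrow> 'n list \<Rightarrow> 'n list \<Rightarrow> (real ^ 'n) set" where
  "slab_split C k xs ys = C \<inter> coord_box 1 (real k + 1) (set xs) \<inter> descending xs \<inter>
     coord_box 0 1 (set ys) \<inter> descending ys"

text \<open>The cut is at x_i = 1 for the last, hence smallest, coordinate of the upper chain. Above
  it the upper chain is at least 1 and \<open>ys\<close> at most 1, so the order between them holds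
  by itself and the piece is a product; below it \<open>i\<close> joins \<open>ys\<close>.\<close>

lemma slab_cut:
  fixes C :: "(real ^ 'n) set"
  assumes val: "rat_valuation \<phi>"
    and van: "\<And>P i. P \<in> rat_polytopes \<Longrightarrow> i \<in> I \<Longrightarrow> P \<subseteq> {x. x $ i = 1} \<Longrightarrow> P \<subseteq> coord_space I \<Longrightarrow> \<phi> P = 0"
    and C: "rat_polyhedron C" "C \<subseteq> coord_space I" "C \<subseteq> coord_box 0 1 (- (set xs \<union> {i} \<union> set ys))"
    and iI: "i \<in> I"
  shows "\<phi> (slab_mixed C k (xs @ [i]) ys) = \<phi> (slab_split C k (xs @ [i]) ys) + \<phi> (slab_mixed C k xs (i # ys))"
proof -
  let ?A = "slab_split C k (xs @ [i]) ys" and ?B = "slab_mixed C k xs (i # ys)"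
    and ?U = "slab_mixed C k (xs @ [i]) ys"
  have A: "?A = ?U \<inter> {x. x $ i \<ge> 1}"
    by (auto simp: slab_split_def slab_mixed_def coord_box_def descending_def sorted_wrt_append
      intro: order_trans order_trans[of 0 1])
  have B: "?B = ?U \<inter> {x. x $ i \<le> 1}"
    by (auto simp: slab_mixed_def coord_box_def descending_def sorted_wrt_append intro: order_trans)
  have "?U = ?A \<union> ?B" unfolding A B by auto
  have box: "?U \<subseteq> coord_box 0 (real k + 1) UNIV"
  proof
    fix x assume x: "x \<in> ?U"
    have "0 \<le> x $ j \<and> x $ j \<le> real k + 1" for j
    proof (cases "j \<in> set xs \<union> {i} \<union> set ys")
      case True
      then show ?thesis using x by (auto simp: slab_mixed_def coord_box_def)
    next
      case False
      then have "0 \<le> x $ j \<and> x $ j \<le> 1" using x C(3) by (auto simp: slab_mixed_def coord_box_def)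
      then show ?thesis by auto
    qed
    then show "x \<in> coord_box 0 (real k + 1) UNIV" by (simp add: coord_box_def)
  qed
  have "rat_polyhedron ?U" unfolding slab_mixed_def
    by (intro rat_polyhedron_Int C rat_polyhedron_coord_box rat_polyhedron_descending) auto
  note U = this
  have UR: "?U \<in> rat_polytopes" by (rule rat_polytope_in_box[OF U box])
  have AR: "?A \<in> rat_polytopes" unfolding A
    by (rule rat_polytope_in_box[OF rat_polyhedron_Int[OF U rat_polyhedron_coord_ge[of 1 i]]]) (use box in auto)
  have BR: "?B \<in> rat_polytopes" unfolding B
    by (rule rat_polytope_in_box[OF rat_polyhedron_Int[OF U rat_polyhedron_coord_le[of 1 i]]]) (use box in auto)
  have "\<phi> (?A \<inter> ?B) = 0"
  proof (rule van[OF rat_polytope_Int[OF AR BR] iI])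
    show "?A \<inter> ?B \<subseteq> {x. x $ i = 1}" unfolding A B by auto
    show "?A \<inter> ?B \<subseteq> coord_space I" using C(2) by (auto simp: slab_split_def)
  qed
  moreover have "\<phi> ?A + \<phi> ?B = \<phi> (?A \<union> ?B) + \<phi> (?A \<inter> ?B)"
    using val AR BR UR \<open>?U = ?A \<union> ?B\<close> unfolding rat_valuation_def by metis
  ultimately show ?thesis using \<open>?U = ?A \<union> ?B\<close> by simp
qed

text \<open>Points are sorted by the number \<open>j\<close> of coordinates in \<open>xs\<close>
  that are at least 1; these form an initial part of the descending list. Overlaps lie in
  hyperplanes x_i = 1, where \<phi> vanishes.\<close>

lemma slab_sum:
  fixes C :: "(real ^ 'n) set"
  assumes val: "rat_valuation \<phi>"
    and van: "\<And>P i. P \<in> rat_polytopes \<Longrightarrow> i \<in> I \<Longrightarrow> P \<subseteq> {x. x $ i = 1} \<Longrightarrow> P \<subseteq> coord_space I \<Longrightarrow> \<phi> P = 0"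
    and C: "rat_polyhedron C" "C \<subseteq> coord_space I" "C \<subseteq> coord_box 0 1 (- (set xs \<union> set ys))"
    and xs: "set xs \<subseteq> I"
  shows "\<phi> (slab_mixed C k xs ys) = (\<Sum>j\<le>length xs. \<phi> (slab_split C k (take j xs) (drop j xs @ ys)))"
  using C(3) xs
proof (induction xs arbitrary: ys rule: rev_induct)
  case Nil
  show ?case by (simp add: slab_mixed_def slab_split_def coord_box_def descending_def)
next
  case (snoc i xs)
  have "\<phi> (slab_mixed C k (xs @ [i]) ys) = \<phi> (slab_split C k (xs @ [i]) ys) + \<phi> (slab_mixed C k xs (i # ys))"
    by (rule slab_cut[OF val van C(1,2)]) (use snoc.prems in \<open>simp_all add: Un_ac\<close>)
  also have "\<phi> (slab_mixed C k xs (i # ys)) = (\<Sum>j\<le>length xs. \<phi> (slab_split C k (take j xs) (drop j xs @ i # ys)))"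
    by (rule snoc.IH) (use snoc.prems in \<open>auto simp: Un_ac\<close>)
  also have "\<phi> (slab_split C k (xs @ [i]) ys) + (\<Sum>j\<le>length xs. \<phi> (slab_split C k (take j xs) (drop j xs @ i # ys))) =
      (\<Sum>j\<le>length (xs @ [i]). \<phi> (slab_split C k (take j (xs @ [i])) (drop j (xs @ [i]) @ ys)))"
    by (simp add: add.commute)
  finally show ?case .
qed

definition indicator_vec :: "'n set \<Rightarrow> real ^ 'n" where
  "indicator_vec I = (\<chi> i. if i \<in> I then 1 else 0)"

lemma indicator_vec_rat: "indicator_vec I \<in> rat_vecs"
  by (simp add: indicator_vec_def rat_vecs_def)

text \<open>
  Slicing a dilated chain simplex by unit cubes leaves products of smaller chain simplices, which
  gives a recursion for the values at successive dilates.
\<close>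

lemma chain_binomial_expansion:
  fixes C :: "(real ^ 'n) set"
  assumes val: "rat_valuation \<phi>"
    and trans: "\<And>P y. P \<in> rat_polytopes \<Longrightarrow> y \<in> rat_vecs \<Longrightarrow> \<phi> ((\<lambda>x. x + y) ` P) = \<phi> P"
    and van: "\<And>P i. P \<in> rat_polytopes \<Longrightarrow> i \<in> I \<Longrightarrow> P \<subseteq> {x. x $ i = 1} \<Longrightarrow> P \<subseteq> coord_space I \<Longrightarrow> \<phi> P = 0"
    and "rat_polyhedron C" "C \<subseteq> coord_space I" "C \<subseteq> coord_box 0 1 (- set xs)"
    and "set xs \<subseteq> I" "distinct xs"
    and "\<And>x y. x \<in> C \<Longrightarrow> (\<And>i. i \<notin> set xs \<Longrightarrow> y $ i = x $ i) \<Longrightarrow> y \<in> C"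
  shows "\<exists>c. (\<forall>k::nat. \<phi> (C \<inter> coord_box 0 (real k) (set xs) \<inter> descending xs) = (\<Sum>e\<le>length xs. c e * real (k choose e)))
    \<and> c (length xs) = \<phi> (C \<inter> coord_box 0 1 (set xs))"
  using assms(4-)
proof (induction "length xs" arbitrary: xs C rule: less_induct)
  case (less xs C)
  note C = less.prems
  show ?case
  proof (cases "xs = []")
    case True
    then show ?thesis by (intro exI[of _ "\<lambda>_. \<phi> C"]) (simp add: coord_box_def descending_def)
  next
    case False
    then obtain m where m: "length xs = Suc m" by (cases xs) auto
    \<comment> \<open>\<open>G k\<close> is the value at the k-th dilate. In the piece with
      \<open>j\<close> coordinates above 1, the remaining ones do not grow with \<open>k\<close> and
      are absorbed into the cross-section \<open>D j\<close>, over which the chain is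
      shorter.\<close>
    define G where "G k = \<phi> (C \<inter> coord_box 0 (real k) (set xs) \<inter> descending xs)" for k :: nat
    define D where "D j = C \<inter> coord_box 0 1 (set (drop j xs)) \<inter> descending (drop j xs)" for j
    define g where "g j k = \<phi> (D j \<inter> coord_box 0 (real k) (set (take j xs)) \<inter> descending (take j xs))" for j k
    have disj: "set (take j xs) \<inter> set (drop j xs) = {}" for j
      using C(5) by (metis distinct_append append_take_drop_id)
    have un: "set (take j xs) \<union> set (drop j xs) = set xs" for j
      by (metis set_append append_take_drop_id)
    have D: "rat_polyhedron (D j)" "D j \<subseteq> coord_space I" "D j \<subseteq> coord_box 0 1 (- set (take j xs))"
      "\<And>x y. x \<in> D j \<Longrightarrow> (\<And>i. i \<notin> set (take j xs) \<Longrightarrow> y $ i = x $ i) \<Longrightarrow> y \<in> D j" for j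
    proof -
      show "rat_polyhedron (D j)" unfolding D_def
        by (intro rat_polyhedron_Int C rat_polyhedron_coord_box rat_polyhedron_descending) auto
      show "D j \<subseteq> coord_space I" using C(2) by (auto simp: D_def)
      show "D j \<subseteq> coord_box 0 1 (- set (take j xs))"
        using C(3) un[of j] by (auto simp: D_def coord_box_def)
      fix x y assume x: "x \<in> D j" and y: "\<And>i. i \<notin> set (take j xs) \<Longrightarrow> y $ i = x $ i"
      have "y \<in> C" by (rule C(6)[of x]) (use x y un[of j] in \<open>auto simp: D_def\<close>)
      moreover have yd: "y $ i = x $ i" if "i \<in> set (drop j xs)" for i using that y disj[of j] by blast
      then have "y \<in> coord_box 0 1 (set (drop j xs))" using x by (auto simp: D_def coord_box_def)
      moreover have "y \<in> descending (drop j xs)"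
        using x yd sorted_wrt_mono_rel[of "drop j xs" "\<lambda>i l. x $ l \<le> x $ i" "\<lambda>i l. y $ l \<le> y $ i"]
        by (auto simp: D_def descending_def)
      ultimately show "y \<in> D j" by (simp add: D_def)
    qed
    \<comment> \<open>The indicator vector moves the range [1, k + 1] back to [0, k];
      \<open>D j\<close> is a cylinder in these directions and does not change.\<close>
    have shift: "\<phi> (slab_split C k (take j xs) (drop j xs)) = g j k" for j k
    proof -
      let ?t = "indicator_vec (set (take j xs)) :: real ^ 'n"
      let ?S = "D j \<inter> coord_box 0 (real k) (set (take j xs)) \<inter> descending (take j xs)"
      have t: "?t $ i = (if i \<in> set (take j xs) then 1 else 0)" for i by (simp add: indicator_vec_def)
      have desc: "x + ?t \<in> descending (take j xs) \<longleftrightarrow> x \<in> descending (take j xs)" for x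
      proof -
        have "sorted_wrt (\<lambda>i l. (x + ?t) $ l \<le> (x + ?t) $ i) (take j xs) = sorted_wrt (\<lambda>i l. x $ l \<le> x $ i) (take j xs)"
          by (rule iffI; erule sorted_wrt_mono_rel[rotated]) (simp_all add: t)
        then show ?thesis by (simp add: descending_def)
      qed
      have DD: "x + ?t \<in> D j \<longleftrightarrow> x \<in> D j" for x
        using D(4)[of x j "x + ?t"] D(4)[of "x + ?t" j x] by (auto simp: t)
      have bx: "x + ?t \<in> coord_box 1 (real k + 1) (set (take j xs)) \<longleftrightarrow> x \<in> coord_box 0 (real k) (set (take j xs))" for x
        by (auto simp: coord_box_def t)
      have mem: "x + ?t \<in> slab_split C k (take j xs) (drop j xs) \<longleftrightarrow> x \<in> ?S" for x
        using desc[of x] DD[of x] bx[of x] unfolding slab_split_def D_def by blast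
      have "slab_split C k (take j xs) (drop j xs) = (\<lambda>x. x + ?t) ` ?S"
      proof (intro equalityI subsetI)
        fix x assume "x \<in> slab_split C k (take j xs) (drop j xs)"
        then have "x - ?t \<in> ?S" using mem[of "x - ?t"] by simp
        then show "x \<in> (\<lambda>x. x + ?t) ` ?S" by (rule rev_image_eqI) simp
      qed (use mem in blast)
      moreover have "?S \<in> rat_polytopes"
      proof (rule rat_polytope_in_box)
        show "rat_polyhedron ?S"
          by (intro rat_polyhedron_Int D rat_polyhedron_coord_box rat_polyhedron_descending) auto
        show "?S \<subseteq> coord_box 0 (max 1 (real k)) UNIV"
          using D(3)[of j] by (auto simp: coord_box_def le_max_iff_disj)
      qed
      ultimately show ?thesis using trans[OF _ indicator_vec_rat] by (simp only: g_def)
    qed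
    \<comment> \<open>The piece with all coordinates above 1 is a translate of the k-th dilate
      itself, so the other pieces give the difference of successive values.\<close>
    have rec: "G (Suc k) = G k + (\<Sum>j\<le>m. g j k)" for k
    proof -
      have "G (Suc k) = \<phi> (slab_mixed C k xs [])"
        by (simp add: G_def slab_mixed_def coord_box_def add.commute)
      also have "\<dots> = (\<Sum>j\<le>length xs. \<phi> (slab_split C k (take j xs) (drop j xs @ [])))"
        by (rule slab_sum[OF val van C(1,2)]) (use C in auto)
      also have "\<dots> = (\<Sum>j\<le>Suc m. g j k)" using shift m by simp
      also have "\<dots> = G k + (\<Sum>j\<le>m. g j k)"
        by (simp add: g_def D_def G_def m coord_box_def descending_def)
      finally show ?thesis .
    qed
    have "\<exists>c. (\<forall>k::nat. g j k = (\<Sum>e\<le>j. c e * real (k choose e))) \<and> c j = \<phi> (D j \<inter> coord_box 0 1 (set (take j xs)))"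
      if j: "j \<le> m" for j
    proof -
      have len: "length (take j xs) = j" using j m by simp
      have "\<exists>c. (\<forall>k::nat. \<phi> (D j \<inter> coord_box 0 (real k) (set (take j xs)) \<inter> descending (take j xs)) =
          (\<Sum>e\<le>length (take j xs). c e * real (k choose e))) \<and>
          c (length (take j xs)) = \<phi> (D j \<inter> coord_box 0 1 (set (take j xs)))"
      proof (rule less.hyps[OF _ D(1-3)])
        show "length (take j xs) < length xs" using j m by simp
        show "set (take j xs) \<subseteq> I" using C(4) un[of j] by auto
        show "distinct (take j xs)" using C(5) by (rule distinct_take)
        fix x y assume "x \<in> D j" and "\<And>i. i \<notin> set (take j xs) \<Longrightarrow> y $ i = x $ i"
        then show "y \<in> D j" by (rule D(4))
      qed
      then show ?thesis unfolding len g_def .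
    qed
    then have "\<forall>j. \<exists>c. j \<le> m \<longrightarrow> (\<forall>k::nat. g j k = (\<Sum>e\<le>j. c e * real (k choose e))) \<and>
        c j = \<phi> (D j \<inter> coord_box 0 1 (set (take j xs)))" by simp
    from choice[OF this] obtain c where c: "\<And>j k. j \<le> m \<Longrightarrow> g j k = (\<Sum>e\<le>j. c j e * real (k choose e))"
      "\<And>j. j \<le> m \<Longrightarrow> c j j = \<phi> (D j \<inter> coord_box 0 1 (set (take j xs)))"
      by auto
    define b where "b e = (\<Sum>j\<in>{e..m}. c j e)" for e
    have inner: "(\<Sum>j\<le>m. g j k) = (\<Sum>e\<le>m. b e * real (k choose e))" for k
    proof -
      have "(\<Sum>j\<le>m. g j k) = (\<Sum>j\<le>m. \<Sum>e\<le>m. if e \<le> j then c j e * real (k choose e) else 0)"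
      proof (intro sum.cong refl)
        fix j assume j: "j \<in> {..m}"
        have "(\<Sum>e\<le>j. c j e * real (k choose e)) = (\<Sum>e\<le>m. if e \<le> j then c j e * real (k choose e) else 0)"
          using j by (intro sum.mono_neutral_cong_left) auto
        then show "g j k = (\<Sum>e\<le>m. if e \<le> j then c j e * real (k choose e) else 0)" using c(1) j by simp
      qed
      also have "\<dots> = (\<Sum>e\<le>m. \<Sum>j\<le>m. if e \<le> j then c j e * real (k choose e) else 0)" by (rule sum.swap)
      also have "\<dots> = (\<Sum>e\<le>m. b e * real (k choose e))"
      proof (intro sum.cong refl)
        fix e assume "e \<in> {..m}"
        have "(\<Sum>j\<le>m. if e \<le> j then c j e * real (k choose e) else 0) = (\<Sum>j\<in>{e..m}. c j e * real (k choose e))"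
          by (intro sum.mono_neutral_cong_right) auto
        then show "(\<Sum>j\<le>m. if e \<le> j then c j e * real (k choose e) else 0) = b e * real (k choose e)"
          by (simp add: b_def sum_distrib_right)
      qed
      finally show ?thesis .
    qed
    \<comment> \<open>Summing the differences: binomials with lower entry e add up to a binomial
      with lower entry e + 1.\<close>
    have closed: "G k = G 0 + (\<Sum>e\<le>m. b e * real (k choose Suc e))" for k
    proof (induction k)
      case (Suc k)
      then show ?case by (simp add: rec inner sum.distrib distrib_left)
    qed simp
    define c' where "c' e = (case e of 0 \<Rightarrow> G 0 | Suc e' \<Rightarrow> b e')" for e
    have "G k = (\<Sum>e\<le>length xs. c' e * real (k choose e))" for k
      unfolding m closed[of k] sum.atMost_Suc_shift by (simp add: c'_def)
    moreover have "c' (length xs) = \<phi> (C \<inter> coord_box 0 1 (set xs))"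
    proof -
      \<comment> \<open>Only j = m contributes to the top coefficient. A single remaining coordinate
        satisfies no order condition, which leaves the full box.\<close>
      obtain i where i: "drop m xs = [i]"
        using m by (metis Cons_nth_drop_Suc drop_all lessI order_refl)
      have "descending [i] = UNIV" by (simp add: descending_def)
      then have "D m \<inter> coord_box 0 1 (set (take m xs)) = C \<inter> coord_box 0 1 (set xs)"
        using un[of m] by (auto simp: D_def i coord_box_def)
      then show ?thesis using c(2)[of m] by (simp add: c'_def m b_def)
    qed
    ultimately show ?thesis unfolding G_def by blast
  qed
qed

section \<open>Affine coordinates for rational simplices\<close>

definition lin :: "('n \<Rightarrow> real ^ 'n) \<Rightarrow> real ^ 'n \<Rightarrow> real ^ 'n" where
  "lin f x = (\<Sum>i\<in>UNIV. x $ i *\<^sub>R f i)"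

definition rat_basis :: "('n \<Rightarrow> real ^ 'n) \<Rightarrow> bool" where
  "rat_basis f \<longleftrightarrow> (\<forall>i. f i \<in> rat_vecs) \<and> span (range f) = UNIV"

text \<open>The simplex 1 >= x_1 >= ... >= x_m >= 0 of Kuhn's triangulation of the cube, with the
  order of coordinates given by the list.\<close>

definition std_chain :: "'n list \<Rightarrow> (real ^ 'n) set" where
  "std_chain xs = coord_space (set xs) \<inter> coord_box 0 1 (set xs) \<inter> descending xs"

lemma linear_lin: "linear (lin f)"
  by (rule linearI) (simp_all add: lin_def scaleR_add_left sum.distrib scaleR_sum_right)

lemma lin_axis: "lin f (axis i 1) = f i"
  by (simp add: lin_def axis_def if_distrib[of "\<lambda>t. t *\<^sub>R _"] sum.delta' cong: if_cong)

lemma lin_indicator_vec: "lin f (indicator_vec I) = sum f I"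
  by (simp add: lin_def indicator_vec_def if_distrib[of "\<lambda>t. t *\<^sub>R _"] sum.If_cases cong: if_cong)

lemma inj_lin:
  assumes "rat_basis f"
  shows "inj (lin f)"
proof -
  have "subspace (range (lin f))" using linear_subspace_image[OF linear_lin subspace_UNIV] .
  moreover have "range f \<subseteq> range (lin f)" using lin_axis[of f] by (metis image_subsetI rangeI)
  ultimately have "span (range f) \<subseteq> range (lin f)" by (rule span_minimal[rotated])
  then have "surj (lin f)" using assms by (auto simp: rat_basis_def)
  then show ?thesis using linear_lin linear_surjective_imp_injective by blast
qed

lemma lin_rat_vecs: "rat_basis f \<Longrightarrow> lin f ` rat_vecs \<subseteq> rat_vecs"
  unfolding lin_def rat_basis_def by (auto intro!: Rats_sum Rats_mult simp: rat_vecs_def)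

lemma hom_valuation_lin: "hom_valuation d \<phi> \<Longrightarrow> rat_basis f \<Longrightarrow> hom_valuation d (\<lambda>P. \<phi> (lin f ` P))"
  by (intro hom_valuation_linear_image linear_lin inj_lin lin_rat_vecs)

text \<open>\<open>v\<close> is the first and largest coordinate; dividing by it puts the others
  into the shorter chain. If it is zero, so is the whole point.\<close>

lemma std_chain_Cons:
  assumes "i \<notin> set xs"
  shows "x \<in> std_chain (i # xs) \<longleftrightarrow> (\<exists>v y. 0 \<le> v \<and> v \<le> 1 \<and> y \<in> std_chain xs \<and> x = v *\<^sub>R (axis i 1 + y))"
    (is "?l \<longleftrightarrow> ?r")
proof
  assume l: ?l
  define v where "v = x $ i"
  have v: "0 \<le> v" "v \<le> 1" using l by (auto simp: std_chain_def coord_box_def v_def)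
  have x: "x $ j = 0" if "j \<notin> set (i # xs)" for j using l that by (auto simp: std_chain_def coord_space_def)
  have xx: "0 \<le> x $ j" "x $ j \<le> v" if "j \<in> set xs" for j
    using l that by (auto simp: std_chain_def coord_box_def descending_def v_def)
  show ?r
  proof (cases "v = 0")
    case True
    have "x $ j = 0" for j
    proof -
      consider "j = i" | "j \<in> set xs" | "j \<notin> set (i # xs)" by auto
      then show ?thesis using x[of j] xx[of j] True by cases (auto simp: v_def)
    qed
    then have "x = 0" by (simp add: vec_eq_iff)
    moreover have "0 \<in> std_chain xs"
      by (simp add: std_chain_def coord_space_def coord_box_def descending_def sorted_wrt_iff_nth_less)
    ultimately show ?thesis by (intro exI[of _ 0] exI[of _ 0]) simp
  next
    case False
    then have v0: "v > 0" using v by simp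
    define y where "y = (1 / v) *\<^sub>R (x - v *\<^sub>R axis i 1)"
    have y: "y $ j = (if j = i then 0 else x $ j / v)" for j
      using v0 by (simp add: y_def axis_def v_def)
    have "x = v *\<^sub>R (axis i 1 + y)" using v0 by (simp add: y_def scaleR_add_right)
    moreover have "y \<in> coord_space (set xs)" using x by (auto simp: coord_space_def y)
    moreover have "y \<in> coord_box 0 1 (set xs)" using xx v0 by (auto simp: coord_box_def y)
    moreover have "y \<in> descending xs"
    proof -
      have "sorted_wrt (\<lambda>i j. x $ j \<le> x $ i) xs" using l by (simp add: std_chain_def descending_def)
      then have "sorted_wrt (\<lambda>i j. y $ j \<le> y $ i) xs"
        by (rule sorted_wrt_mono_rel[rotated]) (use assms v0 in \<open>auto simp: y divide_right_mono\<close>)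
      then show ?thesis by (simp add: descending_def)
    qed
    ultimately show ?thesis using v unfolding std_chain_def by blast
  qed
next
  assume ?r
  then obtain v y where vy: "0 \<le> v" "v \<le> 1" "y \<in> std_chain xs" "x = v *\<^sub>R (axis i 1 + y)" by blast
  have yi: "y $ i = 0" using vy(3) assms by (auto simp: std_chain_def coord_space_def)
  have x: "x $ j = (if j = i then v else v * y $ j)" for j using yi by (simp add: vy(4) axis_def)
  have yb: "0 \<le> y $ j" "y $ j \<le> 1" if "j \<in> set xs" for j using vy(3) that by (auto simp: std_chain_def coord_box_def)
  have le: "v * y $ j \<le> v" if "j \<in> set xs" for j using yb[OF that] vy(1) by (simp add: mult_left_le)
  have "x \<in> coord_space (set (i # xs))" using vy(3) by (auto simp: std_chain_def coord_space_def x)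
  moreover have "x \<in> coord_box 0 1 (set (i # xs))"
    using yb vy(1,2) le by (auto simp: coord_box_def x intro: order_trans)
  moreover have "sorted_wrt (\<lambda>i j. y $ j \<le> y $ i) xs" using vy(3) by (simp add: std_chain_def descending_def)
  then have "sorted_wrt (\<lambda>i j. x $ j \<le> x $ i) xs"
    by (rule sorted_wrt_mono_rel[rotated]) (use assms vy(1) in \<open>auto simp: x mult_left_mono\<close>)
  then have "x \<in> descending (i # xs)" using le assms by (auto simp: descending_def x)
  ultimately show ?l by (simp add: std_chain_def)
qed

text \<open>By \<open>std_chain_Cons\<close> the simplex is a cone with apex 0 over a translate of
  the shorter chain simplex, so its vertices are the partial sums of unit vectors along the
  list.\<close>

lemma std_chain_hull:
  fixes xs :: "'n::finite list"
  assumes "distinct xs"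
  shows "std_chain xs = convex hull ((\<lambda>j. indicator_vec (set (take j xs))) ` {..length xs})"
  using assms
proof (induction xs)
  case Nil
  show ?case by (auto simp: std_chain_def coord_space_def coord_box_def descending_def indicator_vec_def vec_eq_iff)
next
  case (Cons i xs)
  let ?V = "(\<lambda>j. indicator_vec (set (take j xs)) :: real ^ 'n) ` {..length xs}"
  have "indicator_vec (set (take (Suc j) (i # xs))) = axis i 1 + indicator_vec (set (take j xs))" for j
    using Cons.prems in_set_takeD[of i j xs] by (auto simp: indicator_vec_def axis_def vec_eq_iff)
  moreover have "indicator_vec {} = (0 :: real ^ 'n)" by (simp add: indicator_vec_def vec_eq_iff)
  ultimately have "(\<lambda>j. indicator_vec (set (take j (i # xs)))) ` {..length (i # xs)} = insert 0 ((+) (axis i 1) ` ?V)"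
    by (simp add: atMost_Suc_eq_insert_0 image_image del: take_Suc_Cons)
  moreover have "x \<in> convex hull (insert 0 ((+) (axis i 1) ` ?V)) \<longleftrightarrow> x \<in> std_chain (i # xs)" for x
  proof -
    have "x \<in> convex hull (insert 0 ((+) (axis i 1) ` ?V)) \<longleftrightarrow>
      (\<exists>u v b. 0 \<le> u \<and> 0 \<le> v \<and> u + v = 1 \<and> b \<in> (+) (axis i 1) ` std_chain xs \<and> x = v *\<^sub>R b)"
      using Cons.IH Cons.prems by (subst convex_hull_insert) (auto simp: convex_hull_translation)
    also have "\<dots> \<longleftrightarrow> (\<exists>v y. 0 \<le> v \<and> v \<le> 1 \<and> y \<in> std_chain xs \<and> x = v *\<^sub>R (axis i 1 + y))"
    proof
      assume "\<exists>u v b. 0 \<le> u \<and> 0 \<le> v \<and> u + v = 1 \<and> b \<in> (+) (axis i 1) ` std_chain xs \<and> x = v *\<^sub>R b"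
      then show "\<exists>v y. 0 \<le> v \<and> v \<le> 1 \<and> y \<in> std_chain xs \<and> x = v *\<^sub>R (axis i 1 + y)" by force
    next
      assume "\<exists>v y. 0 \<le> v \<and> v \<le> 1 \<and> y \<in> std_chain xs \<and> x = v *\<^sub>R (axis i 1 + y)"
      then obtain v y where "0 \<le> v" "v \<le> 1" "y \<in> std_chain xs" "x = v *\<^sub>R (axis i 1 + y)" by blast
      then show "\<exists>u v b. 0 \<le> u \<and> 0 \<le> v \<and> u + v = 1 \<and> b \<in> (+) (axis i 1) ` std_chain xs \<and> x = v *\<^sub>R b"
        by (intro exI[of _ "1 - v"] exI[of _ v] exI[of _ "axis i 1 + y"]) auto
    qed
    also have "\<dots> \<longleftrightarrow> x \<in> std_chain (i # xs)" using std_chain_Cons[of i xs x] Cons.prems by simp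
    finally show ?thesis .
  qed
  ultimately show ?case by auto
qed

text \<open>Inverse to partial sums along the list: \<open>lin (differences g 0 xs)\<close> maps the
  nonzero vertices of the chain simplex of a distinct list to the values of \<open>g\<close> on
  it.\<close>

fun differences :: "('n \<Rightarrow> 'v::ab_group_add) \<Rightarrow> 'v \<Rightarrow> 'n list \<Rightarrow> 'n \<Rightarrow> 'v" where
  "differences g a [] = g"
| "differences g a (i # xs) = (differences g (g i) xs)(i := g i - a)"

lemma differences_other: "i \<notin> set xs \<Longrightarrow> differences g a xs i = g i"
  by (induction xs arbitrary: a) auto

lemma differences_sum:
  "distinct xs \<Longrightarrow> j < length xs \<Longrightarrow> (\<Sum>i\<in>set (take (Suc j) xs). differences g a xs i) = g (xs ! j) - a"
proof (induction xs arbitrary: a j)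
  case (Cons i xs)
  show ?case
  proof (cases j)
    case (Suc j')
    have i: "i \<notin> set (take (Suc j') xs)" using Cons.prems by (meson distinct.simps(2) in_set_takeD)
    have "(\<Sum>l\<in>set (take (Suc j') xs). differences g a (i # xs) l) = (\<Sum>l\<in>set (take (Suc j') xs). differences g (g i) xs l)"
      using i by (intro sum.cong) auto
    also have "\<dots> = g (xs ! j') - g i" using Cons Suc by simp
    finally show ?thesis using i Suc by simp
  qed simp
qed simp

lemma differences_rat: "(\<And>i. g i \<in> rat_vecs) \<Longrightarrow> a \<in> rat_vecs \<Longrightarrow> differences g a xs i \<in> rat_vecs"
  by (induction xs arbitrary: a) (auto intro: rat_vecs_arith)

text \<open>With one vertex moved to the origin, the other vertices are extended to a basis indexed
  by \<open>'n\<close>. Successive differences turn them into partial sums, which are the images of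
  the vertices of the chain simplex.\<close>

lemma simplex_coordinates:
  fixes W :: "(real ^ 'n) set"
  assumes "W \<subseteq> rat_vecs" "\<not> affine_dependent W" "card W = Suc m"
  obtains p f xs where "p \<in> rat_vecs" "rat_basis f" "distinct xs" "length xs = m"
    "convex hull W = (\<lambda>x. x + p) ` lin f ` std_chain xs"
proof -
  have fin: "finite W" using assms(2) by (rule aff_independent_finite)
  obtain ps where ps: "set ps = W" "distinct ps" using finite_distinct_list[OF fin] by blast
  have "length ps = Suc m" using ps assms(3) distinct_card by fastforce
  then obtain p qs where pq: "ps = p # qs" "length qs = m" by (cases ps) auto
  define bs where "bs = map (\<lambda>w. w - p) qs"
  have bs: "distinct bs" "length bs = m" using ps pq by (auto simp: bs_def distinct_map inj_on_def)
  have W: "W = insert p ((\<lambda>x. x + p) ` set bs)" using ps pq by (auto simp: bs_def image_image)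
  have pr: "p \<in> rat_vecs" using assms(1) W by auto
  have br: "set bs \<subseteq> rat_vecs" using assms(1) ps pq by (auto simp: bs_def intro!: rat_vecs_arith)
  have "(+) (- p) ` (W - {p}) = set bs" using ps pq by (auto simp: bs_def image_iff)
  then have ind: "independent (set bs)"
    using affine_dependent_iff_dependent2[of p W] assms(2) W by auto
  \<comment> \<open>Extending by unit vectors keeps the basis rational.\<close>
  let ?A = "set bs \<union> range (\<lambda>i. axis i 1)"
  obtain B where B: "set bs \<subseteq> B" "B \<subseteq> ?A" "independent B" "?A \<subseteq> span B"
    using maximal_independent_subset_extend[of "set bs" ?A, OF Un_upper1 ind] by blast
  have spB: "span B = UNIV"
  proof -
    have "lin (\<lambda>i. axis i 1) x \<in> span B" for x
      unfolding lin_def using B(4) by (intro span_sum span_scale) auto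
    moreover have "lin (\<lambda>i. axis i 1) x = x" for x :: "real ^ 'n"
      by (simp add: lin_def vec_eq_iff axis_def if_distrib[of "\<lambda>t. _ * t"] sum.delta cong: if_cong)
    ultimately show ?thesis by auto
  qed
  have "card B = CARD('n)"
    using dim_eq_card[of B UNIV] spB B(3) by simp
  moreover have finB: "finite B" using B(3) by (rule independent_imp_finite)
  ultimately obtain g where g: "bij_betw g (UNIV :: 'n set) B"
    using finite_same_card_bij[of "UNIV :: 'n set" B] by auto
  have "range (\<lambda>i. axis i 1) \<subseteq> (rat_vecs :: (real ^ 'n) set)" by (auto intro: rat_vecs_arith(6))
  then have Brat: "B \<subseteq> rat_vecs" using B(2) br by (meson Un_least order_trans)
  define xs where "xs = map (inv_into UNIV g) bs"
  have ginv: "g (inv_into UNIV g b) = b" if "b \<in> set bs" for b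
    using that B(1) g by (meson bij_betw_inv_into_right subsetD)
  have xs: "distinct xs" "length xs = m"
    using bs ginv by (auto simp: xs_def distinct_map inj_on_def) metis
  have gx: "g (xs ! j) = bs ! j" if "j < m" for j using that bs ginv by (simp add: xs_def)
  define f where "f = differences g 0 xs"
  have grat: "g i \<in> rat_vecs" for i using g Brat by (auto simp: bij_betw_def)
  have part: "sum f (set (take (Suc j) xs)) = bs ! j" if "j < m" for j
    using differences_sum[OF xs(1), of j g 0] gx that xs(2) by (simp add: f_def)
  have "g i \<in> span (range f)" for i
  proof (cases "i \<in> set xs")
    case True
    then obtain j where j: "j < m" "i = xs ! j" using xs(2) by (auto simp: in_set_conv_nth)
    have "sum f (set (take (Suc j) xs)) \<in> span (range f)" by (intro span_sum span_base) auto
    then show ?thesis using part[OF j(1)] gx[OF j(1)] j(2) by simp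
  next
    case False
    then have "f i = g i" by (simp add: f_def differences_other)
    then show ?thesis by (metis rangeI span_base)
  qed
  then have "range g \<subseteq> span (range f)" by auto
  then have "span (range g) \<subseteq> span (range f)" using span_minimal[OF _ subspace_span] by blast
  then have bf: "rat_basis f"
    using spB g differences_rat[OF grat rat_vecs_arith(1)] by (auto simp: rat_basis_def f_def bij_betw_def)
  have "lin f ` (\<lambda>j. indicator_vec (set (take j xs))) ` {..length xs} = insert 0 (set bs)"
  proof -
    have "lin f ` (\<lambda>j. indicator_vec (set (take j xs))) ` {..length xs} = (\<lambda>j. sum f (set (take j xs))) ` {..m}"
      by (simp add: image_image lin_indicator_vec xs(2))
    also have "{..m} = insert 0 (Suc ` {..<m})" by (auto simp: image_iff gr0_conv_Suc) (metis Suc_pred lessThan_iff not_gr_zero Suc_le_eq)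
    also have "(\<lambda>j. sum f (set (take j xs))) ` insert 0 (Suc ` {..<m}) = insert 0 ((\<lambda>j. sum f (set (take (Suc j) xs))) ` {..<m})"
      by (simp add: image_image)
    also have "(\<lambda>j. sum f (set (take (Suc j) xs))) ` {..<m} = (\<lambda>j. bs ! j) ` {..<m}"
      using part by (intro image_cong) auto
    also have "\<dots> = set bs" using bs(2) by (auto simp: set_conv_nth)
    finally show ?thesis .
  qed
  then have "lin f ` std_chain xs = convex hull (insert 0 (set bs))"
    unfolding std_chain_hull[OF xs(1)] convex_hull_linear_image[OF linear_lin] by (simp only:)
  moreover have "(\<lambda>x. x + p) ` (convex hull (insert 0 (set bs))) = convex hull ((\<lambda>x. x + p) ` insert 0 (set bs))"
    using convex_hull_translation[of p "insert 0 (set bs)"] by (simp add: add.commute)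
  ultimately have "convex hull W = (\<lambda>x. x + p) ` lin f ` std_chain xs"
    unfolding W by simp
  then show ?thesis using that pr bf xs by blast
qed

section \<open>Chain simplices under dilation\<close>

lemma choose_over_power_tendsto:
  assumes "e \<le> d"
  shows "(\<lambda>k. real (k choose e) / real k ^ d) \<longlonglongrightarrow> (if e = d then 1 / fact e else 0)"
proof -
  have 1: "(\<lambda>k. real (k choose e) / real k ^ e) \<longlonglongrightarrow> 1 / fact e"
  proof (induction e)
    case 0
    show ?case by simp
  next
    case (Suc e)
    have "(\<lambda>k. (real (k choose e) / real k ^ e) * ((1 - real e * inverse (real k)) / real (Suc e))) \<longlonglongrightarrow>
        (1 / fact e) * ((1 - real e * 0) / real (Suc e))"
      by (intro tendsto_intros Suc lim_inverse_n) auto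
    moreover have "\<forall>\<^sub>F k in sequentially. (real (k choose e) / real k ^ e) * ((1 - real e * inverse (real k)) / real (Suc e)) =
        real (k choose Suc e) / real k ^ Suc e"
      using eventually_ge_at_top[of "Suc e"]
    proof eventually_elim
      case (elim k)
      have "Suc e * (k choose Suc e) = (k - e) * (k choose e)"
        by (simp only: binomial_absorption binomial_absorb_comp)
      then have "real (Suc e) * real (k choose Suc e) = real (k - e) * real (k choose e)"
        by (simp only: of_nat_mult[symmetric])
      also have "real (k - e) = real k * (1 - real e * inverse (real k))"
        using elim by (simp add: field_simps of_nat_diff)
      finally have "real (k choose Suc e) = real k * (1 - real e * inverse (real k)) * real (k choose e) / real (Suc e)"
        by (simp add: field_simps)
      then show ?case using elim by (simp add: mult_ac)
    qed
    ultimately have "(\<lambda>k. real (k choose Suc e) / real k ^ Suc e) \<longlonglongrightarrow> (1 / fact e) * ((1 - real e * 0) / real (Suc e))"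
      by (rule Lim_transform_eventually)
    then show ?case by (simp add: field_simps)
  qed
  show ?thesis
  proof (cases "e = d")
    case False
    have "(\<lambda>k. real (k choose e) / real k ^ e * (inverse (real k)) ^ (d - e)) \<longlonglongrightarrow> (1 / fact e) * 0 ^ (d - e)"
      by (intro tendsto_intros 1 lim_inverse_n)
    moreover have "\<forall>\<^sub>F k in sequentially. real (k choose e) / real k ^ e * (inverse (real k)) ^ (d - e) = real (k choose e) / real k ^ d"
      using eventually_gt_at_top[of 0]
    proof eventually_elim
      case (elim k)
      have "real k ^ d = real k ^ e * real k ^ (d - e)" using assms by (simp flip: power_add)
      then show ?case by (simp add: power_inverse divide_inverse)
    qed
    ultimately have "(\<lambda>k. real (k choose e) / real k ^ d) \<longlonglongrightarrow> (1 / fact e) * 0 ^ (d - e)"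
      by (rule Lim_transform_eventually)
    moreover have "d - e > 0" using False assms by simp
    ultimately show ?thesis using False by (simp add: zero_power)
  qed (use 1 in simp)
qed

text \<open>The k-fold dilate of the simplex has k^d times its value, and by slicing this is a
  combination of the binomials C(k,e) with e \<le> m, where C(k,m) has the value of the box as
  coefficient. Dividing by k^d and letting \<open>k\<close> grow leaves that coefficient divided by
  m!, and only if m = d.\<close>

lemma hom_valuation_std_chain:
  fixes \<phi> :: "(real ^ 'n) set \<Rightarrow> real"
  assumes "hom_valuation d \<phi>" "vanishes m \<phi>" "distinct xs" "length xs = m" "m \<le> d"
  shows "\<phi> (std_chain xs) = (if m = d then \<phi> (coord_space (set xs) \<inter> coord_box 0 1 (set xs)) / fact m else 0)"
proof -
  let ?I = "set xs"
  have cI: "card ?I = m" using assms(3,4) distinct_card by fastforce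
  have val: "rat_valuation \<phi>" by (rule hom_valuation_rat_valuation[OF assms(1)])
  \<comment> \<open>Moved to x_i = 0, such a polytope lies in a coordinate subspace of dimension m -
    1, whose simplices have at most \<open>m\<close> vertices.\<close>
  have van: "\<phi> P = 0" if P: "P \<in> rat_polytopes" "i \<in> ?I" "P \<subseteq> {x. x $ i = 1}" "P \<subseteq> coord_space ?I" for P i
  proof -
    have ax: "axis i (- 1) \<in> rat_vecs" by (rule rat_vecs_arith) simp
    let ?P = "(\<lambda>x. x + axis i (- 1)) ` P"
    have "card (?I - {i}) + 1 = m" using card_Suc_Diff1[of ?I i] P(2) cI by simp
    moreover have "?P \<subseteq> {x. \<forall>j. j \<notin> ?I - {i} \<longrightarrow> x $ j = 0}"
    proof (clarify)
      fix z j assume z: "z \<in> P" "j \<notin> ?I - {i}"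
      have "z $ i = 1" "z \<in> coord_space ?I" using P(3,4) z(1) by blast+
      then show "(z + axis i (- 1)) $ j = 0" using z(2) by (cases "j = i") (auto simp: coord_space_def axis_def)
    qed
    ultimately have "\<phi> ?P = 0"
      using vanishes_rat_polytope[OF val, of "?I - {i}" ?P] assms(2) rat_polytope_translate[OF P(1) ax] by simp
    then show ?thesis using hom_valuation_translate[OF assms(1) P(1) ax] by simp
  qed
  obtain c where c: "\<And>k::nat. \<phi> (coord_space ?I \<inter> coord_box 0 (real k) ?I \<inter> descending xs) = (\<Sum>e\<le>m. c e * real (k choose e))"
    "c m = \<phi> (coord_space ?I \<inter> coord_box 0 1 ?I)"
  proof -
    have "\<exists>c. (\<forall>k::nat. \<phi> (coord_space ?I \<inter> coord_box 0 (real k) ?I \<inter> descending xs) = (\<Sum>e\<le>length xs. c e * real (k choose e)))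
      \<and> c (length xs) = \<phi> (coord_space ?I \<inter> coord_box 0 1 ?I)"
    proof (rule chain_binomial_expansion[OF val hom_valuation_translate[OF assms(1)] van rat_polyhedron_coord_space order_refl _ order_refl assms(3)])
      show "coord_space ?I \<subseteq> coord_box 0 1 (- ?I)" by (auto simp: coord_space_def coord_box_def)
      show "y \<in> coord_space ?I" if "x \<in> coord_space ?I" "\<And>i. i \<notin> ?I \<Longrightarrow> y $ i = x $ i" for x y :: "real ^ 'n"
        using that by (simp add: coord_space_def)
    qed
    then show ?thesis using that unfolding assms(4) by blast
  qed
  have std: "std_chain xs \<in> rat_polytopes"
    unfolding std_chain_hull[OF assms(3)] by (rule rat_polytopeI) (auto simp: indicator_vec_rat)
  have scaled: "real k ^ d * \<phi> (std_chain xs) = (\<Sum>e\<le>m. c e * real (k choose e))" if "k > 0" for k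
  proof -
    have "coord_space ?I \<inter> coord_box 0 (real k) ?I \<inter> descending xs = (\<lambda>x. real k *\<^sub>R x) ` std_chain xs"
    proof (intro equalityI subsetI)
      fix x assume x: "x \<in> coord_space ?I \<inter> coord_box 0 (real k) ?I \<inter> descending xs"
      have "sorted_wrt (\<lambda>i j. x $ j \<le> x $ i) xs" using x by (simp add: descending_def)
      then have "sorted_wrt (\<lambda>i j. ((1 / real k) *\<^sub>R x) $ j \<le> ((1 / real k) *\<^sub>R x) $ i) xs"
        by (rule sorted_wrt_mono_rel[rotated]) (use that in \<open>simp add: divide_right_mono\<close>)
      then have "(1 / real k) *\<^sub>R x \<in> std_chain xs"
        using x that by (auto simp: std_chain_def coord_space_def coord_box_def descending_def)
      then show "x \<in> (\<lambda>x. real k *\<^sub>R x) ` std_chain xs" using that by (intro image_eqI[of _ _ "(1 / real k) *\<^sub>R x"]) auto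
    next
      fix x assume "x \<in> (\<lambda>x. real k *\<^sub>R x) ` std_chain xs"
      then obtain y where y: "y \<in> std_chain xs" "x = real k *\<^sub>R y" by blast
      have "sorted_wrt (\<lambda>i j. y $ j \<le> y $ i) xs" using y(1) by (simp add: std_chain_def descending_def)
      then have "sorted_wrt (\<lambda>i j. x $ j \<le> x $ i) xs"
        by (rule sorted_wrt_mono_rel[rotated]) (use that y(2) in \<open>simp add: mult_left_mono\<close>)
      then show "x \<in> coord_space ?I \<inter> coord_box 0 (real k) ?I \<inter> descending xs"
        using y by (auto simp: std_chain_def coord_space_def coord_box_def descending_def mult_left_le)
    qed
    then show ?thesis using c(1)[of k] hom_valuation_scale[OF assms(1) std that] by simp
  qed
  have "(\<lambda>k. \<Sum>e\<le>m. c e * (real (k choose e) / real k ^ d)) \<longlonglongrightarrow> (\<Sum>e\<le>m. c e * (if e = d then 1 / fact e else 0))"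
    by (intro tendsto_intros choose_over_power_tendsto) (use assms(5) in auto)
  moreover have "\<forall>\<^sub>F k in sequentially. (\<Sum>e\<le>m. c e * (real (k choose e) / real k ^ d)) = \<phi> (std_chain xs)"
    using eventually_gt_at_top[of 0]
  proof eventually_elim
    case (elim k)
    have "(\<Sum>e\<le>m. c e * (real (k choose e) / real k ^ d)) = (\<Sum>e\<le>m. c e * real (k choose e)) / real k ^ d"
      by (simp add: sum_divide_distrib)
    then show ?case unfolding scaled[OF elim, symmetric] using elim by simp
  qed
  ultimately have "(\<lambda>k::nat. \<phi> (std_chain xs)) \<longlonglongrightarrow> (\<Sum>e\<le>m. c e * (if e = d then 1 / fact e else 0))"
    by (rule Lim_transform_eventually)
  then have "\<phi> (std_chain xs) = (\<Sum>e\<le>m. c e * (if e = d then 1 / fact e else 0))"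
    by (rule LIMSEQ_unique[OF tendsto_const])
  also have "\<dots> = (\<Sum>e\<le>m. if e = d then c d / fact d else 0)"
    by (intro sum.cong) auto
  also have "\<dots> = (if m = d then c d / fact d else 0)" using assms(5) by (simp add: sum.delta')
  finally show ?thesis using c(2) by auto
qed

text \<open>Induction on the number of vertices: N + 1 vertices span dimension N < d, and the limit
  in \<open>hom_valuation_std_chain\<close> is then zero.\<close>

lemma hom_valuation_vanishes:
  fixes \<phi> :: "(real ^ 'n) set \<Rightarrow> real"
  assumes "hom_valuation d \<phi>" "N \<le> d"
  shows "vanishes N \<phi>"
  using assms
proof (induction N arbitrary: \<phi>)
  case 0
  show ?case unfolding vanishes_def using hom_valuation_empty[OF 0(1)] aff_independent_finite by fastforce
next
  case (Suc N)
  show ?case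
    unfolding vanishes_def
  proof (intro allI impI)
    fix W :: "(real ^ 'n) set" assume W: "W \<subseteq> rat_vecs" "\<not> affine_dependent W" "card W \<le> Suc N"
    show "\<phi> (convex hull W) = 0"
    proof (cases "card W = Suc N")
      case True
      obtain p f xs where *: "p \<in> rat_vecs" "rat_basis f" "distinct xs" "length xs = N"
        "convex hull W = (\<lambda>x. x + p) ` lin f ` std_chain xs"
        using simplex_coordinates[OF W(1,2) True] by blast
      have nl: "hom_valuation d (\<lambda>P. \<phi> (lin f ` P))" by (rule hom_valuation_lin[OF Suc.prems(1) *(2)])
      have "vanishes N (\<lambda>P. \<phi> (lin f ` P))" by (rule Suc.IH[OF nl]) (use Suc.prems in simp)
      then have "\<phi> (lin f ` std_chain xs) = 0"
        using hom_valuation_std_chain[OF nl _ *(3,4)] Suc.prems(2) by simp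
      moreover have "std_chain xs \<in> rat_polytopes"
        unfolding std_chain_hull[OF *(3)] by (rule rat_polytopeI) (auto simp: indicator_vec_rat)
      then have "lin f ` std_chain xs \<in> rat_polytopes"
        by (rule rat_polytope_linear_image[OF _ linear_lin lin_rat_vecs[OF *(2)]])
      ultimately show ?thesis using hom_valuation_translate[OF Suc.prems(1) _ *(1)] *(5) by simp
    next
      case False
      then show ?thesis using Suc W by (simp add: vanishes_def)
    qed
  qed
qed

section \<open>Parallelepipeds\<close>

lemma unit_cube_box: "unit_cube = coord_box 0 1 UNIV"
  by (simp add: unit_cube_def coord_box_def)

lemma unit_cube_rat_polytope: "unit_cube \<in> rat_polytopes"
  unfolding unit_cube_box by (rule rat_polytope_in_box[OF rat_polyhedron_coord_box order_refl]) auto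

text \<open>Rationality comes from Cramer's rule: the coordinates are quotients of determinants with
  rational entries.\<close>

lemma rat_basis_coordinates:
  assumes "rat_basis f" "v \<in> rat_vecs"
  shows "\<exists>c. (\<forall>i. c i \<in> \<rat>) \<and> v = (\<Sum>i\<in>UNIV. c i *\<^sub>R f i)"
proof -
  let ?M = "matrix (lin f)"
  have det_rat: "det A \<in> \<rat>" if "\<And>i j. A $ i $ j \<in> \<rat>" for A :: "real ^ 'n ^ 'n"
  proof -
    have "prod (\<lambda>i. A $ i $ p i) I \<in> \<rat>" for p and I :: "'n set"
      using that by (induction I rule: infinite_finite_induct) auto
    then show ?thesis unfolding det_def by (intro Rats_sum Rats_mult Rats_of_int)
  qed
  have "surj (lin f)" using inj_lin[OF assms(1)] linear_lin linear_injective_imp_surjective by blast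
  then obtain x where x: "lin f x = v" by (metis surjD)
  have "det ?M \<noteq> 0" using inj_lin[OF assms(1)] det_nz_iff_inj[OF linear_lin] by blast
  moreover have "?M = (\<chi> i j. f j $ i)" by (simp add: matrix_def lin_axis)
  then have "?M *v x = v"
    unfolding x[symmetric] by (simp add: matrix_vector_mult_def lin_def vec_eq_iff mult.commute)
  ultimately have xe: "x = (\<chi> k. det (\<chi> i j. if j = k then v $ i else ?M $ i $ j) / det ?M)"
    using cramer by blast
  have M: "?M $ i $ j \<in> \<rat>" for i j
    using assms(1) by (simp add: matrix_def lin_axis rat_basis_def rat_vecs_def)
  have "x $ k \<in> \<rat>" for k
    unfolding xe using M assms(2) by (auto intro!: Rats_divide det_rat simp: rat_vecs_def)
  then show ?thesis using x by (intro exI[of _ "\<lambda>k. x $ k"]) (simp add: lin_def)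
qed

lemma rat_basis_update:
  assumes f: "rat_basis f" and a: "a \<in> \<rat>" "a \<noteq> 0" and v: "v \<in> rat_vecs" "v \<in> span (f ` (- {j}))"
  shows "rat_basis (f(j := a *\<^sub>R f j + v))"
proof -
  let ?g = "f(j := a *\<^sub>R f j + v)"
  have "f i \<in> span (range ?g)" for i
  proof (cases "i = j")
    case True
    have "f ` (- {j}) \<subseteq> range ?g" by (auto simp: image_iff)
    then have "v \<in> span (range ?g)" using v(2) span_mono by blast
    moreover have "?g j \<in> span (range ?g)" by (intro span_base) blast
    ultimately have "(1 / a) *\<^sub>R (?g j - v) \<in> span (range ?g)" by (intro span_scale span_diff)
    then show ?thesis using a True by simp
  next
    case False
    then have "f i = ?g i" by simp
    then show ?thesis by (metis rangeI span_base)
  qed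
  then have "range f \<subseteq> span (range ?g)" by blast
  then have "span (range f) \<subseteq> span (range ?g)" by (rule span_minimal[OF _ subspace_span])
  then show ?thesis using f a v(1) by (auto simp: rat_basis_def intro!: rat_vecs_arith)
qed

text \<open>Only vanishing is compared, since scaling a basis vector changes the value by a factor.
  The clause on \<open>g\<close> lets steps be chained.\<close>

definition cube_equiv :: "((real ^ 'n) set \<Rightarrow> real) \<Rightarrow> ('n \<Rightarrow> real ^ 'n) \<Rightarrow> ('n \<Rightarrow> real ^ 'n) \<Rightarrow> bool" where
  "cube_equiv \<phi> f g \<longleftrightarrow> rat_basis g \<and> (\<phi> (lin f ` unit_cube) = 0 \<longleftrightarrow> \<phi> (lin g ` unit_cube) = 0)"

lemma cube_equiv_trans: "cube_equiv \<phi> f g \<Longrightarrow> cube_equiv \<phi> g h \<Longrightarrow> cube_equiv \<phi> f h"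
  by (simp add: cube_equiv_def)

text \<open>The parallelepiped has n! times the value of a chain simplex, whatever the order of the
  coordinates. Parallelepipeds can thus be compared through simplices that are translates of each
  other.\<close>

lemma hom_valuation_full_chain:
  fixes \<phi> :: "(real ^ 'n) set \<Rightarrow> real"
  assumes "hom_valuation CARD('n) \<phi>" "rat_basis f" "distinct xs" "set xs = UNIV"
  shows "\<phi> (lin f ` std_chain xs) = \<phi> (lin f ` unit_cube) / fact CARD('n)"
proof -
  have len: "length xs = CARD('n)" using assms(3,4) distinct_card by fastforce
  have nl: "hom_valuation CARD('n) (\<lambda>P. \<phi> (lin f ` P))" by (rule hom_valuation_lin[OF assms(1,2)])
  show ?thesis
    using hom_valuation_std_chain[OF nl hom_valuation_vanishes[OF nl order_refl] assms(3) len order_refl] assms(4)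
    by (simp add: unit_cube_box coord_space_def)
qed

lemma lin_image_rat_polytope: "rat_basis f \<Longrightarrow> P \<in> rat_polytopes \<Longrightarrow> lin f ` P \<in> rat_polytopes"
  by (rule rat_polytope_linear_image[OF _ linear_lin lin_rat_vecs])

text \<open>Exchanging the first two vertices of a simplex changes its edge vectors by this rule.\<close>

lemma cube_equiv_swap_vertices:
  fixes \<phi> :: "(real ^ 'n) set \<Rightarrow> real"
  assumes n: "hom_valuation CARD('n) \<phi>" and f: "rat_basis f" and ij: "i \<noteq> j"
  shows "cube_equiv \<phi> f (f(i := - f i, j := f i + f j))"
proof -
  define g where "g = f(i := - f i, j := f i + f j)"
  have "rat_basis (f(i := (-1) *\<^sub>R f i + 0))" by (rule rat_basis_update[OF f]) (auto simp: rat_vecs_arith span_zero)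
  then have 1: "rat_basis (f(i := - f i))" by simp
  have "rat_basis ((f(i := - f i))(j := 1 *\<^sub>R (f(i := - f i)) j + f i))"
  proof (rule rat_basis_update[OF 1])
    have "- ((f(i := - f i)) i) \<in> span ((f(i := - f i)) ` (- {j}))"
      by (intro span_neg span_base imageI) (use ij in simp)
    then show "f i \<in> span ((f(i := - f i)) ` (- {j}))" by simp
  qed (use f in \<open>auto simp: rat_basis_def\<close>)
  then have g: "rat_basis g" using ij by (simp add: g_def add.commute)
  obtain ys where ys: "set ys = UNIV - {i, j}" "distinct ys" using finite_distinct_list[of "UNIV - {i, j}"] by auto
  define xs where "xs = i # j # ys"
  have xs: "distinct xs" "set xs = UNIV" using ys ij by (auto simp: xs_def)
  have V: "lin h ` std_chain xs = convex hull ((\<lambda>l. sum h (set (take l xs))) ` {..length xs})" for h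
    unfolding std_chain_hull[OF xs(1)] convex_hull_linear_image[OF linear_lin]
    by (simp add: image_image lin_indicator_vec)
  have idx: "{..length xs} = insert 0 (insert 1 ((\<lambda>l. Suc (Suc l)) ` {..length ys}))"
    by (simp add: xs_def atMost_Suc_eq_insert_0 image_image)
  have ni: "i \<notin> set (take l ys)" "j \<notin> set (take l ys)" for l
    using set_take_subset[of l ys] ys(1) by auto
  have s2: "sum h (set (take (Suc (Suc l)) xs)) = h i + (h j + sum h (set (take l ys)))" for h :: "'n \<Rightarrow> real ^ 'n" and l
    using ni[of l] ij by (simp add: xs_def)
  have rest: "sum g (set (take l ys)) = sum f (set (take l ys))" for l
  proof (intro sum.cong refl)
    fix x assume "x \<in> set (take l ys)"
    then have "x \<noteq> i" "x \<noteq> j" using ni[of l] by auto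
    then show "g x = f x" by (simp add: g_def)
  qed
  have gi: "g i = - f i" "g j = f i + f j" using ij by (auto simp: g_def)
  \<comment> \<open>For \<open>f\<close> the first vertices are 0, \<open>f i\<close>,
    \<open>f i + f j\<close>; for \<open>g\<close> they are 0, \<open>- f i\<close>,
    \<open>f j\<close>. Translation by \<open>f i\<close> exchanges the roles of the first two and
    matches all others.\<close>
  have "(+) (f i) ` ((\<lambda>l. sum g (set (take l xs))) ` {..length xs}) = (\<lambda>l. sum f (set (take l xs))) ` {..length xs}"
    unfolding idx image_insert image_image s2 rest gi by (simp add: xs_def gi insert_commute)
  then have "(+) (f i) ` (lin g ` std_chain xs) = lin f ` std_chain xs"
    unfolding V convex_hull_translation[symmetric] by simp
  moreover have "lin g ` std_chain xs \<in> rat_polytopes"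
    by (rule lin_image_rat_polytope[OF g]) (auto simp: std_chain_hull[OF xs(1)] indicator_vec_rat intro!: rat_polytopeI)
  then have "\<phi> ((+) (f i) ` (lin g ` std_chain xs)) = \<phi> (lin g ` std_chain xs)"
    using hom_valuation_translate[OF n, of "lin g ` std_chain xs" "f i"] f by (simp add: rat_basis_def add.commute)
  ultimately have "\<phi> (lin f ` std_chain xs) = \<phi> (lin g ` std_chain xs)" by simp
  then show ?thesis
    using hom_valuation_full_chain[OF n f xs] hom_valuation_full_chain[OF n g xs] g by (simp add: cube_equiv_def g_def)
qed

lemma lin_update: "lin (f(i := v)) x = lin f x + x $ i *\<^sub>R (v - f i)"
proof -
  have "lin h x = x $ i *\<^sub>R h i + (\<Sum>l\<in>UNIV - {i}. x $ l *\<^sub>R h l)" for h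
    unfolding lin_def by (rule sum.remove) auto
  from this[of f] this[of "f(i := v)"] show ?thesis by (simp add: algebra_simps)
qed

text \<open>The reflection x_i -> 1 - x_i preserves the cube, so the two parallelepipeds are
  translates of each other.\<close>

lemma cube_equiv_neg:
  fixes \<phi> :: "(real ^ 'n) set \<Rightarrow> real"
  assumes n: "hom_valuation CARD('n) \<phi>" and f: "rat_basis f"
  shows "cube_equiv \<phi> f (f(i := - f i))"
proof -
  let ?g = "f(i := - f i)"
  have "rat_basis (f(i := (-1) *\<^sub>R f i + 0))" by (rule rat_basis_update[OF f]) (auto simp: rat_vecs_arith span_zero)
  then have g: "rat_basis ?g" by simp
  let ?r = "\<lambda>x :: real ^ 'n. \<chi> l. if l = i then 1 - x $ i else x $ l"
  have r: "?r x \<in> unit_cube" if "x \<in> unit_cube" for x using that by (simp add: unit_cube_def)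
  have rr: "?r (?r x) = x" for x by (simp add: vec_eq_iff)
  have rx: "?r x = x + (1 - x $ i - x $ i) *\<^sub>R axis i 1" for x by (simp add: vec_eq_iff axis_def)
  have lr: "lin f (?r x) = lin ?g x + f i" for x
    unfolding rx lin_update linear_add[OF linear_lin] linear_scale[OF linear_lin] lin_axis
    by (simp add: vec_eq_iff algebra_simps)
  have im: "lin f ` unit_cube = (\<lambda>x. x + f i) ` lin ?g ` unit_cube"
  proof (intro equalityI subsetI)
    fix y assume "y \<in> lin f ` unit_cube"
    then obtain x where x: "x \<in> unit_cube" "y = lin f x" by blast
    then have "y = lin ?g (?r x) + f i" using lr[of "?r x"] rr by simp
    then show "y \<in> (\<lambda>x. x + f i) ` lin ?g ` unit_cube" using r[OF x(1)] by blast
  next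
    fix y assume "y \<in> (\<lambda>x. x + f i) ` lin ?g ` unit_cube"
    then obtain x where x: "x \<in> unit_cube" "y = lin ?g x + f i" by blast
    then show "y \<in> lin f ` unit_cube" using imageI[OF r[OF x(1)], of "lin f"] lr[of x] by simp
  qed
  have fi: "f i \<in> rat_vecs" using f unfolding rat_basis_def by blast
  have "\<phi> (lin f ` unit_cube) = \<phi> (lin ?g ` unit_cube)"
    unfolding im by (rule hom_valuation_translate[OF n lin_image_rat_polytope[OF g unit_cube_rat_polytope] fi])
  then show ?thesis using g by (simp add: cube_equiv_def)
qed

text \<open>The stretched cube is sliced along coordinate \<open>i\<close> only, so
  \<open>chain_binomial_expansion\<close> for a list of one element makes its value affine in
  \<open>k\<close>. At k = 0 the polytope is flat and the value zero; hence the value is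
  \<open>k\<close> times that of the cube.\<close>

lemma cube_equiv_scale_nat:
  fixes \<phi> :: "(real ^ 'n) set \<Rightarrow> real"
  assumes n: "hom_valuation CARD('n) \<phi>" and f: "rat_basis f" and k: "k > 0"
  shows "cube_equiv \<phi> f (f(i := real k *\<^sub>R f i))"
proof -
  let ?g = "f(i := real k *\<^sub>R f i)"
  have "rat_basis (f(i := real k *\<^sub>R f i + 0))"
    by (rule rat_basis_update[OF f]) (use k in \<open>auto simp: rat_vecs_arith span_zero\<close>)
  then have g: "rat_basis ?g" by simp
  define \<psi> where "\<psi> P = \<phi> (lin f ` P)" for P
  have \<psi>: "hom_valuation CARD('n) \<psi>" unfolding \<psi>_def by (rule hom_valuation_lin[OF n f])
  have val: "rat_valuation \<psi>" by (rule hom_valuation_rat_valuation[OF \<psi>])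
  have van0: "\<psi> P = 0" if "P \<in> rat_polytopes" "P \<subseteq> {x. x $ l = 0}" for P l
  proof (rule vanishes_rat_polytope[OF val _ that(1), of "UNIV - {l}"])
    have "card (UNIV - {l}) + 1 = CARD('n)" using card_Suc_Diff1[of UNIV l] by simp
    then show "vanishes (card (UNIV - {l}) + 1) \<psi>" using hom_valuation_vanishes[OF \<psi> order_refl] by simp
    show "P \<subseteq> {x. \<forall>i. i \<notin> UNIV - {l} \<longrightarrow> x $ i = 0}" using that(2) by auto
  qed
  have van: "\<psi> P = 0" if "P \<in> rat_polytopes" "l \<in> UNIV" "P \<subseteq> {x. x $ l = 1}" "P \<subseteq> coord_space UNIV" for P and l :: 'n
  proof -
    have ax: "axis l (- 1) \<in> rat_vecs" by (rule rat_vecs_arith(6)) simp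
    have "(\<lambda>x. x + axis l (- 1)) ` P \<subseteq> {x. x $ l = 0}" using that(3) by (auto simp: axis_def)
    then show ?thesis
      using van0[OF rat_polytope_translate[OF that(1) ax]] hom_valuation_translate[OF \<psi> that(1) ax] by simp
  qed
  let ?C = "coord_box 0 1 (- {i}) :: (real ^ 'n) set"
  obtain c where c: "\<And>k::nat. \<psi> (?C \<inter> coord_box 0 (real k) (set [i]) \<inter> descending [i]) = (\<Sum>e\<le>length [i]. c e * real (k choose e))"
    "c (length [i]) = \<psi> (?C \<inter> coord_box 0 1 (set [i]))"
  proof -
    have "\<exists>c. (\<forall>k::nat. \<psi> (?C \<inter> coord_box 0 (real k) (set [i]) \<inter> descending [i]) = (\<Sum>e\<le>length [i]. c e * real (k choose e)))
      \<and> c (length [i]) = \<psi> (?C \<inter> coord_box 0 1 (set [i]))"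
    proof (rule chain_binomial_expansion[OF val hom_valuation_translate[OF \<psi>] van])
      show "rat_polyhedron ?C" by (rule rat_polyhedron_coord_box) auto
      show "y \<in> ?C" if "x \<in> ?C" "\<And>l. l \<notin> set [i] \<Longrightarrow> y $ l = x $ l" for x y
        using that by (simp add: coord_box_def)
    qed (auto simp: coord_space_def)
    then show ?thesis using that by blast
  qed
  define Q where "Q k = ?C \<inter> coord_box 0 (real k) {i}" for k :: nat
  have d: "descending [i] = UNIV" by (simp add: descending_def)
  have Q: "\<psi> (Q k) = c 0 + c 1 * real k" for k
    using c(1)[of k] by (simp add: Q_def d)
  have Q1: "Q 1 = unit_cube" by (auto simp: Q_def unit_cube_box coord_box_def)
  have "Q 0 \<in> rat_polytopes"
  proof (rule rat_polytope_in_box)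
    show "rat_polyhedron (Q 0)" unfolding Q_def by (intro rat_polyhedron_Int rat_polyhedron_coord_box) auto
    show "Q 0 \<subseteq> coord_box 0 1 UNIV" by (auto simp: Q_def coord_box_def)
  qed
  then have "\<psi> (Q 0) = 0" by (rule van0[of _ i]) (auto simp: Q_def coord_box_def)
  then have Qk: "\<psi> (Q k) = real k * \<psi> unit_cube" for k using Q[of 0] Q[of 1] Q[of k] Q1 by simp
  have "lin ?g ` unit_cube = lin f ` Q k"
  proof -
    have lg: "lin ?g x = lin f (\<chi> l. if l = i then real k * x $ i else x $ l)" for x
    proof -
      have e: "(\<chi> l. if l = i then real k * x $ i else x $ l) = x + ((real k - 1) * x $ i) *\<^sub>R axis i 1"
        by (simp add: vec_eq_iff axis_def algebra_simps)
      show ?thesis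
        unfolding e lin_update linear_add[OF linear_lin] linear_scale[OF linear_lin] lin_axis
        by (simp add: vec_eq_iff algebra_simps)
    qed
    have "Q k = (\<lambda>x. \<chi> l. if l = i then real k * x $ i else x $ l) ` unit_cube"
    proof (intro equalityI subsetI)
      fix x assume x: "x \<in> Q k"
      let ?y = "\<chi> l. if l = i then x $ i / real k else x $ l"
      have "?y \<in> unit_cube" using x k by (auto simp: Q_def unit_cube_def coord_box_def)
      moreover have "x = (\<chi> l. if l = i then real k * ?y $ i else ?y $ l)" using k by (simp add: vec_eq_iff)
      ultimately show "x \<in> (\<lambda>x. \<chi> l. if l = i then real k * x $ i else x $ l) ` unit_cube" by blast
    next
      fix x assume "x \<in> (\<lambda>x. \<chi> l. if l = i then real k * x $ i else x $ l) ` unit_cube"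
      then show "x \<in> Q k" by (auto simp: Q_def unit_cube_def coord_box_def mult_left_le)
    qed
    then show ?thesis by (simp add: image_image lg)
  qed
  then have "\<phi> (lin ?g ` unit_cube) = real k * \<phi> (lin f ` unit_cube)" using Qk[of k] by (simp add: \<psi>_def)
  then show ?thesis using g k by (simp add: cube_equiv_def)
qed

lemma cube_equiv_scale:
  fixes \<phi> :: "(real ^ 'n) set \<Rightarrow> real"
  assumes n: "hom_valuation CARD('n) \<phi>" and f: "rat_basis f" and c: "c \<in> \<rat>" "c \<noteq> 0"
  shows "cube_equiv \<phi> f (f(i := c *\<^sub>R f i))"
proof -
  have pos: "cube_equiv \<phi> f (f(i := c *\<^sub>R f i))" if f: "rat_basis f" and c: "c \<in> \<rat>" "c > 0" for f c
  proof -
    obtain a b :: int where ab: "b > 0" "c = of_int a / of_int b"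
      using c(1) by (auto elim: Rats_cases')
    then have a: "a > 0" using c(2) by (simp add: zero_less_divide_iff)
    let ?g = "f(i := c *\<^sub>R f i)"
    have "rat_basis (f(i := c *\<^sub>R f i + 0))"
      by (rule rat_basis_update[OF f]) (use c in \<open>auto simp: rat_vecs_arith span_zero\<close>)
    then have g: "rat_basis ?g" by simp
    \<comment> \<open>For c = a / b, stretching \<open>f i\<close> by \<open>a\<close> and
      \<open>?g i\<close> by \<open>b\<close> leads to the same basis.\<close>
    have "?g(i := real (nat b) *\<^sub>R ?g i) = f(i := real (nat a) *\<^sub>R f i)" using ab a by (simp add: fun_eq_iff)
    then show ?thesis
      using cube_equiv_scale_nat[OF n g, of "nat b" i] cube_equiv_scale_nat[OF n f, of "nat a" i] ab(1) a g
      by (simp add: cube_equiv_def)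
  qed
  show ?thesis
  proof (cases "c > 0")
    case True
    then show ?thesis using pos[OF f c(1)] by simp
  next
    case False
    have "cube_equiv \<phi> f (f(i := - f i))" by (rule cube_equiv_neg[OF n f])
    moreover from this have "rat_basis (f(i := - f i))" by (simp add: cube_equiv_def)
    from pos[OF this, of "- c"] have "cube_equiv \<phi> (f(i := - f i)) (f(i := c *\<^sub>R f i))" using False c by simp
    ultimately show ?thesis by (rule cube_equiv_trans)
  qed
qed

lemma cube_equiv_basis: "cube_equiv \<phi> f g \<Longrightarrow> rat_basis g"
  by (simp add: cube_equiv_def)

text \<open>Exchanging two vertices and then changing a sign adds \<open>f i\<close> to
  \<open>f j\<close>; conjugating with a scaling of \<open>f i\<close> by \<open>c\<close> adds the
  multiple instead.\<close>

lemma cube_equiv_shear: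
  fixes \<phi> :: "(real ^ 'n) set \<Rightarrow> real"
  assumes n: "hom_valuation CARD('n) \<phi>" and f: "rat_basis f" and ij: "i \<noteq> j" and c: "c \<in> \<rat>"
  shows "cube_equiv \<phi> f (f(j := f j + c *\<^sub>R f i))"
proof (cases "c = 0")
  case True
  then show ?thesis using f by (simp add: cube_equiv_def)
next
  case False
  have add: "cube_equiv \<phi> f (f(j := f j + f i))" if f: "rat_basis f" for f
  proof -
    let ?g = "f(i := - f i, j := f i + f j)"
    have 1: "cube_equiv \<phi> f ?g" by (rule cube_equiv_swap_vertices[OF n f ij])
    have "?g(i := - ?g i) = f(j := f j + f i)" using ij by (auto simp: fun_eq_iff)
    then show ?thesis using cube_equiv_trans[OF 1] cube_equiv_neg[OF n cube_equiv_basis[OF 1], of i] by simp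
  qed
  let ?f1 = "f(i := c *\<^sub>R f i)"
  have 1: "cube_equiv \<phi> f ?f1" by (rule cube_equiv_scale[OF n f c False])
  let ?f2 = "?f1(j := ?f1 j + ?f1 i)"
  have 2: "cube_equiv \<phi> ?f1 ?f2" by (rule add[OF cube_equiv_basis[OF 1]])
  let ?f3 = "?f2(i := (1 / c) *\<^sub>R ?f2 i)"
  have 3: "cube_equiv \<phi> ?f2 ?f3" by (rule cube_equiv_scale[OF n cube_equiv_basis[OF 2]]) (use c False in auto)
  have "?f3 = f(j := f j + c *\<^sub>R f i)" using ij False by (auto simp: fun_eq_iff)
  then show ?thesis using cube_equiv_trans[OF 1 cube_equiv_trans[OF 2 3]] by simp
qed

lemma cube_equiv_combination:
  fixes \<phi> :: "(real ^ 'n) set \<Rightarrow> real"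
  assumes n: "hom_valuation CARD('n) \<phi>" and f: "rat_basis f" and L: "finite L" "j \<notin> L" and c: "\<And>l. c l \<in> \<rat>"
  shows "cube_equiv \<phi> f (f(j := f j + (\<Sum>l\<in>L. c l *\<^sub>R f l)))"
  using L
proof (induction L rule: finite_induct)
  case empty
  show ?case using f by (simp add: cube_equiv_def)
next
  case (insert i L)
  let ?g = "f(j := f j + (\<Sum>l\<in>L. c l *\<^sub>R f l))"
  have 1: "cube_equiv \<phi> f ?g" by (rule insert.IH) (use insert.prems in simp)
  have 2: "cube_equiv \<phi> ?g (?g(j := ?g j + c i *\<^sub>R ?g i))"
    by (rule cube_equiv_shear[OF n cube_equiv_basis[OF 1] _ c]) (use insert in auto)
  have eq: "?g(j := ?g j + c i *\<^sub>R ?g i) = f(j := f j + (\<Sum>l\<in>insert i L. c l *\<^sub>R f l))"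
    using insert by (auto simp: fun_eq_iff add_ac)
  show ?case unfolding eq[symmetric] by (rule cube_equiv_trans[OF 1 2])
qed

text \<open>Steinitz exchange: the basis is turned into the standard one, one vector at a time.\<close>

lemma cube_equiv_standard:
  fixes \<phi> :: "(real ^ 'n) set \<Rightarrow> real"
  assumes n: "hom_valuation CARD('n) \<phi>" and "finite J" "rat_basis f" "\<forall>l. l \<notin> J \<longrightarrow> f l = axis l 1"
  shows "cube_equiv \<phi> f (\<lambda>l. axis l 1)"
  using assms(2-)
proof (induction J arbitrary: f rule: finite_induct)
  case empty
  then have "f = (\<lambda>l. axis l 1)" by auto
  then show ?case using empty by (simp add: cube_equiv_def)
next
  case (insert i J)
  note f = insert.prems(1)
  have ax: "axis i 1 \<in> (rat_vecs :: (real ^ 'n) set)" by (rule rat_vecs_arith(6)) simp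
  obtain c where c: "\<And>l. c l \<in> \<rat>" "axis i 1 = (\<Sum>l\<in>UNIV. c l *\<^sub>R f l)"
    using rat_basis_coordinates[OF f ax] by blast
  have "\<exists>g c. cube_equiv \<phi> f g \<and> (\<forall>l. l \<notin> insert i J \<longrightarrow> g l = axis l 1) \<and> (\<forall>l. c l \<in> \<rat>) \<and> c i \<noteq> 0 \<and>
      axis i 1 = (\<Sum>l\<in>UNIV. c l *\<^sub>R g l)"
  proof (cases "c i = 0")
    case False
    then show ?thesis using c insert.prems by (intro exI[of _ f] exI[of _ c]) (simp add: cube_equiv_def)
  next
    case True
    \<comment> \<open>Otherwise the unit vector at \<open>i\<close> would be a combination of other
      unit vectors, which have entry zero at \<open>i\<close>.\<close>
    have "\<exists>j\<in>J. c j \<noteq> 0"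
    proof (rule ccontr)
      assume "\<not> (\<exists>j\<in>J. c j \<noteq> 0)"
      then have z: "c l *\<^sub>R f l = c l *\<^sub>R axis l 1 \<and> (l = i \<longrightarrow> c l = 0)" for l
        using True insert.prems(2) by (cases "l \<in> insert i J") auto
      have "axis i 1 = (\<Sum>l\<in>UNIV. c l *\<^sub>R axis l (1::real))" unfolding c(2) using z by (intro sum.cong) auto
      then have "axis i 1 $ i = (\<Sum>l\<in>UNIV. c l *\<^sub>R axis l (1::real)) $ i" by simp
      also have "\<dots> = 0" using z by (auto simp: axis_def intro!: sum.neutral)
      finally show False by (simp add: axis_def)
    qed
    then obtain j where j: "j \<in> J" "c j \<noteq> 0" by blast
    have ij: "i \<noteq> j" using j insert.hyps by auto
    \<comment> \<open>Replacing \<open>f j\<close> by \<open>f j - f i\<close> changes the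
      coefficient at \<open>i\<close> from zero to \<open>c j\<close>.\<close>
    let ?g = "f(j := f j + (-1) *\<^sub>R f i)"
    let ?c = "c(i := c j)"
    have 1: "cube_equiv \<phi> f ?g" by (rule cube_equiv_shear[OF n f ij]) simp
    have rem: "sum h UNIV = h i + (h j + sum h (UNIV - {i} - {j}))" for h :: "'n \<Rightarrow> real ^ 'n"
      using ij by (simp add: sum.remove[of UNIV i] sum.remove[of "UNIV - {i}" j])
    have "(\<Sum>l\<in>UNIV - {i} - {j}. ?c l *\<^sub>R ?g l) = (\<Sum>l\<in>UNIV - {i} - {j}. c l *\<^sub>R f l)"
      by (intro sum.cong) auto
    then have "(\<Sum>l\<in>UNIV. ?c l *\<^sub>R ?g l) = (\<Sum>l\<in>UNIV. c l *\<^sub>R f l)"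
      using ij True unfolding rem[of "\<lambda>l. ?c l *\<^sub>R ?g l"] rem[of "\<lambda>l. c l *\<^sub>R f l"] by (simp add: algebra_simps)
    then show ?thesis using 1 c j insert.prems(2) ij
      by (intro exI[of _ ?g] exI[of _ ?c]) auto
  qed
  then obtain g c where g: "cube_equiv \<phi> f g" "\<forall>l. l \<notin> insert i J \<longrightarrow> g l = axis l 1" "\<And>l. c l \<in> \<rat>" "c i \<noteq> 0"
    "axis i 1 = (\<Sum>l\<in>UNIV. c l *\<^sub>R g l)" by blast
  \<comment> \<open>The vector at \<open>i\<close> is built up to the whole combination, first its
    own term by scaling, then the others by shears.\<close>
  let ?g1 = "g(i := c i *\<^sub>R g i)"
  have 1: "cube_equiv \<phi> g ?g1" by (rule cube_equiv_scale[OF n cube_equiv_basis[OF g(1)] g(3,4)])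
  let ?g2 = "?g1(i := ?g1 i + (\<Sum>l\<in>UNIV - {i}. c l *\<^sub>R ?g1 l))"
  have 2: "cube_equiv \<phi> ?g1 ?g2"
    by (rule cube_equiv_combination[OF n cube_equiv_basis[OF 1] _ _ g(3)]) auto
  have "?g1 i + (\<Sum>l\<in>UNIV - {i}. c l *\<^sub>R ?g1 l) = axis i 1"
  proof -
    have "(\<Sum>l\<in>UNIV - {i}. c l *\<^sub>R ?g1 l) = (\<Sum>l\<in>UNIV - {i}. c l *\<^sub>R g l)"
      by (intro sum.cong) auto
    then show ?thesis unfolding g(5) by (simp add: sum.remove[of UNIV i])
  qed
  then have "\<forall>l. l \<notin> J \<longrightarrow> ?g2 l = axis l 1" using g(2) by auto
  then have "cube_equiv \<phi> ?g2 (\<lambda>l. axis l 1)"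
    by (rule insert.IH[OF cube_equiv_basis[OF 2]])
  then show ?case using cube_equiv_trans[OF g(1) cube_equiv_trans[OF 1 cube_equiv_trans[OF 2]]] by blast
qed

text \<open>For d > n the degree alone covers simplices with n + 1 vertices. For d = n their value
  is a multiple of that of a parallelepiped, which vanishes along with the cube.\<close>

lemma hom_valuation_zero:
  fixes \<phi> :: "(real ^ 'n) set \<Rightarrow> real"
  assumes n: "hom_valuation d \<phi>" and d: "d > CARD('n) \<or> d = CARD('n) \<and> \<phi> unit_cube = 0" and P: "P \<in> rat_polytopes"
  shows "\<phi> P = 0"
proof (rule vanishes_rat_polytope[OF hom_valuation_rat_valuation[OF n] _ P, of UNIV])
  show "vanishes (CARD('n) + 1) \<phi>"
  proof (cases "d > CARD('n)")
    case True
    then show ?thesis by (intro hom_valuation_vanishes[OF n]) simp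
  next
    case False
    then have d: "d = CARD('n)" "\<phi> unit_cube = 0" using d by auto
    note n = n[unfolded d(1)]
    show ?thesis
      unfolding vanishes_def
    proof (intro allI impI)
      fix W :: "(real ^ 'n) set" assume W: "W \<subseteq> rat_vecs" "\<not> affine_dependent W" "card W \<le> CARD('n) + 1"
      show "\<phi> (convex hull W) = 0"
      proof (cases "card W = Suc CARD('n)")
        case True
        obtain p f xs where *: "p \<in> rat_vecs" "rat_basis f" "distinct xs" "length xs = CARD('n)"
          "convex hull W = (\<lambda>x. x + p) ` lin f ` std_chain xs"
          using simplex_coordinates[OF W(1,2) True] by blast
        have "card (set xs) = CARD('n)" using *(3,4) distinct_card by fastforce
        then have xs: "set xs = UNIV" by (intro card_subset_eq) auto
        have "cube_equiv \<phi> f (\<lambda>l. axis l 1)" by (rule cube_equiv_standard[OF n finite *(2), of UNIV]) simp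
        moreover have "lin (\<lambda>l. axis l 1) x = x" for x :: "real ^ 'n"
          by (simp add: lin_def vec_eq_iff axis_def if_distrib[of "\<lambda>t. _ * t"] sum.delta cong: if_cong)
        ultimately have "\<phi> (lin f ` unit_cube) = 0" using d(2) by (simp add: cube_equiv_def)
        then have "\<phi> (lin f ` std_chain xs) = 0" using hom_valuation_full_chain[OF n *(2,3) xs] by simp
        moreover have "lin f ` std_chain xs \<in> rat_polytopes"
          by (rule lin_image_rat_polytope[OF *(2)]) (auto simp: std_chain_hull[OF *(3)] indicator_vec_rat intro!: rat_polytopeI)
        ultimately show ?thesis using hom_valuation_translate[OF n _ *(1)] *(5) by simp
      next
        case False
        then show ?thesis using hom_valuation_vanishes[OF n order_refl] W by (simp add: vanishes_def)
      qed
    qed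
  qed
qed simp

section \<open>Translation covariant valuations\<close>

definition fill_slots :: "nat set \<Rightarrow> 'v \<Rightarrow> (nat \<Rightarrow> 'v) \<Rightarrow> nat \<Rightarrow> 'v" where
  "fill_slots I u x = (\<lambda>i. if i \<in> I then u else x i)"

lemma sym_tensor_locality: "A \<in> sym_tensors r \<Longrightarrow> (\<And>i. i < r \<Longrightarrow> v i = w i) \<Longrightarrow> A v = A w"
  and sym_tensor_linear: "A \<in> sym_tensors r \<Longrightarrow> i < r \<Longrightarrow> linear (\<lambda>x. A (v(i := x)))"
  and sym_tensor_permute: "A \<in> sym_tensors r \<Longrightarrow> \<sigma> permutes {..<r} \<Longrightarrow> A (v \<circ> \<sigma>) = A v"
  unfolding sym_tensors_def by blast+

text \<open>Multilinearity gives a polynomial in \<open>t\<close>; its linear coefficient is the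
  derivative at 0, which by the product rule replaces \<open>u\<close> by \<open>w\<close> in one
  slot at a time.\<close>

lemma sym_tensor_line:
  fixes A :: "'n::finite tensor"
  assumes A: "A \<in> sym_tensors r" and I: "finite I" "I \<subseteq> {..<r}"
  shows "\<exists>p. (\<forall>t. A (fill_slots I (u + t *\<^sub>R w) x) = poly p t) \<and> coeff p 0 = A (fill_slots I u x) \<and>
    coeff p 1 = (\<Sum>l\<in>I. A ((fill_slots I u x)(l := w)))"
  using I
proof (induction I arbitrary: x rule: finite_induct)
  case empty
  show ?case by (intro exI[of _ "[:A x:]"]) (simp add: fill_slots_def)
next
  case (insert i I)
  have ov: "fill_slots (insert i I) a y = (fill_slots I a y)(i := a)"
    "fill_slots I a (y(i := b)) = (fill_slots I a y)(i := b)" for a b :: "real ^ 'n" and y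
    using insert.hyps by (auto simp: fill_slots_def)
  have Ir: "I \<subseteq> {..<r}" using insert.prems by simp
  from insert.IH[OF Ir, of "x(i := u)"] obtain p where p: "\<forall>t. A (fill_slots I (u + t *\<^sub>R w) (x(i := u))) = poly p t"
    "coeff p 0 = A (fill_slots I u (x(i := u)))"
    "coeff p 1 = (\<Sum>l\<in>I. A ((fill_slots I u (x(i := u)))(l := w)))"
    by (elim exE conjE)
  from insert.IH[OF Ir, of "x(i := w)"] obtain q where q: "\<forall>t. A (fill_slots I (u + t *\<^sub>R w) (x(i := w))) = poly q t"
    "coeff q 0 = A (fill_slots I u (x(i := w)))"
    by (elim exE conjE)
  have lin: "linear (\<lambda>y. A (v(i := y)))" for v using insert.prems by (intro sym_tensor_linear[OF A]) auto
  \<comment> \<open>The new slot splits linearly into \<open>u\<close> and \<open>t\<close> times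
    \<open>w\<close>, which gives the polynomial p + t q.\<close>
  have 1: "A (fill_slots (insert i I) (u + t *\<^sub>R w) x) = poly (p + pCons 0 q) t" for t
    using p(1)[rule_format, of t] q(1)[rule_format, of t] unfolding ov linear_add[OF lin] linear_scale[OF lin] by simp
  have 2: "coeff (p + pCons 0 q) 0 = A (fill_slots (insert i I) u x)"
    using p(2) unfolding ov by simp
  have "(\<Sum>l\<in>I. A ((fill_slots (insert i I) u x)(l := w))) = (\<Sum>l\<in>I. A ((fill_slots I u (x(i := u)))(l := w)))"
    by (intro sum.cong refl) (simp only: ov)
  then have 3: "coeff (p + pCons 0 q) 1 = (\<Sum>l\<in>insert i I. A ((fill_slots (insert i I) u x)(l := w)))"
    using p(3) q(2) insert.hyps by (simp add: ov(1)) (simp add: ov)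
  show ?case using 1 2 3 by (intro exI[of _ "p + pCons 0 q"]) blast
qed

text \<open>Differentiating along a line of diagonal arguments frees the slots one at a time.\<close>

lemma sym_tensor_polarization:
  fixes A :: "'n::finite tensor"
  assumes A: "A \<in> sym_tensors r" and diag: "\<And>u. A (\<lambda>_. u) = 0"
  shows "A v = 0"
proof -
  \<comment> \<open>The first \<open>m\<close> slots are free, the others still share the argument
    \<open>u\<close>.\<close>
  have "\<forall>(v :: nat \<Rightarrow> real ^ 'n) u. A (fill_slots {m..<r} u v) = 0" if "m \<le> r" for m
    using that
  proof (induction m)
    case 0
    have "A (fill_slots {0..<r} u v) = A (\<lambda>_. u)" for u v
      by (rule sym_tensor_locality[OF A]) (simp add: fill_slots_def)
    then show ?case using diag by simp
  next
    case (Suc m)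
    show ?case
    proof (intro allI)
      fix v :: "nat \<Rightarrow> real ^ 'n" and u :: "real ^ 'n"
      let ?I = "{m..<r}" and ?w = "v m"
      have "?I \<subseteq> {..<r}" by auto
      from sym_tensor_line[OF A finite_atLeastLessThan this, of u ?w v] obtain p where
        p: "\<forall>t. A (fill_slots ?I (u + t *\<^sub>R ?w) v) = poly p t" "coeff p 0 = A (fill_slots ?I u v)"
        "coeff p 1 = (\<Sum>l\<in>?I. A ((fill_slots ?I u v)(l := ?w)))"
        by (elim exE conjE)
      have "poly p t = 0" for t using p(1)[rule_format, of t] Suc by simp
      then have "p = 0" using poly_all_0_iff_0 by blast
      then have s: "(\<Sum>l\<in>?I. A ((fill_slots ?I u v)(l := ?w))) = 0" using p(3) by simp
      \<comment> \<open>By symmetry the r - m terms of the derivative agree, so each of them is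
        zero.\<close>
      have sym: "A ((fill_slots ?I u v)(l := ?w)) = A ((fill_slots ?I u v)(m := ?w))" if l: "l \<in> ?I" for l
      proof -
        let ?\<sigma> = "Transposition.transpose m l"
        have "?\<sigma> permutes {..<r}" using l by (intro permutes_swap_id) auto
        then have "A ((fill_slots ?I u v)(l := ?w) \<circ> ?\<sigma>) = A ((fill_slots ?I u v)(l := ?w))"
          by (rule sym_tensor_permute[OF A])
        moreover have "(fill_slots ?I u v)(l := ?w) \<circ> ?\<sigma> = (fill_slots ?I u v)(m := ?w)"
          using l by (auto simp: fun_eq_iff fill_slots_def Transposition.transpose_def)
        ultimately show ?thesis by simp
      qed
      have "(\<Sum>l\<in>?I. A ((fill_slots ?I u v)(l := ?w))) = (\<Sum>l\<in>?I. A ((fill_slots ?I u v)(m := ?w)))"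
        by (intro sum.cong refl sym)
      then have "real (card ?I) * A ((fill_slots ?I u v)(m := ?w)) = 0" using s by simp
      then have "A ((fill_slots ?I u v)(m := ?w)) = 0" using Suc.prems by simp
      moreover have "(fill_slots ?I u v)(m := ?w) = fill_slots {Suc m..<r} u v"
        by (auto simp: fun_eq_iff fill_slots_def)
      ultimately show "A (fill_slots {Suc m..<r} u v) = 0" by simp
    qed
  qed
  from this[of r] show ?thesis by (simp add: fill_slots_def)
qed

section \<open>Covariant valuations of top degree\<close>

lemma unit_cube_lattice: "unit_cube \<in> (lattice_polytopes :: (real ^ 'n) set set)"
proof -
  let ?V = "{x :: real ^ 'n. \<forall>i\<in>Basis. x \<bullet> i = 0 \<or> x \<bullet> i = 1}"
  have V: "x \<in> ?V \<longleftrightarrow> (\<forall>i. x $ i = 0 \<or> x $ i = 1)" for x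
    by (auto simp: Basis_vec_def inner_axis)
  have "unit_cube = cbox 0 (One :: real ^ 'n)"
  proof -
    have "x \<in> cbox 0 One \<longleftrightarrow> (\<forall>b\<in>Basis. 0 \<le> x \<bullet> b \<and> x \<bullet> b \<le> 1)" for x :: "real ^ 'n"
      by (simp add: mem_box)
    also have "(\<forall>b\<in>Basis. 0 \<le> x \<bullet> b \<and> x \<bullet> b \<le> 1) \<longleftrightarrow> x \<in> unit_cube" for x :: "real ^ 'n"
      by (auto simp: unit_cube_def Basis_vec_def inner_axis)
    finally show ?thesis by blast
  qed
  then have "unit_cube = convex hull ?V" using unit_interval_convex_hull[where 'a = "real ^ 'n"] by simp
  moreover have "?V \<subseteq> int_lattice"
  proof
    fix x assume "x \<in> ?V"
    then have "x $ i = 0 \<or> x $ i = 1" for i using V by blast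
    then have "x $ i \<in> \<int>" for i by (metis Ints_0 Ints_1)
    then show "x \<in> int_lattice" by (simp add: int_lattice_def)
  qed
  moreover have "finite ?V"
  proof (rule finite_subset)
    show "?V \<subseteq> unit_cube \<inter> int_lattice"
    proof
      fix x assume x: "x \<in> ?V"
      then have "x $ i = 0 \<or> x $ i = 1" for i using V by blast
      then have "0 \<le> x $ i \<and> x $ i \<le> 1" for i by (metis order_refl zero_le_one)
      then show "x \<in> unit_cube \<inter> int_lattice" using \<open>?V \<subseteq> int_lattice\<close> x by (auto simp: unit_cube_def)
    qed
    show "finite (unit_cube \<inter> int_lattice :: (real ^ 'n) set)"
      unfolding unit_cube_box by (rule finite_bounded_int_lattice[OF bounded_coord_box])
  qed
  ultimately show ?thesis unfolding lattice_polytopes_iff by (intro exI[of _ ?V] conjI)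
qed

text \<open>In the application \<open>z\<close> is a tensor valuation at a fixed diagonal argument
  \<open>u\<close>, and \<open>a j\<close> is its associated function of rank \<open>r - j\<close>
  divided by j!. The coefficient of the highest surviving power is translation invariant, hence zero
  by \<open>hom_valuation_zero\<close>; then the next one becomes the highest.\<close>

lemma covariant_valuation_zero:
  fixes z :: "(real ^ 'n) set \<Rightarrow> real" and a :: "nat \<Rightarrow> (real ^ 'n) set \<Rightarrow> real"
  assumes empty: "z {} = 0"
    and val: "\<And>P Q. P \<in> lattice_polytopes \<Longrightarrow> Q \<in> lattice_polytopes \<Longrightarrow> P \<union> Q \<in> lattice_polytopes \<Longrightarrow>
       P \<inter> Q \<in> lattice_polytopes \<Longrightarrow> z P + z Q = z (P \<union> Q) + z (P \<inter> Q)"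
    and hom: "\<And>P k. P \<in> lattice_polytopes \<Longrightarrow> k > 0 \<Longrightarrow> z ((\<lambda>x. real k *\<^sub>R x) ` P) = real k ^ (CARD('n) + r) * z P"
    and cov: "\<And>P y. P \<in> lattice_polytopes \<Longrightarrow> y \<in> int_lattice \<Longrightarrow> z ((\<lambda>x. x + y) ` P) = (\<Sum>j\<le>r. a j P * (y \<bullet> u) ^ j)"
    and u: "u \<noteq> 0" and cube: "a r unit_cube = 0"
    and P: "P \<in> lattice_polytopes"
  shows "z P = 0"
proof -
  obtain i where i: "u $ i \<noteq> 0" using u by (auto simp: vec_eq_iff)
  define s where "s = u $ i"
  \<comment> \<open>Multiples of one unit vector not orthogonal to \<open>u\<close> are enough to
    read off coefficients: the values of \<open>z\<close> become a polynomial in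
    \<open>k\<close>.\<close>
  define e where "e k = axis i (real k)" for k :: nat
  have e: "e k \<in> int_lattice" "e k \<bullet> u = real k * s" for k
  proof -
    show "e k \<in> int_lattice" by (simp add: e_def int_lattice_def axis_def)
    show "e k \<bullet> u = real k * s" by (simp add: e_def s_def inner_axis')
  qed
  have s: "s \<noteq> 0" using i by (simp add: s_def)
  have "\<forall>P\<in>lattice_polytopes. \<forall>j\<le>r. r < j + m \<longrightarrow> a j P = 0" if "m \<le> Suc r" for m
    using that
  proof (induction m)
    case (Suc m)
    define q where "q = r - m"
    have q: "q \<le> r" "q + m = r" using Suc.prems by (auto simp: q_def)
    have van: "a j P = 0" if "P \<in> lattice_polytopes" "j \<le> r" "q < j" for P j
      using Suc that q by auto
    have cov': "z ((\<lambda>x. x + y) ` P) = (\<Sum>j\<le>q. a j P * (y \<bullet> u) ^ j)"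
      if "P \<in> lattice_polytopes" "y \<in> int_lattice" for P y
      unfolding cov[OF that] using van[OF that(1)] q by (intro sum.mono_neutral_right) auto
    \<comment> \<open>For \<open>b = y \<bullet> u\<close> this is the value of \<open>z\<close> on
      P translated by \<open>y + e k\<close>, as a polynomial in \<open>k\<close>. Its leading
      coefficient does not depend on \<open>b\<close>, which is the translation invariance of
      \<open>a q\<close>.\<close>
    define p where "p P b = (\<Sum>j\<le>q. smult (a j P) ([:b, s:] ^ j))" for P and b :: real
    have p: "poly (p P (y \<bullet> u)) (real k) = z ((\<lambda>x. x + (y + e k)) ` P)"
      if "P \<in> lattice_polytopes" "y \<in> int_lattice" for P y k
      using cov'[OF that(1), of "y + e k"] that(2) e[of k]
      by (simp add: p_def poly_sum int_lattice_arith inner_add_left)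
    have p0: "poly (p P 0) (real k) = z ((\<lambda>x. x + e k) ` P)" if "P \<in> lattice_polytopes" for P k
      using p[OF that int_lattice_arith(1), of k] by simp
    have coeff: "coeff (p P b) q = a q P * s ^ q" for P b
    proof -
      have "coeff ([:b, s:] ^ j) q = (if j = q then s ^ q else 0)" if "j \<le> q" for j
      proof (cases "j = q")
        case True
        then show ?thesis by (simp add: coeff_linear_poly_power)
      next
        case False
        then have "degree ([:b, s:] ^ j) < q" using that s by (simp add: degree_power_eq)
        then show ?thesis using False by (simp add: coeff_eq_0)
      qed
      then have "coeff (p P b) q = (\<Sum>j\<le>q. if j = q then a q P * s ^ q else 0)"
        unfolding p_def coeff_sum by (intro sum.cong) auto
      then show ?thesis by simp
    qed
    have sq: "s ^ q \<noteq> 0" using s by simp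
    have aq_empty: "a q {} = 0"
    proof -
      have "p {} 0 = 0"
        by (rule poly_eq_on_nats) (use p0[OF empty_lattice_polytope] empty in simp)
      then show ?thesis using coeff[of "{}" 0] s by simp
    qed
    have aq_val: "a q P + a q Q = a q (P \<union> Q) + a q (P \<inter> Q)"
      if PQ: "P \<in> lattice_polytopes" "Q \<in> lattice_polytopes" "P \<union> Q \<in> lattice_polytopes" "P \<inter> Q \<in> lattice_polytopes" for P Q
    proof -
      have "p P 0 + p Q 0 = p (P \<union> Q) 0 + p (P \<inter> Q) 0"
      proof (rule poly_eq_on_nats)
        fix k :: nat
        let ?t = "\<lambda>x. x + e k"
        have "inj ?t" by (auto intro: injI)
        note I = image_Int[OF this]
        have "z (?t ` P) + z (?t ` Q) = z (?t ` P \<union> ?t ` Q) + z (?t ` P \<inter> ?t ` Q)"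
          by (rule val) (simp_all only: image_Un[symmetric] I[symmetric] lattice_polytope_translate e PQ)
        then show "poly (p P 0 + p Q 0) (real k) = poly (p (P \<union> Q) 0 + p (P \<inter> Q) 0) (real k)"
          using PQ by (simp only: poly_add p0 image_Un I)
      qed
      then have "coeff (p P 0 + p Q 0) q = coeff (p (P \<union> Q) 0 + p (P \<inter> Q) 0) q" by simp
      then have "(a q P + a q Q) * s ^ q = (a q (P \<union> Q) + a q (P \<inter> Q)) * s ^ q"
        by (simp only: coeff_add coeff distrib_right)
      then show ?thesis by (rule mult_right_cancel[OF sq, THEN iffD1])
    qed
    have aq_trans: "a q ((\<lambda>x. x + y) ` P) = a q P" if P: "P \<in> lattice_polytopes" "y \<in> int_lattice" for P y
    proof -
      have "p ((\<lambda>x. x + y) ` P) 0 = p P (y \<bullet> u)"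
      proof (rule poly_eq_on_nats)
        fix k :: nat
        have "(\<lambda>x. x + e k) ` (\<lambda>x. x + y) ` P = (\<lambda>x. x + (y + e k)) ` P" by (simp add: image_image add.assoc)
        then show "poly (p ((\<lambda>x. x + y) ` P) 0) (real k) = poly (p P (y \<bullet> u)) (real k)"
          using p[OF P, of k] p0[OF lattice_polytope_translate[OF P], of k] by simp
      qed
      then have "coeff (p ((\<lambda>x. x + y) ` P) 0) q = coeff (p P (y \<bullet> u)) q" by simp
      then show ?thesis using s by (simp add: coeff)
    qed
    have aq_hom: "a q ((\<lambda>x. real k *\<^sub>R x) ` P) = real k ^ (CARD('n) + m) * a q P" if P: "P \<in> lattice_polytopes" "k > 0" for P k
    proof -
      let ?kP = "(\<lambda>x. real k *\<^sub>R x) ` P"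
      have kP: "?kP \<in> lattice_polytopes" by (rule lattice_polytope_scale[OF P(1)])
      let ?p = "\<lambda>P. \<Sum>j\<le>q. monom (a j P * s ^ j) j"
      have pp: "poly (?p P) (real t) = z ((\<lambda>x. x + e t) ` P)" if "P \<in> lattice_polytopes" for P t
        using cov'[OF that e(1)] e(2) by (simp add: poly_sum poly_monom power_mult_distrib mult_ac)
      \<comment> \<open>Both polynomials in \<open>t\<close> describe \<open>z\<close> on the k-fold
        dilate of P + e t, which is the dilate of P moved by \<open>e (k * t)\<close>. At t^q a
        factor k^q stands against k^(n + r), which leaves the degree n + r - q = n + m.\<close>
      have "(\<Sum>j\<le>q. monom (a j ?kP * (real k * s) ^ j) j) = smult (real k ^ (CARD('n) + r)) (?p P)"
      proof (rule poly_eq_on_nats)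
        fix t :: nat
        have "(\<lambda>x. x + e (k * t)) ` ?kP = (\<lambda>x. real k *\<^sub>R x) ` (\<lambda>x. x + e t) ` P"
          unfolding image_image by (intro image_cong refl) (simp add: e_def vec_eq_iff axis_def distrib_left)
        then have "z ((\<lambda>x. x + e (k * t)) ` ?kP) = real k ^ (CARD('n) + r) * z ((\<lambda>x. x + e t) ` P)"
          using hom[OF lattice_polytope_translate[OF P(1) e(1)] P(2)] by simp
        moreover have "z ((\<lambda>x. x + e (k * t)) ` ?kP) = poly (\<Sum>j\<le>q. monom (a j ?kP * (real k * s) ^ j) j) (real t)"
          using cov'[OF kP e(1)[of "k * t"]] e(2)[of "k * t"] by (simp add: poly_sum poly_monom power_mult_distrib mult_ac)
        ultimately show "poly (\<Sum>j\<le>q. monom (a j ?kP * (real k * s) ^ j) j) (real t) =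
            poly (smult (real k ^ (CARD('n) + r)) (?p P)) (real t)"
          using pp[OF P(1)] by simp
      qed
      then have "coeff (\<Sum>j\<le>q. monom (a j ?kP * (real k * s) ^ j) j) q = coeff (smult (real k ^ (CARD('n) + r)) (?p P)) q" by simp
      then have "a q ?kP * (real k * s) ^ q = real k ^ (CARD('n) + r) * (a q P * s ^ q)"
        by (simp add: coeff_sum)
      also have "real k ^ (CARD('n) + r) = real k ^ q * real k ^ (CARD('n) + m)" unfolding power_add[symmetric] q(2)[symmetric] by (simp add: add_ac)
      finally have "(real k ^ q * s ^ q) * a q ?kP = (real k ^ q * s ^ q) * (real k ^ (CARD('n) + m) * a q P)"
        by (simp only: power_mult_distrib mult_ac)
      moreover have "real k ^ q \<noteq> 0" using P(2) by simp
      then have "real k ^ q * s ^ q \<noteq> 0" using sq by (rule no_zero_divisors)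
      ultimately show ?thesis using mult_left_cancel by blast
    qed
    have "\<exists>\<psi>. hom_valuation (CARD('n) + m) \<psi> \<and> (\<forall>P\<in>lattice_polytopes. \<psi> P = a q P)"
    proof (rule extend_to_rational[where \<phi> = "a q" and d = "CARD('n) + m"])
      show "a q {} = 0" by (rule aq_empty)
      show "a q P + a q Q = a q (P \<union> Q) + a q (P \<inter> Q)"
        if "P \<in> lattice_polytopes" "Q \<in> lattice_polytopes" "P \<union> Q \<in> lattice_polytopes" "P \<inter> Q \<in> lattice_polytopes" for P Q
        using that by (rule aq_val)
      show "a q ((\<lambda>x. x + y) ` P) = a q P" if "P \<in> lattice_polytopes" "y \<in> int_lattice" for P y
        using that by (rule aq_trans)
      show "a q ((\<lambda>x. real k *\<^sub>R x) ` P) = real k ^ (CARD('n) + m) * a q P" if "P \<in> lattice_polytopes" "k > 0" for P k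
        using that by (rule aq_hom)
    qed
    then obtain \<psi> where \<psi>: "hom_valuation (CARD('n) + m) \<psi>" "\<forall>P\<in>lattice_polytopes. \<psi> P = a q P"
      by (elim exE conjE)
    \<comment> \<open>For m = 0, that is q = r, the degree is exactly n and the assumption on the
      cube enters.\<close>
    have "CARD('n) + m > CARD('n) \<or> CARD('n) + m = CARD('n) \<and> \<psi> unit_cube = 0"
      using cube \<psi>(2)[rule_format, OF unit_cube_lattice] q by (cases "m = 0") auto
    then have "a q P = 0" if "P \<in> lattice_polytopes" for P
      using hom_valuation_zero[OF \<psi>(1) _ lattice_rat_polytope[OF that]] \<psi>(2)[rule_format, OF that] by simp
    moreover have "j = q \<or> q < j" if "j \<le> r" "r < j + Suc m" for j using that q by linarith
    ultimately show ?case using van by metis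
  qed simp
  from this[of "Suc r"] have "a j P = 0" if "j \<le> r" for j using P that by simp
  then show ?thesis using cov[OF P int_lattice_arith(1)] by simp
qed

text \<open>With equal arguments all (p + q)! summands agree.\<close>

lemma sym_prod_diagonal: "sym_prod p q A B (\<lambda>_. u) = A (\<lambda>_. u) * B (\<lambda>_. u)"
proof -
  have "card {\<sigma>. \<sigma> permutes {..<p + q}} = fact (p + q)" by (rule card_permutations) auto
  then show ?thesis by (simp add: sym_prod_def)
qed

lemma sym_tensors_diff_scale:
  fixes A B :: "'n::finite tensor"
  assumes "A \<in> sym_tensors r" "B \<in> sym_tensors r"
  shows "(\<lambda>v. A v - c * B v) \<in> sym_tensors r"
  unfolding sym_tensors_def
proof (intro CollectI conjI allI impI)
  fix v w :: "nat \<Rightarrow> real ^ 'n" assume "\<forall>i<r. v i = w i"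
  then show "A v - c * B v = A w - c * B w"
    using sym_tensor_locality[OF assms(1), of v w] sym_tensor_locality[OF assms(2), of v w] by simp
next
  fix v :: "nat \<Rightarrow> real ^ 'n" and i assume i: "i < r"
  note A = sym_tensor_linear[OF assms(1) i, of v] and B = sym_tensor_linear[OF assms(2) i, of v]
  show "linear (\<lambda>x. A (v(i := x)) - c * B (v(i := x)))"
    by (rule linearI)
       (simp_all only: linear_add[OF A] linear_add[OF B] linear_scale[OF A] linear_scale[OF B] real_scaleR_def algebra_simps)
next
  fix v :: "nat \<Rightarrow> real ^ 'n" and \<sigma> assume "\<sigma> permutes {..<r}"
  then show "A (v \<circ> \<sigma>) - c * B (v \<circ> \<sigma>) = A v - c * B v"
    using sym_tensor_permute[OF assms(1)] sym_tensor_permute[OF assms(2)] by simp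
qed

lemma sym_tensor_zero:
  assumes "A \<in> sym_tensors r" "r \<ge> 1"
  shows "A (\<lambda>_. 0) = 0"
  using linear_0[OF sym_tensor_linear[OF assms(1), of 0 "\<lambda>_. 0"]] assms(2) by (simp add: fun_upd_idem)

theorem theorem27:
  fixes Z :: "(real ^ 'n) set \<Rightarrow> 'n tensor" and r :: nat
  assumes "CARD('n) \<ge> 2" and "r \<ge> 1"
    and "tensor_valuation r Z"
    and "translation_covariant r Z"
    and "homogeneous (CARD('n) + r) Z"
  shows "\<exists>c::real. \<forall>P\<in>lattice_polytopes. \<forall>v. Z P v = c * ehrhart_tensor r (CARD('n) + r) P v"
proof -
  obtain Zs :: "nat \<Rightarrow> (real ^ 'n) set \<Rightarrow> 'n tensor" where
    Zs: "\<And>j. j \<le> r \<Longrightarrow> Zs j \<in> lattice_polytopes \<rightarrow> sym_tensors j" and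
    cov: "\<And>P y v. P \<in> lattice_polytopes \<Longrightarrow> y \<in> int_lattice \<Longrightarrow> Z ((\<lambda>x. x + y) ` P) v =
       (\<Sum>j\<le>r. sym_prod (r - j) j (Zs (r - j) P) (tensor_power y j) v / fact j)"
    using assms(4) unfolding translation_covariant_def by blast
  \<comment> \<open>Tensors of rank 0 are constant, so the argument 0 is arbitrary. This
    \<open>c\<close> makes the rank 0 function of the difference vanish on the unit cube, where that
    of the leading moment is 1.\<close>
  define c where "c = Zs 0 unit_cube (\<lambda>_. 0)"
  have Zsym: "Z P \<in> sym_tensors r" if "P \<in> lattice_polytopes" for P
    using assms(3) that unfolding tensor_valuation_def by blast
  have diag: "Z P (\<lambda>_. u) = c * top_moment r P (\<lambda>_. u)" if P: "P \<in> lattice_polytopes" and u: "u \<noteq> 0" for P u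
  proof -
    define z where "z P = Z P (\<lambda>_. u) - c * top_moment r P (\<lambda>_. u)" for P
    \<comment> \<open>On diagonal arguments the symmetric products of the covariance formula are
      products; j! is moved into the coefficient.\<close>
    define a where "a j P = (Zs (r - j) P (\<lambda>_. u) - c * top_moment (r - j) P (\<lambda>_. u)) / fact j" for j P
    have "z P = 0"
    proof (rule covariant_valuation_zero[OF _ _ _ _ u _ P])
      show "z {} = 0" using assms(3) by (simp add: z_def tensor_valuation_def top_moment_empty)
      show "z P + z Q = z (P \<union> Q) + z (P \<inter> Q)"
        if PQ: "P \<in> lattice_polytopes" "Q \<in> lattice_polytopes" "P \<union> Q \<in> lattice_polytopes" "P \<inter> Q \<in> lattice_polytopes" for P Q
      proof -
        have "Z P (\<lambda>_. u) + Z Q (\<lambda>_. u) = Z (P \<union> Q) (\<lambda>_. u) + Z (P \<inter> Q) (\<lambda>_. u)"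
          using assms(3) PQ unfolding tensor_valuation_def by blast
        moreover have "c * (top_moment r P (\<lambda>_. u) + top_moment r Q (\<lambda>_. u)) =
            c * (top_moment r (P \<union> Q) (\<lambda>_. u) + top_moment r (P \<inter> Q) (\<lambda>_. u))"
          using top_moment_valuation[OF PQ, of r "\<lambda>_. u"] by simp
        ultimately show ?thesis by (simp add: z_def algebra_simps)
      qed
      show "z ((\<lambda>x. real k *\<^sub>R x) ` P) = real k ^ (CARD('n) + r) * z P" if "P \<in> lattice_polytopes" "k > 0" for P k
      proof -
        have "Z ((\<lambda>x. real k *\<^sub>R x) ` P) (\<lambda>_. u) = real k ^ (CARD('n) + r) * Z P (\<lambda>_. u)"
          using assms(5) that(1) unfolding homogeneous_def by blast
        then show ?thesis using top_moment_scale[OF that, of r "\<lambda>_. u"] by (simp add: z_def algebra_simps)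
      qed
      show "z ((\<lambda>x. x + y) ` P) = (\<Sum>j\<le>r. a j P * (y \<bullet> u) ^ j)" if Py: "P \<in> lattice_polytopes" "y \<in> int_lattice" for P y
      proof -
        have "Z ((\<lambda>x. x + y) ` P) (\<lambda>_. u) = (\<Sum>j\<le>r. Zs (r - j) P (\<lambda>_. u) * (y \<bullet> u) ^ j / fact j)"
          unfolding cov[OF Py] by (simp add: sym_prod_diagonal tensor_power_def)
        then show ?thesis
          by (simp add: z_def a_def top_moment_translate[OF Py] sum_distrib_left sum_subtractf[symmetric]
            diff_divide_distrib left_diff_distrib mult.assoc)
      qed
      have "Zs 0 unit_cube (\<lambda>_. u) = c"
        unfolding c_def using Zs[of 0] unit_cube_lattice by (intro sym_tensor_locality[of _ 0]) auto
      then show "a r unit_cube = 0" by (simp add: a_def top_moment_cube)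
    qed
    then show ?thesis by (simp add: z_def)
  qed
  have "Z P v = c * ehrhart_tensor r (CARD('n) + r) P v" if P: "P \<in> lattice_polytopes" for P v
  proof -
    have T: "top_moment r P \<in> sym_tensors r" by (rule ehrhart_tensor_top(2)[OF P assms(2)])
    \<comment> \<open>The case u = 0 is left over from \<open>diag\<close>; there both tensors
      vanish because the rank is positive.\<close>
    have "Z P (\<lambda>_. u) - c * top_moment r P (\<lambda>_. u) = 0" for u
      using diag[OF P, of u] sym_tensor_zero[OF Zsym[OF P] assms(2)] sym_tensor_zero[OF T assms(2)]
      by (cases "u = 0") auto
    then have "Z P v - c * top_moment r P v = 0"
      using sym_tensor_polarization[OF sym_tensors_diff_scale[OF Zsym[OF P] T]] by blast
    then show ?thesis using ehrhart_tensor_top(1)[OF P assms(2)] by simp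
  qed
  then show ?thesis by blast
qed

end
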